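(* Let $F\in \mathrm{Dom}(D)$ be such that $e^{sF}\in\mathrm{Dom}(D)$, $0\le s\le t_0$, for some $t_0>0$. Then $$P(F-E[F]\ge x)\le \exp\Big(\min_{0<t<t_0}\Big(\int_0^t h(s)\,ds-tx\Big)\Big),\qquad x>0,$$ where $$h(s)=\sup_{(\omega,\omega')\in\Omega^X\times\Omega^X}\left|\int_X \big(e^{sD_yF(\omega)}-1\big)\,D_yF(\omega')\,\nu(dy)\right|,\qquad s\in[0,t_0).$$ If moreover $h$ is nondecreasing and finite on $[0,t_0)$, then $$P(F-E[F]\ge x)\le\exp\left(-\int_0^x h^{-1}(s)\,ds\right),\qquad 0<x<h(t_0^-),$$ where $h^{-1}$ is the left-continuous inverse of $h$: $h^{-1}(x)=\inf\{t>0: h(t)\ge x\}$, $0<x<h(t_0^-)$.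
   Context: $X$ is a $\sigma$-compact metric space, $\nu$ a diffuse Radon measure on $X$, $\Omega^X$ is the space of configurations $\omega=\sum_{i=1}^N\epsilon_{t_i}$ (Radon measures that are sums of Dirac masses at pairwise distinct points $t_i\in X$, $N\in\mathbb N\cup\{\infty\}$), identified with their supports, and $P$ is the Poisson measure on $\Omega^X$ with intensity $\nu$; $E$ is expectation under $P$. The finite difference operator is $D_yF(\omega)=F(\omega\cup\{y\})-F(\omega)$ (defined $P\otimes\nu$-a.e.), and $\mathrm{Dom}(D)$ is the set of $F\in L^2(\Omega^X,P)$ such that $DF\in L^2(\Omega^X\times X,P\otimes\nu)$. The supremum over $\Omega^X$ may be taken as an essential supremum with respect to $P$. The minimum over $t$ is understood as an infimum. $h(t_0^-)$ is the left limit of $h$ at $t_0$. *)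

theory Defs
  imports "HOL-Probability.Probability"
begin

definition sigma_compact :: "'a::topological_space set \<Rightarrow> bool" where
  "sigma_compact S \<longleftrightarrow> (\<exists>K :: nat \<Rightarrow> 'a set. (\<forall>n. compact (K n)) \<and> (\<Union>n. K n) = S)"

text \<open>Radon: locally finite and inner regular with respect to compact sets. In a locally compact
  space, local finiteness is the same as finiteness on compact sets.\<close>

definition radon_measure :: "'a::metric_space measure \<Rightarrow> bool" where
  "radon_measure M \<longleftrightarrow> sets M = sets borel \<and>
     (\<forall>x. \<exists>U. open U \<and> x \<in> U \<and> emeasure M U < \<infinity>) \<and>
     (\<forall>B\<in>sets borel. emeasure M B = (SUP K\<in>{K. compact K \<and> K \<subseteq> B}. emeasure M K))"

definition diffuse :: "'a measure \<Rightarrow> bool" where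
  "diffuse M \<longleftrightarrow> (\<forall>x. emeasure M {x} = 0)"

text \<open>The sum of the Dirac masses at the points of a set, as the image on the Borel sets of the
  counting measure on that set.\<close>

definition dirac_sum :: "'a::metric_space set \<Rightarrow> 'a measure" where
  "dirac_sum \<omega> = distr (count_space \<omega>) borel (\<lambda>t. t)"

lemma emeasure_dirac_sum:
  assumes "B \<in> sets borel"
  shows "emeasure (dirac_sum \<omega>) B = (\<integral>\<^sup>+ t. emeasure (return borel t) B \<partial>count_space \<omega>)"
proof -
  have "emeasure (dirac_sum \<omega>) B = emeasure (count_space \<omega>) (B \<inter> \<omega>)"
    unfolding dirac_sum_def by (subst emeasure_distr) (use assms in auto)
  also have "\<dots> = (\<integral>\<^sup>+ t. indicator (B \<inter> \<omega>) t \<partial>count_space \<omega>)"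
    by simp
  also have "\<dots> = (\<integral>\<^sup>+ t. emeasure (return borel t) B \<partial>count_space \<omega>)"
    using assms by (intro nn_integral_cong) (auto simp: indicator_def)
  finally show ?thesis .
qed

text \<open>A configuration is represented by its support.\<close>

definition config_space :: "'a::metric_space set set" where
  "config_space = {\<omega>. countable \<omega> \<and> radon_measure (dirac_sum \<omega>)}"

text \<open>The configuration space with the sigma-algebra generated by the counting maps
  \<open>\<omega> \<mapsto> \<omega>(B)\<close>, \<open>B\<close> Borel.\<close>

definition config_algebra :: "'a::metric_space set measure" where
  "config_algebra = sigma config_space
     {{\<omega> \<in> config_space. emeasure (dirac_sum \<omega>) B \<in> A} | B A. B \<in> sets borel \<and> A \<in> sets borel}"

text \<open>The Poisson measure with intensity \<open>\<nu>\<close> is the probability measure under which the counts on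
  disjoint sets of finite intensity are independent and Poisson distributed.\<close>

definition poisson_measure :: "'a::metric_space measure \<Rightarrow> 'a set measure \<Rightarrow> bool" where
  "poisson_measure \<nu> P \<longleftrightarrow> prob_space P \<and> sets P = sets config_algebra \<and>
     (\<forall>(n::nat) B k. (\<forall>i<n. B i \<in> sets borel \<and> emeasure \<nu> (B i) < \<infinity>) \<longrightarrow>
        disjoint_family_on B {..<n} \<longrightarrow>
        measure P {\<omega> \<in> space P. \<forall>i<n. emeasure (dirac_sum \<omega>) (B i) = of_nat (k i)} =
          (\<Prod>i<n. measure \<nu> (B i) ^ k i / fact (k i) * exp (- measure \<nu> (B i))))"

definition diff_op :: "('a set \<Rightarrow> real) \<Rightarrow> 'a \<Rightarrow> 'a set \<Rightarrow> real" where
  "diff_op F y \<omega> = F (\<omega> \<union> {y}) - F \<omega>"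

definition square_integrable :: "'a measure \<Rightarrow> ('a \<Rightarrow> real) \<Rightarrow> bool" where
  "square_integrable M f \<longleftrightarrow> f \<in> borel_measurable M \<and> integrable M (\<lambda>x. (f x)\<^sup>2)"

definition dom_diff :: "'a measure \<Rightarrow> 'a set measure \<Rightarrow> ('a set \<Rightarrow> real) set" where
  "dom_diff \<nu> P = {F. square_integrable P F \<and>
     square_integrable (P \<Otimes>\<^sub>M \<nu>) (\<lambda>(\<omega>, y). diff_op F y \<omega>)}"

text \<open>The quantity under the supremum defining \<open>h(s)\<close>. If \<open>F\<close> and \<open>exp (s F)\<close> belong to
  \<open>dom_diff \<nu> P\<close>, then the integral converges absolutely for almost all pairs of configurations,
  by Cauchy-Schwarz; the value infinity is used for the remaining pairs.\<close>

definition diff_pairing ::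
  "'a measure \<Rightarrow> ('a set \<Rightarrow> real) \<Rightarrow> real \<Rightarrow> 'a set \<Rightarrow> 'a set \<Rightarrow> ennreal" where
  "diff_pairing \<nu> F s \<omega> \<omega>' =
     (let g = (\<lambda>y. (exp (s * diff_op F y \<omega>) - 1) * diff_op F y \<omega>')
      in if integrable \<nu> g then ennreal \<bar>\<integral>y. g y \<partial>\<nu>\<bar> else \<infinity>)"

text \<open>The two readings of the supremum over pairs of configurations: over all pairs, which depends
  on the choice of the function \<open>F\<close> in its class modulo null sets, and the essential supremum,
  which does not.\<close>

definition h_sup :: "'a::metric_space measure \<Rightarrow> ('a set \<Rightarrow> real) \<Rightarrow> real \<Rightarrow> ennreal" where
  "h_sup \<nu> F s = (SUP (\<omega>, \<omega>') \<in> config_space \<times> config_space. diff_pairing \<nu> F s \<omega> \<omega>')"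

definition h_esssup ::
  "'a measure \<Rightarrow> 'a set measure \<Rightarrow> ('a set \<Rightarrow> real) \<Rightarrow> real \<Rightarrow> ennreal" where
  "h_esssup \<nu> P F s = esssup (P \<Otimes>\<^sub>M P) (\<lambda>(\<omega>, \<omega>'). diff_pairing \<nu> F s \<omega> \<omega>')"

text \<open>The left-continuous inverse of a function with domain \<open>{0..<t0}\<close>.\<close>

definition left_inverse :: "real \<Rightarrow> (real \<Rightarrow> ennreal) \<Rightarrow> real \<Rightarrow> real" where
  "left_inverse t0 h x = Inf {t. 0 < t \<and> t < t0 \<and> ennreal x \<le> h t}"

definition exp_ereal :: "ereal \<Rightarrow> ereal" where
  "exp_ereal x = (case x of ereal r \<Rightarrow> ereal (exp r) | PInfty \<Rightarrow> \<infinity> | MInfty \<Rightarrow> 0)"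

end

theory Submission
  imports Defs
begin

text \<open>
  Herbst's argument reduces both bounds to the covariance estimate
  \<open>Cov(F, exp(sF)) \<le> h(s) E exp(sF)\<close>. On Poisson space
  \<open>Cov(F, G) = E \<integral> D\<^sub>yG(\<omega>) D\<^sub>yF(\<omega>') \<nu>(dy)\<close> for a coupling \<open>(\<omega>, \<omega>')\<close> of \<open>P\<close> with itself, and
  \<open>D\<^sub>y exp(sF) = exp(sF) (exp(s D\<^sub>yF) - 1)\<close>. A bound that holds for \<open>P \<otimes> P\<close>-almost all pairs is only
  of use if the coupling is absolutely continuous with respect to \<open>P \<otimes> P\<close>, which the
  Ornstein-Uhlenbeck coupling is not: its two configurations share points. So the covariance
  identity is applied to the conditional expectations of \<open>F\<close> and \<open>G\<close> given the numbers of points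
  in finitely many cells. There the coupling is discrete and lifts to a density with respect to
  \<open>P \<otimes> P\<close>. By the Mecke formula the discrete gradients are the cell averages of \<open>DF\<close> and \<open>DG\<close>;
  they converge in \<open>L\<^sup>2\<close> when the cells are refined, and the bilinear forms of all self-couplings
  are uniformly continuous on \<open>L\<^sup>2\<close>.
\<close>

section \<open>A discrete covariance identity\<close>

text \<open>Why covariances: the derivative of \<open>L(t) = ln E exp(tF) - t E F\<close> is
  \<open>Cov(F, exp(tF)) / E exp(tF)\<close>, so a bound by \<open>h\<close> integrates to a bound
  on \<open>L\<close>, and Markov's inequality for \<open>exp(tF)\<close> turns that into a tail
  bound; the second estimate takes \<open>t\<close> to be the inverse of \<open>h\<close> at
  \<open>x\<close>. Why profiles help: a coupling of two laws on a countable set charges a pair of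
  atoms only if both atoms have positive mass, so it always has a density with respect to the
  product law. No limit of the couplings is taken, since it could be singular. At each level the
  almost sure bound is applied to the gradients of \<open>F\<close> and \<open>exp(sF)\<close>
  themselves, and only the numbers so obtained pass to the limit. This works because a function of
  one coordinate has the same L2 norm under every self-coupling, so approximation errors are uniform
  in the level. The discrete identity is proved in [0, infinity], where sums may be rearranged
  freely; it is an equation between sums, and subtraction enters only for bounded functions.\<close>

text \<open>
  Two generators on pairs of multisets, with weights \<open>l\<close>: \<open>raise_op\<close> adds a common point to both or
  does nothing, \<open>split_op\<close> adds a point to one of them. Both have the marginal \<open>mix_op\<close>. If
  \<open>\<Lambda> = \<Sum>l\<close>, then \<open>exp(raise_op - 2\<Lambda>)\<close> at the empty pair is the law of \<open>(N, N)\<close> for a Poisson vector \<open>N\<close>,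
  and \<open>exp(split_op - 2\<Lambda>)\<close> is the law of two independent copies. As the generators commute, the
  difference of the exponentials is \<open>exp(-2\<Lambda>)\<close> times the sum over \<open>n\<close> of
  \<open>(\<Sum>j\<le>n. raise_op\<^sup>j split_op\<^sup>n\<^sup>-\<^sup>j) / (n + 1)!\<close>, applied to
  \<open>raise_op - split_op\<close>, which takes \<open>f \<otimes> g\<close> to \<open>\<Sum>i. l i D\<^sub>if \<otimes> D\<^sub>ig\<close>.
\<close>

definition raise_op :: "'i set \<Rightarrow> ('i \<Rightarrow> ennreal) \<Rightarrow> ('i multiset \<times> 'i multiset \<Rightarrow> ennreal) \<Rightarrow> 'i multiset \<times> 'i multiset \<Rightarrow> ennreal"
  where "raise_op I l \<Phi> = (\<lambda>(a, b). (\<Sum>i\<in>I. l i * \<Phi> (add_mset i a, add_mset i b)) + (\<Sum>i\<in>I. l i) * \<Phi> (a, b))"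

definition split_op :: "'i set \<Rightarrow> ('i \<Rightarrow> ennreal) \<Rightarrow> ('i multiset \<times> 'i multiset \<Rightarrow> ennreal) \<Rightarrow> 'i multiset \<times> 'i multiset \<Rightarrow> ennreal"
  where "split_op I l \<Phi> = (\<lambda>(a, b). (\<Sum>i\<in>I. l i * \<Phi> (add_mset i a, b)) + (\<Sum>i\<in>I. l i * \<Phi> (a, add_mset i b)))"

definition mix_op :: "'i set \<Rightarrow> ('i \<Rightarrow> ennreal) \<Rightarrow> ('i multiset \<Rightarrow> ennreal) \<Rightarrow> 'i multiset \<Rightarrow> ennreal"
  where "mix_op I l f = (\<lambda>a. (\<Sum>i\<in>I. l i * f (add_mset i a)) + (\<Sum>i\<in>I. l i) * f a)"

section \<open>Operators given by a kernel\<close>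

text \<open>\<open>Op\<close> is an integral operator against counting measure, with kernel
  \<open>Op (indicator {r}) q\<close>. This packs linearity and continuity along increasing
  sequences into one equation, with no summability condition. It allows a measure given by its point
  masses, such as \<open>coupling\<close>, to be evaluated on every function. Source and target
  types differ so that evaluation at a point is covered.\<close>

definition sigma_linear :: "(('p \<Rightarrow> ennreal) \<Rightarrow> 'q \<Rightarrow> ennreal) \<Rightarrow> bool" where
  "sigma_linear Op \<longleftrightarrow> (\<forall>(\<Phi> :: 'p \<Rightarrow> ennreal) q. Op \<Phi> q = (\<integral>\<^sup>+ r. \<Phi> r * Op (indicator {r}) q \<partial>count_space UNIV))"

lemma sigma_linearI:
  assumes "\<And>\<Phi> q. Op \<Phi> q = (\<integral>\<^sup>+ r. \<Phi> r * Op (indicator {r}) q \<partial>count_space UNIV)"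
  shows "sigma_linear Op"
  unfolding sigma_linear_def using assms by blast

lemma sigma_linearD:
  "sigma_linear Op \<Longrightarrow> Op \<Phi> q = (\<integral>\<^sup>+ r. \<Phi> r * Op (indicator {r}) q \<partial>count_space UNIV)"
  unfolding sigma_linear_def by blast

lemma nn_integral_count_space_indicator_single:
  "(\<integral>\<^sup>+ r. f r * indicator {r} q \<partial>count_space UNIV) = (f q :: ennreal)"
proof -
  have "(\<integral>\<^sup>+ r. f r * indicator {r} q \<partial>count_space UNIV) = (\<integral>\<^sup>+ r. f r * indicator {q} r \<partial>count_space UNIV)"
    by (intro nn_integral_cong) (auto simp: indicator_def)
  also have "\<dots> = f q" by (subst nn_integral_count_space'[of "{q}"]) auto
  finally show ?thesis .
qed

lemma sigma_linear_id: "sigma_linear (\<lambda>\<Phi>. \<Phi>)"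
  by (intro sigma_linearI) (simp add: nn_integral_count_space_indicator_single)

text \<open>Composition of kernels: the two sums are interchanged by Tonelli for counting
  measures.\<close>

lemma sigma_linear_comp:
  assumes A: "sigma_linear A" and B: "sigma_linear B"
  shows "sigma_linear (\<lambda>\<Phi>. A (B \<Phi>))"
proof (rule sigma_linearI)
  fix \<Phi> q
  have "A (B \<Phi>) q = (\<integral>\<^sup>+ r. (\<integral>\<^sup>+ s. \<Phi> s * B (indicator {s}) r \<partial>count_space UNIV) * A (indicator {r}) q \<partial>count_space UNIV)"
    by (subst sigma_linearD[OF A]) (intro nn_integral_cong arg_cong2[where f="(*)"] sigma_linearD[OF B] refl)
  also have "\<dots> = (\<integral>\<^sup>+ r. \<integral>\<^sup>+ s. \<Phi> s * B (indicator {s}) r * A (indicator {r}) q \<partial>count_space UNIV \<partial>count_space UNIV)"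
    by (intro nn_integral_cong) (simp add: nn_integral_multc)
  also have "\<dots> = (\<integral>\<^sup>+ s. \<integral>\<^sup>+ r. \<Phi> s * B (indicator {s}) r * A (indicator {r}) q \<partial>count_space UNIV \<partial>count_space UNIV)"
    using nn_integral_fst_count_space[of "\<lambda>(r, s). \<Phi> s * B (indicator {s}) r * A (indicator {r}) q"]
      nn_integral_snd_count_space[of "\<lambda>(r, s). \<Phi> s * B (indicator {s}) r * A (indicator {r}) q"] by simp
  also have "\<dots> = (\<integral>\<^sup>+ s. \<Phi> s * A (B (indicator {s})) q \<partial>count_space UNIV)"
    by (intro nn_integral_cong) (subst sigma_linearD[OF A], simp add: mult.assoc nn_integral_cmult)
  finally show "A (B \<Phi>) q = \<dots>" .
qed

lemma sigma_linear_add: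
  assumes A: "sigma_linear A" and B: "sigma_linear B"
  shows "sigma_linear (\<lambda>\<Phi> q. A \<Phi> q + B \<Phi> q)"
proof (rule sigma_linearI)
  fix \<Phi> q
  show "A \<Phi> q + B \<Phi> q = (\<integral>\<^sup>+ r. \<Phi> r * (A (indicator {r}) q + B (indicator {r}) q) \<partial>count_space UNIV)"
    using sigma_linearD[OF A, of \<Phi> q] sigma_linearD[OF B, of \<Phi> q]
    by (simp add: distrib_left nn_integral_add)
qed

lemma sigma_linear_cmult:
  assumes A: "sigma_linear A"
  shows "sigma_linear (\<lambda>\<Phi> q. c * A \<Phi> q)"
proof (rule sigma_linearI)
  fix \<Phi> q
  show "c * A \<Phi> q = (\<integral>\<^sup>+ r. \<Phi> r * (c * A (indicator {r}) q) \<partial>count_space UNIV)"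
    using sigma_linearD[OF A, of \<Phi> q]
    by (simp add: mult.left_commute[of _ c] nn_integral_cmult)
qed

lemma sigma_linear_sum:
  assumes A: "\<And>j. j \<in> J \<Longrightarrow> sigma_linear (A j)"
  shows "sigma_linear (\<lambda>\<Phi> q. \<Sum>j\<in>J. A j \<Phi> q)"
proof (rule sigma_linearI)
  fix \<Phi> q
  have "(\<Sum>j\<in>J. A j \<Phi> q) = (\<Sum>j\<in>J. \<integral>\<^sup>+ r. \<Phi> r * A j (indicator {r}) q \<partial>count_space UNIV)"
    by (intro sum.cong refl sigma_linearD A)
  then show "(\<Sum>j\<in>J. A j \<Phi> q) = (\<integral>\<^sup>+ r. \<Phi> r * (\<Sum>j\<in>J. A j (indicator {r}) q) \<partial>count_space UNIV)"
    by (simp add: sum_distrib_left nn_integral_sum)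
qed

lemma sigma_linear_suminf:
  assumes A: "\<And>j::nat. sigma_linear (A j)"
  shows "sigma_linear (\<lambda>\<Phi> q. \<Sum>j. A j \<Phi> q)"
proof (rule sigma_linearI)
  fix \<Phi> q
  have "(\<Sum>j. A j \<Phi> q) = (\<Sum>j. \<integral>\<^sup>+ r. \<Phi> r * A j (indicator {r}) q \<partial>count_space UNIV)"
    by (intro suminf_cong sigma_linearD A)
  then show "(\<Sum>j. A j \<Phi> q) = (\<integral>\<^sup>+ r. \<Phi> r * (\<Sum>j. A j (indicator {r}) q) \<partial>count_space UNIV)"
    by (simp add: nn_integral_suminf[symmetric])
qed

lemma sigma_linear_shift: "sigma_linear (\<lambda>\<Phi> q. \<Phi> (s q))"
  by (intro sigma_linearI) (simp add: nn_integral_count_space_indicator_single)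

lemma sigma_linear_funpow:
  fixes A :: "('p \<Rightarrow> ennreal) \<Rightarrow> 'p \<Rightarrow> ennreal"
  assumes "sigma_linear A"
  shows "sigma_linear (A ^^ n)"
  using assms
proof (induction n)
  case 0
  have "A ^^ 0 = (\<lambda>\<Phi>. \<Phi>)" by (simp add: fun_eq_iff)
  then show ?case by (simp only: sigma_linear_id)
next
  case (Suc n) then show ?case using sigma_linear_comp[of A "A ^^ n"] by (simp add: comp_def)
qed

lemma sigma_linear_distrib:
  assumes A: "sigma_linear A"
  shows "A (\<lambda>p. \<Sum>j\<in>J. c j * g j p) q = (\<Sum>j\<in>J. c j * A (g j) q)"
proof -
  have "A (\<lambda>p. \<Sum>j\<in>J. c j * g j p) q = (\<integral>\<^sup>+ r. (\<Sum>j\<in>J. c j * (g j r * A (indicator {r}) q)) \<partial>count_space UNIV)"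
    by (subst sigma_linearD[OF A]) (simp add: sum_distrib_right mult.assoc)
  also have "\<dots> = (\<Sum>j\<in>J. c j * (\<integral>\<^sup>+ r. (g j r * A (indicator {r}) q) \<partial>count_space UNIV))"
    by (simp add: nn_integral_sum nn_integral_cmult)
  also have "\<dots> = (\<Sum>j\<in>J. c j * A (g j) q)"
    by (intro sum.cong refl arg_cong2[where f="(*)"] sigma_linearD[OF A, symmetric])
  finally show ?thesis .
qed

lemma sigma_linear_add_arg:
  assumes A: "sigma_linear A"
  shows "A (\<lambda>p. f p + g p) q = A f q + A g q"
proof -
  have "A (\<lambda>p. f p + g p) q = (\<integral>\<^sup>+ r. f r * A (indicator {r}) q + g r * A (indicator {r}) q \<partial>count_space UNIV)"
    by (subst sigma_linearD[OF A]) (simp add: distrib_right)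
  then show ?thesis using sigma_linearD[OF A, of f q] sigma_linearD[OF A, of g q] by (simp add: nn_integral_add)
qed

section \<open>The two generators: commutation and marginals\<close>

lemma sigma_linear_raise_op: "sigma_linear (raise_op I l)"
proof -
  have "sigma_linear (\<lambda>\<Phi> q. (\<Sum>i\<in>I. l i * \<Phi> (add_mset i (fst q), add_mset i (snd q))) + (\<Sum>i\<in>I. l i) * \<Phi> (fst q, snd q))"
    by (intro sigma_linear_add sigma_linear_sum sigma_linear_cmult sigma_linear_shift)
  moreover have "raise_op I l = (\<lambda>\<Phi> q. (\<Sum>i\<in>I. l i * \<Phi> (add_mset i (fst q), add_mset i (snd q))) + (\<Sum>i\<in>I. l i) * \<Phi> (fst q, snd q))"
    by (auto simp: raise_op_def fun_eq_iff)
  ultimately show ?thesis by simp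
qed

lemma sigma_linear_split_op: "sigma_linear (split_op I l)"
proof -
  have "sigma_linear (\<lambda>\<Phi> q. (\<Sum>i\<in>I. l i * \<Phi> (add_mset i (fst q), snd q)) + (\<Sum>i\<in>I. l i * \<Phi> (fst q, add_mset i (snd q))))"
    by (intro sigma_linear_add sigma_linear_sum sigma_linear_cmult sigma_linear_shift)
  moreover have "split_op I l = (\<lambda>\<Phi> q. (\<Sum>i\<in>I. l i * \<Phi> (add_mset i (fst q), snd q)) + (\<Sum>i\<in>I. l i * \<Phi> (fst q, add_mset i (snd q))))"
    by (auto simp: split_op_def fun_eq_iff)
  ultimately show ?thesis by simp
qed

text \<open>Both generators only insert points, and insertions commute. The order affects only which
  summation index belongs to which operator, so the double sums agree after the indices are
  exchanged.\<close>

lemma raise_split_commute: "raise_op I l (split_op I l \<Phi>) = split_op I l (raise_op I l \<Phi>)"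
proof (rule ext, clarify)
  fix a b
  have sw: "(\<Sum>i\<in>I. \<Sum>j\<in>I. l i * (l j * g i j)) = (\<Sum>i\<in>I. \<Sum>j\<in>I. l i * (l j * g j i))" for g :: "_ \<Rightarrow> _ \<Rightarrow> ennreal"
    by (subst sum.swap) (simp add: mult.left_commute)
  show "raise_op I l (split_op I l \<Phi>) (a, b) = split_op I l (raise_op I l \<Phi>) (a, b)"
    unfolding raise_op_def split_op_def
    using sw[of "\<lambda>i j. \<Phi> (add_mset j (add_mset i a), add_mset i b)"] sw[of "\<lambda>i j. \<Phi> (add_mset i a, add_mset j (add_mset i b))"]
    by (simp add: sum_distrib_left distrib_left sum.distrib add_mset_commute mult.left_commute ac_simps)
qed

lemma split_funpow_raise: "(split_op I l ^^ n) (raise_op I l \<Phi>) = raise_op I l ((split_op I l ^^ n) \<Phi>)"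
  by (induction n) (simp_all add: raise_split_commute)

lemma raise_op_fst: "raise_op I l (\<lambda>p. f (fst p)) = (\<lambda>p. mix_op I l f (fst p))"
  by (auto simp: raise_op_def mix_op_def)

lemma raise_op_snd: "raise_op I l (\<lambda>p. f (snd p)) = (\<lambda>p. mix_op I l f (snd p))"
  by (auto simp: raise_op_def mix_op_def)

lemma split_op_fst: "split_op I l (\<lambda>p. f (fst p)) = (\<lambda>p. mix_op I l f (fst p))"
  by (auto simp: split_op_def mix_op_def sum_distrib_right)

lemma split_op_snd: "split_op I l (\<lambda>p. f (snd p)) = (\<lambda>p. mix_op I l f (snd p))"
  by (auto simp: split_op_def mix_op_def sum_distrib_right add.commute)

lemma raise_funpow_fst: "(raise_op I l ^^ n) (\<lambda>p. f (fst p)) = (\<lambda>p. (mix_op I l ^^ n) f (fst p))"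
  by (induction n) (simp_all add: raise_op_fst)

lemma raise_funpow_snd: "(raise_op I l ^^ n) (\<lambda>p. f (snd p)) = (\<lambda>p. (mix_op I l ^^ n) f (snd p))"
  by (induction n) (simp_all add: raise_op_snd)

lemma split_funpow_fst: "(split_op I l ^^ n) (\<lambda>p. f (fst p)) = (\<lambda>p. (mix_op I l ^^ n) f (fst p))"
  by (induction n) (simp_all add: split_op_fst)

lemma split_funpow_snd: "(split_op I l ^^ n) (\<lambda>p. f (snd p)) = (\<lambda>p. (mix_op I l ^^ n) f (snd p))"
  by (induction n) (simp_all add: split_op_snd)

text \<open>\<open>raise_op\<close> keeps equal components equal and acts on the diagonal as
  \<open>mix_op\<close>; hence its exponential describes the pair (N, N).\<close>

lemma raise_funpow_diag: "(raise_op I l ^^ n) \<Phi> (a, a) = (mix_op I l ^^ n) (\<lambda>k. \<Phi> (k, k)) a"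
  by (induction n arbitrary: a) (simp_all add: raise_op_def mix_op_def)

text \<open>With \<open>X = raise_op\<close> and \<open>Y = split_op\<close> this is the integral
  over u in [0, 1] of \<open>exp(u X + (1 - u) Y)\<close> at the empty pair: the Beta integrals of
  \<open>u^j (1 - u)^(n - j)\<close> turn the binomial coefficients into the equal weights 1 / (n +
  1)!. Up to normalization it is the law of a pair with a common Poisson part of means u l and
  independent parts of means (1 - u) l, for uniform u: the Ornstein-Uhlenbeck coupling averaged over
  u = exp(-time).\<close>

definition ladder :: "'i set \<Rightarrow> ('i \<Rightarrow> ennreal) \<Rightarrow> ('i multiset \<times> 'i multiset \<Rightarrow> ennreal) \<Rightarrow> ennreal" where
  "ladder I l \<Phi> = (\<Sum>n. (\<Sum>j\<le>n. (raise_op I l ^^ j) ((split_op I l ^^ (n - j)) \<Phi>) ({#}, {#})) / fact (Suc n))"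

text \<open>The factorization of \<open>X^(n+1) - Y^(n+1)\<close> for commuting \<open>X\<close> and
  \<open>Y\<close>, divided by (n + 1)! and summed. Negative terms stand on the other side, as
  subtraction is truncated in \<open>ennreal\<close>.\<close>

lemma ladder_telescope:
  "(\<Sum>n. (raise_op I l ^^ n) \<Phi> ({#}, {#}) / fact n) + ladder I l (split_op I l \<Phi>)
   = (\<Sum>n. (split_op I l ^^ n) \<Phi> ({#}, {#}) / fact n) + ladder I l (raise_op I l \<Phi>)"
proof -
  let ?X = "raise_op I l" and ?Y = "split_op I l" and ?o = "({#}, {#}) :: 'a multiset \<times> 'a multiset"
  define W where "W n j = (?X ^^ j) ((?Y ^^ (n - j)) \<Phi>) ?o" for n j
  have sX: "(\<Sum>j\<le>n. (?X ^^ j) ((?Y ^^ (n - j)) (?X \<Phi>)) ?o) = (\<Sum>j\<le>n. W (Suc n) (Suc j))" for n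
    by (intro sum.cong refl) (simp add: W_def split_funpow_raise funpow_swap1)
  have sY: "(\<Sum>j\<le>n. (?X ^^ j) ((?Y ^^ (n - j)) (?Y \<Phi>)) ?o) = (\<Sum>j\<le>n. W (Suc n) j)" for n
    by (intro sum.cong refl) (simp add: W_def Suc_diff_le funpow_swap1)
  \<comment> \<open>By \<open>sX\<close> and \<open>sY\<close> the inner sums run over the same
    family \<open>W (Suc n)\<close>, once over indices 1 to n + 1 and once over 0 to n. They differ
    in the two end terms, which are the pure powers.\<close>
  have step: "(?X ^^ Suc n) \<Phi> ?o + (\<Sum>j\<le>n. (?X ^^ j) ((?Y ^^ (n - j)) (?Y \<Phi>)) ?o)
     = (?Y ^^ Suc n) \<Phi> ?o + (\<Sum>j\<le>n. (?X ^^ j) ((?Y ^^ (n - j)) (?X \<Phi>)) ?o)" for n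
  proof -
    have "(?X ^^ Suc n) \<Phi> ?o = W (Suc n) (Suc n)" "(?Y ^^ Suc n) \<Phi> ?o = W (Suc n) 0"
      by (simp_all add: W_def)
    then show ?thesis unfolding sX sY
      using sum.atMost_Suc[of "W (Suc n)" n] sum.atMost_Suc_shift[of "W (Suc n)" n] by (simp add: add.commute)
  qed
  have sp: "(\<Sum>n. (A ^^ n) \<Phi> ?o / fact n) = \<Phi> ?o + (\<Sum>n. (A ^^ Suc n) \<Phi> ?o / fact (Suc n))"
    for A :: "('a multiset \<times> 'a multiset \<Rightarrow> ennreal) \<Rightarrow> 'a multiset \<times> 'a multiset \<Rightarrow> ennreal"
    using suminf_offset[of "\<lambda>n. (A ^^ n) \<Phi> ?o / fact n" 1] by (simp add: divide_ennreal_def)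
  have gen: "(\<Sum>n. (A ^^ n) \<Phi> ?o / fact n) + ladder I l \<Psi>
    = \<Phi> ?o + (\<Sum>n. ((A ^^ Suc n) \<Phi> ?o + (\<Sum>j\<le>n. (?X ^^ j) ((?Y ^^ (n - j)) \<Psi>) ?o)) / fact (Suc n))"
    for A :: "('a multiset \<times> 'a multiset \<Rightarrow> ennreal) \<Rightarrow> 'a multiset \<times> 'a multiset \<Rightarrow> ennreal" and \<Psi>
    unfolding sp ladder_def add.assoc
    by (simp only: suminf_add[OF summableI summableI] divide_ennreal_def distrib_right)
  show ?thesis unfolding gen step ..
qed

lemma sigma_linear_ladder: "sigma_linear (\<lambda>\<Phi> (q::unit). ladder I l \<Phi>)"
proof -
  have "sigma_linear (\<lambda>\<Phi> (q::unit). (\<Sum>j\<le>n. (raise_op I l ^^ j) ((split_op I l ^^ (n - j)) \<Phi>) ({#}, {#})))" for n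
    by (intro sigma_linear_sum
      sigma_linear_comp[where A="\<lambda>\<Phi> q. \<Phi> ({#}, {#})" and B="\<lambda>\<Phi>. (raise_op I l ^^ j) ((split_op I l ^^ (n - j)) \<Phi>)" for j]
      sigma_linear_comp[where A="raise_op I l ^^ j" and B="split_op I l ^^ (n - j)" for j]
      sigma_linear_shift sigma_linear_funpow sigma_linear_raise_op sigma_linear_split_op)
  then have "sigma_linear (\<lambda>\<Phi> (q::unit). \<Sum>n. (1 / fact (Suc n)) * (\<Sum>j\<le>n. (raise_op I l ^^ j) ((split_op I l ^^ (n - j)) \<Phi>) ({#}, {#})))"
    by (intro sigma_linear_suminf sigma_linear_cmult)
  then show ?thesis by (simp add: ladder_def divide_ennreal_def mult.commute)
qed

lemma sum_fact_Suc: "(\<Sum>j\<le>n. x) / fact (Suc n) = (x :: ennreal) / fact n"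
proof -
  have f: "fact m = ennreal (fact m)" for m :: nat
    by (metis ennreal_of_nat_eq_real_of_nat of_nat_fact)
  have "(\<Sum>j\<le>n. x) / fact (Suc n) = ennreal (of_nat (Suc n)) * x / (ennreal (of_nat (Suc n)) * fact n)"
    by (simp add: ennreal_of_nat_eq_real_of_nat)
  also have "\<dots> = ennreal (of_nat (Suc n)) * x * (inverse (ennreal (of_nat (Suc n))) * inverse (fact n))"
    unfolding f divide_ennreal_def by (subst ennreal_inverse_mult) simp_all
  also have "\<dots> = (ennreal (of_nat (Suc n)) * inverse (ennreal (of_nat (Suc n)))) * (x * inverse (fact n))"
    by (simp only: ac_simps)
  also have "ennreal (of_nat (Suc n)) * inverse (ennreal (of_nat (Suc n))) = 1"
    by (simp add: inverse_ennreal flip: ennreal_mult del: of_nat_Suc)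
  finally show ?thesis by (simp add: divide_ennreal_def)
qed

text \<open>On functions of one coordinate both generators act as \<open>mix_op\<close>, so all n +
  1 summands coincide and 1 / (n + 1)! becomes 1 / n!. This gives \<open>coupling\<close> the
  correct marginal.\<close>

lemma ladder_fst: "ladder I l (\<lambda>p. f (fst p)) = (\<Sum>n. (mix_op I l ^^ n) f {#} / fact n)"
proof -
  have "(raise_op I l ^^ j) ((split_op I l ^^ (n - j)) (\<lambda>p. f (fst p))) ({#}, {#}) = (mix_op I l ^^ n) f {#}" if "j \<le> n" for j n
    unfolding split_funpow_fst raise_funpow_fst using funpow_add[of j "n - j" "mix_op I l"] that by simp
  then have "(\<Sum>j\<le>n. (raise_op I l ^^ j) ((split_op I l ^^ (n - j)) (\<lambda>p. f (fst p))) ({#}, {#})) = (\<Sum>j\<le>n. (mix_op I l ^^ n) f {#})" for n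
    by (intro sum.cong) auto
  then show ?thesis unfolding ladder_def by (simp only: sum_fact_Suc)
qed

lemma ladder_snd: "ladder I l (\<lambda>p. f (snd p)) = (\<Sum>n. (mix_op I l ^^ n) f {#} / fact n)"
proof -
  have "(raise_op I l ^^ j) ((split_op I l ^^ (n - j)) (\<lambda>p. f (snd p))) ({#}, {#}) = (mix_op I l ^^ n) f {#}" if "j \<le> n" for j n
    unfolding split_funpow_snd raise_funpow_snd using funpow_add[of j "n - j" "mix_op I l"] that by simp
  then have "(\<Sum>j\<le>n. (raise_op I l ^^ j) ((split_op I l ^^ (n - j)) (\<lambda>p. f (snd p))) ({#}, {#})) = (\<Sum>j\<le>n. (mix_op I l ^^ n) f {#})" for n
    by (intro sum.cong) auto
  then show ?thesis unfolding ladder_def by (simp only: sum_fact_Suc)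
qed

section \<open>Poisson weights and their coupling\<close>

text \<open>The equation \<open>stein\<close> characterizes products of Poisson weights with means \<open>l i\<close>, up to a factor.\<close>

locale stein_weights =
  fixes I :: "'i set" and l :: "'i \<Rightarrow> ennreal" and \<pi> :: "'i multiset \<Rightarrow> ennreal"
  assumes finite_I: "finite I"
    and stein: "i \<in> I \<Longrightarrow> l i * \<pi> k = of_nat (Suc (count k i)) * \<pi> (add_mset i k)"
    and supp: "\<not> set_mset k \<subseteq> I \<Longrightarrow> \<pi> k = 0"
    and total: "(\<integral>\<^sup>+ k. \<pi> k \<partial>count_space UNIV) = 1"
begin

text \<open>Since \<open>\<pi> {#} = exp(-\<Sum>l)\<close>, this is the normalization \<open>exp(-2\<Lambda>)\<close>.\<close>

definition c0 :: ennreal where "c0 = \<pi> {#} * \<pi> {#}"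

lemma sum_count_\<pi>: "(\<Sum>i\<in>I. of_nat (count k i)) * \<pi> k = of_nat (size k) * \<pi> k"
proof (cases "set_mset k \<subseteq> I")
  case True
  have "(\<Sum>i\<in>I. count k i) = (\<Sum>i\<in>set_mset k. count k i)"
    using True finite_I by (intro sum.mono_neutral_right) (auto simp: not_in_iff)
  then show ?thesis by (simp add: size_multiset_overloaded_eq flip: of_nat_sum)
qed (simp add: supp)

text \<open>Applied to a point mass, \<open>split_op\<close> lives on the predecessors of (a, b),
  the pairs from which one insertion produces it. This is the recursion behind
  \<open>split_funpow_indicator\<close>.\<close>

lemma split_indicator:
  "split_op I l (indicator {(a, b)}) = (\<lambda>p. (\<Sum>i\<in>I. (if i \<in># a then l i else 0) * indicator {(a - {#i#}, b)} p)
     + (\<Sum>i\<in>I. (if i \<in># b then l i else 0) * indicator {(a, b - {#i#})} p))"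
proof (rule ext, clarify)
  fix x y
  have "(indicator {(a, b)} (add_mset i x, y) :: ennreal) = (if i \<in># a then indicator {(a - {#i#}, b)} (x, y) else 0)" for i
    by (auto simp: indicator_def)
  moreover have "(indicator {(a, b)} (x, add_mset i y) :: ennreal) = (if i \<in># b then indicator {(a, b - {#i#})} (x, y) else 0)" for i
    by (auto simp: indicator_def)
  ultimately show "split_op I l (indicator {(a, b)}) (x, y) = (\<Sum>i\<in>I. (if i \<in># a then l i else 0) * indicator {(a - {#i#}, b)} (x, y))
     + (\<Sum>i\<in>I. (if i \<in># b then l i else 0) * indicator {(a, b - {#i#})} (x, y))"
    by (auto simp: split_op_def intro!: arg_cong2[where f="(+)"] sum.cong)
qed

lemma stein_remove: "i \<in> I \<Longrightarrow> i \<in># k \<Longrightarrow> l i * \<pi> (k - {#i#}) = of_nat (count k i) * \<pi> k"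
  using stein[of i "k - {#i#}"] by simp

text \<open>After n insertions the total size is n. In the induction each predecessor contributes
  \<open>l i\<close> times its weight, which \<open>stein_remove\<close> turns into the multiplicity
  of \<open>i\<close> times \<open>\<pi> a * \<pi> b\<close>. The multiplicities of both components
  add up to \<open>size a + size b = Suc n\<close>, the new factor of the factorial.\<close>

lemma split_funpow_indicator:
  "c0 * (split_op I l ^^ n) (indicator {(a, b)}) ({#}, {#}) = (if size a + size b = n then fact n * (\<pi> a * \<pi> b) else 0)"
proof (induction n arbitrary: a b)
  case 0
  then show ?case by (auto simp: c0_def indicator_def)
next
  case (Suc n)
  let ?Y = "split_op I l" and ?o = "({#}, {#})"
  have sl: "sigma_linear (?Y ^^ n)" by (intro sigma_linear_funpow sigma_linear_split_op)
  have A: "c0 * ((if i \<in># a then l i else 0) * (?Y ^^ n) (indicator {(a - {#i#}, b)}) ?o)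
     = (if size a + size b = Suc n then fact n * (of_nat (count a i) * \<pi> a * \<pi> b) else 0)" if "i \<in> I" for i
  proof (cases "i \<in># a")
    case True
    then have "size (a - {#i#}) + size b = n \<longleftrightarrow> size a + size b = Suc n"
      by (auto simp: size_Diff_singleton dest!: multi_member_split)
    moreover have "l i * (fact n * (\<pi> (a - {#i#}) * \<pi> b)) = fact n * (of_nat (count a i) * \<pi> a * \<pi> b)"
      unfolding stein_remove[OF that True, symmetric] by (simp only: ac_simps)
    moreover have "l i * (fact n * (\<pi> b * \<pi> (a - {#i#}))) = fact n * (of_nat (count a i) * \<pi> a * \<pi> b)"
      unfolding stein_remove[OF that True, symmetric] by (simp only: ac_simps)
    ultimately show ?thesis using True Suc.IH[of "a - {#i#}" b]
      by (simp add: mult.left_commute[of c0])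
  qed (auto simp: count_eq_zero_iff)
  have B: "c0 * ((if i \<in># b then l i else 0) * (?Y ^^ n) (indicator {(a, b - {#i#})}) ?o)
     = (if size a + size b = Suc n then fact n * (of_nat (count b i) * \<pi> b * \<pi> a) else 0)" if "i \<in> I" for i
  proof (cases "i \<in># b")
    case True
    then have "size a + size (b - {#i#}) = n \<longleftrightarrow> size a + size b = Suc n"
      by (auto simp: size_Diff_singleton dest!: multi_member_split)
    moreover have "l i * (fact n * (\<pi> (b - {#i#}) * \<pi> a)) = fact n * (of_nat (count b i) * \<pi> b * \<pi> a)"
      unfolding stein_remove[OF that True, symmetric] by (simp only: ac_simps)
    moreover have "l i * (fact n * (\<pi> a * \<pi> (b - {#i#}))) = fact n * (of_nat (count b i) * \<pi> b * \<pi> a)"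
      unfolding stein_remove[OF that True, symmetric] by (simp only: ac_simps)
    ultimately show ?thesis using True Suc.IH[of a "b - {#i#}"]
      by (simp add: mult.left_commute[of c0])
  qed (auto simp: count_eq_zero_iff)
  have "c0 * (?Y ^^ Suc n) (indicator {(a, b)}) ?o = c0 * (?Y ^^ n) (?Y (indicator {(a, b)})) ?o"
    by (simp add: funpow_swap1)
  also have "\<dots> = (\<Sum>i\<in>I. c0 * ((if i \<in># a then l i else 0) * (?Y ^^ n) (indicator {(a - {#i#}, b)}) ?o))
       + (\<Sum>i\<in>I. c0 * ((if i \<in># b then l i else 0) * (?Y ^^ n) (indicator {(a, b - {#i#})}) ?o))"
    unfolding split_indicator sigma_linear_add_arg[OF sl] sigma_linear_distrib[OF sl]
    by (simp add: distrib_left sum_distrib_left)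
  also have "\<dots> = (if size a + size b = Suc n then fact n * ((\<Sum>i\<in>I. of_nat (count a i)) * \<pi> a * \<pi> b)
     + fact n * ((\<Sum>i\<in>I. of_nat (count b i)) * \<pi> b * \<pi> a) else 0)"
    by (simp add: A B sum_distrib_left sum_distrib_right cong: sum.cong)
  also have "\<dots> = (if size a + size b = Suc n then fact (Suc n) * (\<pi> a * \<pi> b) else 0)"
    unfolding sum_count_\<pi>
    by (auto simp: algebra_simps simp flip: of_nat_Suc of_nat_add) (metis (no_types, lifting) distrib_right of_nat_Suc of_nat_add add.commute mult.commute mult.left_commute)
  finally show ?case .
qed

text \<open>At each point mass only the term n = size a + size b of the exponential series survives,
  and there n! cancels. So the normalized exponential of \<open>split_op\<close> is the product law
  of two independent copies.\<close>

lemma funpow_split_integral: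
  "c0 * (\<Sum>n. (split_op I l ^^ n) \<Phi> ({#}, {#}) / fact n) = (\<integral>\<^sup>+ p. \<Phi> p * (\<pi> (fst p) * \<pi> (snd p)) \<partial>count_space UNIV)"
proof -
  let ?Y = "split_op I l" and ?o = "({#}, {#})"
  have f: "fact m = ennreal (fact m)" for m :: nat
    by (metis ennreal_of_nat_eq_real_of_nat of_nat_fact)
  have ff: "(fact m :: ennreal) / fact m = 1" for m :: nat
    unfolding f by (subst divide_ennreal) simp_all
  have "c0 * (\<Sum>n. (?Y ^^ n) \<Phi> ?o / fact n) = (\<Sum>n. c0 * ((?Y ^^ n) \<Phi> ?o / fact n))"
    by simp
  also have "\<dots> = (\<Sum>n. (c0 / fact n) * (?Y ^^ n) \<Phi> ?o)"
    by (simp only: divide_ennreal_def ac_simps)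
  also have "\<dots> = (\<Sum>n. (c0 / fact n) * (\<integral>\<^sup>+ p. \<Phi> p * (?Y ^^ n) (indicator {p}) ?o \<partial>count_space UNIV))"
    by (intro suminf_cong arg_cong2[where f="(*)"] refl sigma_linearD sigma_linear_funpow sigma_linear_split_op)
  also have "\<dots> = (\<Sum>n. (\<integral>\<^sup>+ p. (c0 / fact n) * (\<Phi> p * (?Y ^^ n) (indicator {p}) ?o) \<partial>count_space UNIV))"
    by (simp add: nn_integral_cmult)
  also have "\<dots> = (\<integral>\<^sup>+ p. (\<Sum>n. (c0 / fact n) * (\<Phi> p * (?Y ^^ n) (indicator {p}) ?o)) \<partial>count_space UNIV)"
    by (intro nn_integral_suminf[symmetric]) simp
  also have "\<dots> = (\<integral>\<^sup>+ p. \<Phi> p * (\<pi> (fst p) * \<pi> (snd p)) \<partial>count_space UNIV)"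
  proof (intro nn_integral_cong)
    fix p :: "'i multiset \<times> 'i multiset"
    obtain a b where p: "p = (a, b)" by (cases p)
    have "(c0 / fact n) * (\<Phi> p * (?Y ^^ n) (indicator {p}) ?o) = (if n = size a + size b then \<Phi> p * (\<pi> a * \<pi> b) else 0)" for n
    proof -
      have "(c0 / fact n) * (\<Phi> p * (?Y ^^ n) (indicator {p}) ?o) = \<Phi> p * inverse (fact n) * (c0 * (?Y ^^ n) (indicator {p}) ?o)"
        by (simp only: divide_ennreal_def ac_simps)
      also have "\<dots> = (if n = size a + size b then (fact n / fact n) * (\<Phi> p * (\<pi> a * \<pi> b)) else 0)"
        unfolding p split_funpow_indicator by (simp add: divide_ennreal_def ac_simps)
      finally show ?thesis by (simp add: ff)
    qed
    then show "(\<Sum>n. (c0 / fact n) * (\<Phi> p * (?Y ^^ n) (indicator {p}) ?o)) = \<Phi> p * (\<pi> (fst p) * \<pi> (snd p))"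
      using suminf_finite[of "{size a + size b}" "\<lambda>n. if n = size a + size b then \<Phi> p * (\<pi> a * \<pi> b) else 0"]
      by (simp add: p)
  qed
  finally show ?thesis .
qed

lemma nn_integral_prod_\<pi>:
  "(\<integral>\<^sup>+ p. \<Phi> p * (\<pi> (fst p) * \<pi> (snd p)) \<partial>count_space UNIV)
   = (\<integral>\<^sup>+ a. \<pi> a * (\<integral>\<^sup>+ b. \<pi> b * \<Phi> (a, b) \<partial>count_space UNIV) \<partial>count_space UNIV)"
  by (subst nn_integral_fst_count_space[symmetric]) (simp add: nn_integral_cmult[symmetric] ac_simps)

text \<open>Obtained from the pair version by integrating out the second component. The
  normalization is again \<open>c0\<close>, the square of \<open>\<pi> {#}\<close>, because the idle
  term of \<open>mix_op\<close> doubles its total rate.\<close>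

lemma funpow_mix_integral:
  "c0 * (\<Sum>n. (mix_op I l ^^ n) f {#} / fact n) = (\<integral>\<^sup>+ k. \<pi> k * f k \<partial>count_space UNIV)"
proof -
  have "c0 * (\<Sum>n. (mix_op I l ^^ n) f {#} / fact n) = c0 * (\<Sum>n. (split_op I l ^^ n) (\<lambda>p. f (fst p)) ({#}, {#}) / fact n)"
    by (simp add: split_funpow_fst)
  also have "\<dots> = (\<integral>\<^sup>+ a. \<pi> a * (\<integral>\<^sup>+ b. \<pi> b * f a \<partial>count_space UNIV) \<partial>count_space UNIV)"
    unfolding funpow_split_integral nn_integral_prod_\<pi> by simp
  also have "\<dots> = (\<integral>\<^sup>+ k. \<pi> k * f k \<partial>count_space UNIV)"
    by (simp add: nn_integral_multc total)
  finally show ?thesis .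
qed

definition coupling :: "'i multiset \<times> 'i multiset \<Rightarrow> ennreal" where
  "coupling p = c0 * ladder I l (indicator {p})"

lemma coupling_integral:
  "(\<integral>\<^sup>+ p. coupling p * \<Phi> p \<partial>count_space UNIV) = c0 * ladder I l \<Phi>"
proof -
  have "ladder I l \<Phi> = (\<integral>\<^sup>+ p. \<Phi> p * ladder I l (indicator {p}) \<partial>count_space UNIV)"
    using sigma_linearD[OF sigma_linear_ladder, of I l \<Phi>] by simp
  then show ?thesis unfolding coupling_def
    by (simp add: nn_integral_cmult[symmetric] ac_simps)
qed

lemma coupling_fst: "(\<integral>\<^sup>+ b. coupling (a, b) \<partial>count_space UNIV) = \<pi> a"
proof -
  have "(\<integral>\<^sup>+ b. coupling (a, b) \<partial>count_space UNIV) = (\<integral>\<^sup>+ a'. (\<integral>\<^sup>+ b. coupling (a', b) \<partial>count_space UNIV) * indicator {a} a' \<partial>count_space UNIV)"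
    by (subst nn_integral_count_space'[of "{a}"]) auto
  also have "\<dots> = (\<integral>\<^sup>+ p. coupling p * indicator {a} (fst p) \<partial>count_space UNIV)"
    by (subst nn_integral_fst_count_space[symmetric]) (simp add: nn_integral_multc)
  also have "\<dots> = (\<integral>\<^sup>+ k. \<pi> k * indicator {a} k \<partial>count_space UNIV)"
    unfolding coupling_integral ladder_fst funpow_mix_integral ..
  also have "\<dots> = \<pi> a" by (subst nn_integral_count_space'[of "{a}"]) auto
  finally show ?thesis .
qed

lemma coupling_snd: "(\<integral>\<^sup>+ a. coupling (a, b) \<partial>count_space UNIV) = \<pi> b"
proof -
  have "(\<integral>\<^sup>+ a. coupling (a, b) \<partial>count_space UNIV) = (\<integral>\<^sup>+ b'. (\<integral>\<^sup>+ a. coupling (a, b') \<partial>count_space UNIV) * indicator {b} b' \<partial>count_space UNIV)"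
    by (subst nn_integral_count_space'[of "{b}"]) auto
  also have "\<dots> = (\<integral>\<^sup>+ p. coupling p * indicator {b} (snd p) \<partial>count_space UNIV)"
    by (subst nn_integral_snd_count_space[symmetric]) (simp add: nn_integral_multc)
  also have "\<dots> = (\<integral>\<^sup>+ k. \<pi> k * indicator {b} k \<partial>count_space UNIV)"
    unfolding coupling_integral ladder_snd funpow_mix_integral ..
  also have "\<dots> = \<pi> b" by (subst nn_integral_count_space'[of "{b}"]) auto
  finally show ?thesis .
qed

text \<open>\<open>ladder_telescope\<close> times \<open>c0\<close>: its two exponential series
  become the law of (N, N) and the product law. For \<open>\<Phi> (a, b) = f a * g b\<close> this is
  the covariance formula with the negative terms moved across.\<close>

lemma coupling_identity:
  "(\<integral>\<^sup>+ k. \<pi> k * \<Phi> (k, k) \<partial>count_space UNIV) + (\<integral>\<^sup>+ p. coupling p * split_op I l \<Phi> p \<partial>count_space UNIV)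
   = (\<integral>\<^sup>+ a. \<pi> a * (\<integral>\<^sup>+ b. \<pi> b * \<Phi> (a, b) \<partial>count_space UNIV) \<partial>count_space UNIV)
     + (\<integral>\<^sup>+ p. coupling p * raise_op I l \<Phi> p \<partial>count_space UNIV)"
  unfolding coupling_integral nn_integral_prod_\<pi>[symmetric] funpow_split_integral[symmetric]
    funpow_mix_integral[of "\<lambda>k. \<Phi> (k, k)", symmetric] raise_funpow_diag[symmetric] distrib_left[symmetric] ladder_telescope ..

end

section \<open>Averages over nested countable partitions\<close>

lemma sq_diff_triangle:
  fixes a b c :: real
  shows "ennreal ((a - c)\<^sup>2) \<le> 2 * ennreal ((a - b)\<^sup>2) + 2 * ennreal ((b - c)\<^sup>2)"
proof -
  have "0 \<le> (a - b - (b - c))\<^sup>2" by simp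
  then have "(a - c)\<^sup>2 \<le> 2 * (a - b)\<^sup>2 + 2 * (b - c)\<^sup>2"
    by (simp add: power2_eq_square algebra_simps)
  then have "ennreal ((a - c)\<^sup>2) \<le> ennreal (2 * (a - b)\<^sup>2 + 2 * (b - c)\<^sup>2)"
    by (rule ennreal_leI)
  then show ?thesis by (simp add: ennreal_mult)
qed

lemma nn_integral_sq_triangle:
  fixes f g h :: "'x \<Rightarrow> real"
  assumes [measurable]: "f \<in> borel_measurable M" "g \<in> borel_measurable M" "h \<in> borel_measurable M"
  shows "(\<integral>\<^sup>+x. ennreal ((f x - h x)\<^sup>2) \<partial>M)
    \<le> 2 * (\<integral>\<^sup>+x. ennreal ((f x - g x)\<^sup>2) \<partial>M) + 2 * (\<integral>\<^sup>+x. ennreal ((g x - h x)\<^sup>2) \<partial>M)"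
proof -
  have "(\<integral>\<^sup>+x. ennreal ((f x - h x)\<^sup>2) \<partial>M) \<le> (\<integral>\<^sup>+x. 2 * ennreal ((f x - g x)\<^sup>2) + 2 * ennreal ((g x - h x)\<^sup>2) \<partial>M)"
    by (intro nn_integral_mono sq_diff_triangle)
  also have "\<dots> = 2 * (\<integral>\<^sup>+x. ennreal ((f x - g x)\<^sup>2) \<partial>M) + 2 * (\<integral>\<^sup>+x. ennreal ((g x - h x)\<^sup>2) \<partial>M)"
    by (simp add: nn_integral_add nn_integral_cmult)
  finally show ?thesis .
qed

text \<open>Expanding the squares reduces the claim to
  \<open>0 \<le> measure M A * (t - a)\<^sup>2\<close>.\<close>

lemma mean_minimizes_sq:
  fixes f :: "'x \<Rightarrow> real"
  assumes [measurable]: "A \<in> sets M" "f \<in> borel_measurable M"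
    and fin: "emeasure M A < \<infinity>" and sq: "(\<integral>\<^sup>+x. ennreal ((f x)\<^sup>2) * indicator A x \<partial>M) < \<infinity>"
  defines "a \<equiv> (\<integral>x. f x * indicator A x \<partial>M) / measure M A"
  shows "(\<integral>\<^sup>+x. ennreal ((f x - a)\<^sup>2) * indicator A x \<partial>M) \<le> (\<integral>\<^sup>+x. ennreal ((f x - t)\<^sup>2) * indicator A x \<partial>M)"
proof -
  let ?s = "\<integral>x. f x * indicator A x \<partial>M"
  have iA: "integrable M (indicator A :: _ \<Rightarrow> real)" using fin by simp
  have i2: "integrable M (\<lambda>x. (f x)\<^sup>2 * indicator A x)"
    using sq by (intro integrableI_nonneg) (auto simp: ennreal_mult'' ennreal_indicator)
  have i1: "integrable M (\<lambda>x. f x * indicator A x)"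
  proof (rule Bochner_Integration.integrable_bound[OF Bochner_Integration.integrable_add[OF iA i2]])
    have "\<bar>y\<bar> \<le> 1 + y\<^sup>2" for y :: real
    proof -
      have "0 \<le> (\<bar>y\<bar> - 1)\<^sup>2" by simp
      then show ?thesis by (simp add: power2_eq_square algebra_simps)
    qed
    then show "AE x in M. norm (f x * indicator A x) \<le> norm (indicator A x + (f x)\<^sup>2 * indicator A x)"
      by (intro AE_I2) (auto simp: indicator_def)
  qed simp
  have eq: "(\<lambda>x. (f x - t)\<^sup>2 * indicator A x) = (\<lambda>x. (f x)\<^sup>2 * indicator A x - 2 * t * (f x * indicator A x) + t\<^sup>2 * indicator A x)" for t
    by (auto simp: power2_eq_square algebra_simps)
  have int: "integrable M (\<lambda>x. (f x - t)\<^sup>2 * indicator A x)" for t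
    unfolding eq using i1 i2 iA by simp
  have val: "(\<integral>x. (f x - t)\<^sup>2 * indicator A x \<partial>M) = (\<integral>x. (f x)\<^sup>2 * indicator A x \<partial>M) - 2 * t * ?s + t\<^sup>2 * measure M A" for t
    unfolding eq using i1 i2 iA by simp
  have nn: "(\<integral>\<^sup>+x. ennreal ((f x - t)\<^sup>2) * indicator A x \<partial>M) = ennreal (\<integral>x. (f x - t)\<^sup>2 * indicator A x \<partial>M)" for t
    by (subst nn_integral_eq_integral[OF int, symmetric]) (auto simp: ennreal_mult'' ennreal_indicator)
  \<comment> \<open>For a null set both sides are 0: the integrand vanishes almost
    everywhere.\<close>
  have s: "?s = a * measure M A"
  proof (cases "measure M A = 0")
    case True
    then have "A \<in> null_sets M" using fin by (auto simp: null_sets_def measure_def enn2real_eq_0_iff)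
    then have "AE x in M. f x * indicator A x = 0" using AE_not_in[of A M] by (auto elim!: eventually_mono)
    then have "?s = 0" by (subst integral_cong_AE[of _ _ "\<lambda>_. 0"]) auto
    then show ?thesis using True by simp
  qed (simp add: a_def)
  have "0 \<le> measure M A * (t - a)\<^sup>2" by simp
  then have "- 2 * a * ?s + a\<^sup>2 * measure M A \<le> - 2 * t * ?s + t\<^sup>2 * measure M A"
    unfolding s by (simp add: power2_eq_square algebra_simps)
  then show ?thesis unfolding nn val by (intro ennreal_leI) simp
qed

text \<open>
  The partitions are given by the fibres of the maps \<open>c n\<close>. Fibres over \<open>out\<close> are left out of the
  averages, since they may have infinite measure.
\<close>

locale code_filtration =
  fixes M :: "'x measure" and c :: "nat \<Rightarrow> 'x \<Rightarrow> 'c::countable" and out :: "'c \<Rightarrow> bool"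
  assumes meas[measurable]: "c n \<in> measurable M (count_space UNIV)"
    and refine: "m \<le> n \<Longrightarrow> \<exists>r. \<forall>x\<in>space M. c m x = r (c n x)"
    and gen: "sets M = sigma_sets (space M) {c n -` S \<inter> space M | n S. True}"
    and out_mono: "m \<le> n \<Longrightarrow> x \<in> space M \<Longrightarrow> out (c n x) \<Longrightarrow> out (c m x)"
    and cover: "x \<in> space M \<Longrightarrow> \<exists>n. \<not> out (c n x)"
    and window_finite: "emeasure M {x \<in> space M. \<not> out (c n x)} < \<infinity>"
begin

definition window :: "nat \<Rightarrow> 'x set" where "window n = {x \<in> space M. \<not> out (c n x)}"

lemma window_sets[measurable]: "window n \<in> sets M"
proof -
  have "window n = c n -` {b. \<not> out b} \<inter> space M" by (auto simp: window_def)
  then show ?thesis using measurable_sets[OF meas, of "{b. \<not> out b}"] by simp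
qed

lemma window_mono: "m \<le> n \<Longrightarrow> window m \<subseteq> window n"
  using out_mono by (auto simp: window_def)

lemma measurable_code[measurable]: "(\<lambda>x. \<phi> (c n x) :: 'b::topological_space) \<in> borel_measurable M"
  using measurable_compose[OF meas, of \<phi> borel] by simp

text \<open>The L2 closure of the functions constant on the cells of some level and zero on the
  excluded ones. Such step functions are exactly the competitors of the averages in
  \<open>cell_mean_best\<close>.\<close>

definition approximable :: "('x \<Rightarrow> real) \<Rightarrow> bool" where
  "approximable f \<longleftrightarrow> f \<in> borel_measurable M \<and>
     (\<forall>e>0. \<exists>n \<phi>. (\<forall>b. out b \<longrightarrow> \<phi> b = 0) \<and> (\<integral>\<^sup>+x. ennreal ((f x - \<phi> (c n x))\<^sup>2) \<partial>M) \<le> ennreal e)"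

lemma approximable_borel: "approximable f \<Longrightarrow> f \<in> borel_measurable M"
  by (simp add: approximable_def)

lemma level_lift:
  assumes "m \<le> n" "\<forall>b. out b \<longrightarrow> \<phi> b = (0::real)"
  obtains \<psi> where "\<forall>b. out b \<longrightarrow> \<psi> b = (0::real)" "\<And>x. x \<in> space M \<Longrightarrow> \<psi> (c n x) = \<phi> (c m x)"
proof -
  obtain r where r: "\<And>x. x \<in> space M \<Longrightarrow> c m x = r (c n x)" using refine[OF assms(1)] by blast
  show ?thesis
    \<comment> \<open>Setting the value to 0 on excluded fine cells is consistent: by
      \<open>out_mono\<close> the coarse cell is excluded too, and \<open>\<phi>\<close> vanishes
      there.\<close>
    by (rule that[of "\<lambda>b. if out b then 0 else \<phi> (r b)"]) (use assms out_mono r[symmetric] in auto)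
qed

lemma approximable_level:
  assumes "\<forall>b. out b \<longrightarrow> \<phi> b = 0" "\<And>x. x \<in> space M \<Longrightarrow> f x = \<phi> (c n x)"
  shows "approximable f"
proof -
  have "f \<in> borel_measurable M" using assms(2) measurable_code[of \<phi> n] by (simp cong: measurable_cong)
  moreover have "(\<integral>\<^sup>+x. ennreal ((f x - \<phi> (c n x))\<^sup>2) \<partial>M) = 0"
    using assms(2) by (simp cong: nn_integral_cong)
  ultimately show ?thesis using assms(1) unfolding approximable_def by (metis zero_le)
qed

lemma approximable_closed:
  assumes f[measurable]: "f \<in> borel_measurable M"
    and "\<And>e. e > 0 \<Longrightarrow> \<exists>g. approximable g \<and> (\<integral>\<^sup>+x. ennreal ((f x - g x)\<^sup>2) \<partial>M) \<le> ennreal e"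
  shows "approximable f"
  unfolding approximable_def
proof (intro conjI allI impI)
  fix e :: real assume e: "e > 0"
  \<comment> \<open>The quarter compensates the factors 2 of \<open>nn_integral_sq_triangle\<close>:
    2 e/4 + 2 e/4 = e.\<close>
  obtain g where g: "approximable g" "(\<integral>\<^sup>+x. ennreal ((f x - g x)\<^sup>2) \<partial>M) \<le> ennreal (e/4)"
    using assms(2)[of "e/4"] e by auto
  note [measurable] = approximable_borel[OF g(1)]
  obtain n \<phi> where n: "\<forall>b. out b \<longrightarrow> \<phi> b = 0" "(\<integral>\<^sup>+x. ennreal ((g x - \<phi> (c n x))\<^sup>2) \<partial>M) \<le> ennreal (e/4)"
    using g(1) e unfolding approximable_def by (meson divide_pos_pos zero_less_numeral)
  have "(\<integral>\<^sup>+x. ennreal ((f x - \<phi> (c n x))\<^sup>2) \<partial>M) \<le> 2 * ennreal (e/4) + 2 * ennreal (e/4)"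
    by (rule order_trans[OF nn_integral_sq_triangle[of f M g]]) (auto intro!: add_mono mult_left_mono g n)
  also have "\<dots> = ennreal e"
  proof -
    have "2 * ennreal (e/4) = ennreal (e/2)" using e by (simp add: ennreal_mult'[symmetric] flip: ennreal_numeral)
    then show ?thesis using e by (simp flip: ennreal_plus)
  qed
  finally show "\<exists>n \<phi>. (\<forall>b. out b \<longrightarrow> \<phi> b = 0) \<and> (\<integral>\<^sup>+x. ennreal ((f x - \<phi> (c n x))\<^sup>2) \<partial>M) \<le> ennreal e"
    using n(1) by blast
qed (rule f)

lemma approximable_add:
  assumes f: "approximable f" and g: "approximable g"
  shows "approximable (\<lambda>x. s * f x + t * g x)"
proof (rule approximable_closed)
  note [measurable] = approximable_borel[OF f] approximable_borel[OF g]
  show "(\<lambda>x. s * f x + t * g x) \<in> borel_measurable M" by measurable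
  fix e :: real assume e: "e > 0"
  \<comment> \<open>Chosen so that \<open>2 * s\<^sup>2 * d + 2 * t\<^sup>2 * d \<le> e\<close>; the
    summand 1 keeps the denominator positive when both coefficients vanish.\<close>
  define d where "d = e / (2 * (s\<^sup>2 + t\<^sup>2 + 1))"
  have st: "s\<^sup>2 + t\<^sup>2 + 1 > 0" by (simp add: add_nonneg_pos)
  have d: "d > 0" using e st by (simp add: d_def)
  obtain m \<phi> where m: "\<forall>b. out b \<longrightarrow> \<phi> b = 0" "(\<integral>\<^sup>+x. ennreal ((f x - \<phi> (c m x))\<^sup>2) \<partial>M) \<le> ennreal d"
    using f d unfolding approximable_def by meson
  obtain n \<psi> where n: "\<forall>b. out b \<longrightarrow> \<psi> b = 0" "(\<integral>\<^sup>+x. ennreal ((g x - \<psi> (c n x))\<^sup>2) \<partial>M) \<le> ennreal d"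
    using g d unfolding approximable_def by meson
  obtain \<phi>' where \<phi>': "\<forall>b. out b \<longrightarrow> \<phi>' b = (0::real)" "\<And>x. x \<in> space M \<Longrightarrow> \<phi>' (c (max m n) x) = \<phi> (c m x)"
    using level_lift[of m "max m n" \<phi>] m(1) by auto
  obtain \<psi>' where \<psi>': "\<forall>b. out b \<longrightarrow> \<psi>' b = (0::real)" "\<And>x. x \<in> space M \<Longrightarrow> \<psi>' (c (max m n) x) = \<psi> (c n x)"
    using level_lift[of n "max m n" \<psi>] n(1) by auto
  let ?h = "\<lambda>x. s * \<phi> (c m x) + t * \<psi> (c n x)"
  have "approximable ?h"
    by (rule approximable_level[of "\<lambda>b. s * \<phi>' b + t * \<psi>' b" _ "max m n"]) (auto simp: \<phi>' \<psi>')
  moreover have "(\<integral>\<^sup>+x. ennreal ((s * f x + t * g x - ?h x)\<^sup>2) \<partial>M) \<le> ennreal e"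
  proof -
    have "(s * f x + t * g x - ?h x)\<^sup>2 \<le> 2 * s\<^sup>2 * (f x - \<phi> (c m x))\<^sup>2 + 2 * t\<^sup>2 * (g x - \<psi> (c n x))\<^sup>2" for x
    proof -
      have "0 \<le> (s * (f x - \<phi> (c m x)) - t * (g x - \<psi> (c n x)))\<^sup>2" by simp
      then show ?thesis by (simp add: power2_eq_square algebra_simps)
    qed
    then have "(\<integral>\<^sup>+x. ennreal ((s * f x + t * g x - ?h x)\<^sup>2) \<partial>M)
       \<le> (\<integral>\<^sup>+x. ennreal (2 * s\<^sup>2) * ennreal ((f x - \<phi> (c m x))\<^sup>2) + ennreal (2 * t\<^sup>2) * ennreal ((g x - \<psi> (c n x))\<^sup>2) \<partial>M)"
      by (intro nn_integral_mono) (simp add: ennreal_leI flip: ennreal_mult ennreal_plus)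
    also have "\<dots> = ennreal (2 * s\<^sup>2) * (\<integral>\<^sup>+x. ennreal ((f x - \<phi> (c m x))\<^sup>2) \<partial>M) + ennreal (2 * t\<^sup>2) * (\<integral>\<^sup>+x. ennreal ((g x - \<psi> (c n x))\<^sup>2) \<partial>M)"
      by (simp add: nn_integral_add nn_integral_cmult)
    also have "\<dots> \<le> ennreal (2 * s\<^sup>2) * ennreal d + ennreal (2 * t\<^sup>2) * ennreal d"
      by (intro add_mono mult_left_mono m n) auto
    also have "\<dots> = ennreal (2 * s\<^sup>2 * d + 2 * t\<^sup>2 * d)" using d by (simp add: ennreal_mult)
    also have "\<dots> \<le> ennreal e"
    proof (rule ennreal_leI)
      have "2 * s\<^sup>2 * d + 2 * t\<^sup>2 * d \<le> 2 * (s\<^sup>2 + t\<^sup>2 + 1) * d" using d by (simp add: algebra_simps)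
      also have "\<dots> = e" using st by (simp add: d_def)
      finally show "2 * s\<^sup>2 * d + 2 * t\<^sup>2 * d \<le> e" .
    qed
    finally show ?thesis .
  qed
  ultimately show "\<exists>h. approximable h \<and> (\<integral>\<^sup>+x. ennreal ((s * f x + t * g x - h x)\<^sup>2) \<partial>M) \<le> ennreal e"
    by blast
qed

lemma approximable_sum:
  assumes "\<And>j. j \<in> J \<Longrightarrow> approximable (f j)"
  shows "approximable (\<lambda>x. \<Sum>j\<in>J. a j * f j x)"
  using assms
proof (induction J rule: infinite_finite_induct)
  case (insert j J)
  then show ?case using approximable_add[of "f j" "\<lambda>x. \<Sum>j\<in>J. a j * f j x" "a j" 1] by simp
qed (use approximable_level[of "\<lambda>_. 0"] in auto)

lemma approximable_limit:
  assumes f[measurable]: "f \<in> borel_measurable M" and g: "\<And>k::nat. approximable (g k)"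
    and lim: "\<And>x. x \<in> space M \<Longrightarrow> (\<lambda>k. g k x) \<longlonglongrightarrow> f x"
    and dom: "\<And>k x. x \<in> space M \<Longrightarrow> (f x - g k x)\<^sup>2 \<le> w x"
    and w[measurable]: "w \<in> borel_measurable M" and wfin: "(\<integral>\<^sup>+x. ennreal (w x) \<partial>M) < \<infinity>"
  shows "approximable f"
proof (rule approximable_closed[OF f])
  fix e :: real assume e: "e > 0"
  note [measurable] = approximable_borel[OF g]
  have "(\<lambda>k. \<integral>\<^sup>+x. ennreal ((f x - g k x)\<^sup>2) \<partial>M) \<longlonglongrightarrow> (\<integral>\<^sup>+x. 0 \<partial>M)"
  proof (rule nn_integral_dominated_convergence[where w="\<lambda>x. ennreal (w x)"])
    show "AE x in M. (\<lambda>k. ennreal ((f x - g k x)\<^sup>2)) \<longlonglongrightarrow> 0"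
    proof (rule AE_I2)
      fix x assume x: "x \<in> space M"
      have "(\<lambda>k. (f x - g k x)\<^sup>2) \<longlonglongrightarrow> (f x - f x)\<^sup>2" by (intro tendsto_intros lim x)
      then show "(\<lambda>k. ennreal ((f x - g k x)\<^sup>2)) \<longlonglongrightarrow> 0"
        using tendsto_ennrealI[of "\<lambda>k. (f x - g k x)\<^sup>2" 0] by simp
    qed
  qed (use dom wfin in \<open>auto intro!: ennreal_leI\<close>)
  then have "eventually (\<lambda>k. (\<integral>\<^sup>+x. ennreal ((f x - g k x)\<^sup>2) \<partial>M) < ennreal e) sequentially"
    using e by (intro order_tendstoD) auto
  then show "\<exists>h. approximable h \<and> (\<integral>\<^sup>+x. ennreal ((f x - h x)\<^sup>2) \<partial>M) \<le> ennreal e"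
    using g by (auto simp: eventually_sequentially intro: less_imp_le)
qed

lemma Int_stable_gen: "Int_stable {c n -` S \<inter> space M | n S. True}"
proof (rule Int_stableI)
  fix A B assume "A \<in> {c n -` S \<inter> space M | n S. True}" "B \<in> {c n -` S \<inter> space M | n S. True}"
  then obtain m S n T where AB: "A = c m -` S \<inter> space M" "B = c n -` T \<inter> space M" by auto
  obtain r where r: "\<And>x. x \<in> space M \<Longrightarrow> c m x = r (c (max m n) x)" using refine[of m "max m n"] by auto
  obtain q where q: "\<And>x. x \<in> space M \<Longrightarrow> c n x = q (c (max m n) x)" using refine[of n "max m n"] by auto
  have "A \<inter> B = c (max m n) -` {b. r b \<in> S \<and> q b \<in> T} \<inter> space M" by (auto simp: AB r q)
  then show "A \<inter> B \<in> {c n -` S \<inter> space M | n S. True}" by blast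
qed

text \<open>Dynkin induction over the intersection-stable generator. Intersecting with a window
  keeps all indicators square integrable, so complements are differences inside L2 and disjoint
  unions are dominated limits.\<close>

lemma approximable_indicator:
  assumes "A \<in> sets M"
  shows "approximable (indicator (A \<inter> window m))"
proof -
  have "{c n -` S \<inter> space M | n S. True} \<subseteq> Pow (space M)" by auto
  with Int_stable_gen show ?thesis using assms[unfolded gen]
  proof (induction rule: sigma_sets_induct_disjoint)
    case (basic A)
    then obtain n S where A: "A = c n -` S \<inter> space M" by auto
    obtain r where r: "\<And>x. x \<in> space M \<Longrightarrow> c n x = r (c (max m n) x)" using refine[of n "max m n"] by auto
    obtain q where q: "\<And>x. x \<in> space M \<Longrightarrow> c m x = q (c (max m n) x)" using refine[of m "max m n"] by auto
    show ?case
      by (rule approximable_level[of "\<lambda>b. if \<not> out b \<and> r b \<in> S \<and> \<not> out (q b) then 1 else 0" _ "max m n"])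
        (use out_mono[of m "max m n"] in \<open>auto simp: A window_def indicator_def r[symmetric] q[symmetric]\<close>)
  next
    case empty
    show ?case by (rule approximable_level[of "\<lambda>_. 0"]) auto
  next
    case (compl A)
    have W: "approximable (indicator (window m))"
      by (rule approximable_level[of "\<lambda>b. if out b then 0 else 1" _ m]) (auto simp: window_def indicator_def)
    have "indicator ((space M - A) \<inter> window m) = (\<lambda>x. 1 * indicator (window m) x + (- 1) * indicator (A \<inter> window m) x :: real)"
      by (auto simp: window_def indicator_def fun_eq_iff)
    then show ?case using approximable_add[OF W compl(2), of 1 "-1"] by simp
  next
    case (union A)
    have s[measurable]: "A i \<in> sets M" for i
      by (simp only: gen) (rule subsetD[OF union(2)], rule rangeI)
    show ?case
    proof (rule approximable_limit[where g="\<lambda>k x. \<Sum>i<k. 1 * indicator (A i \<inter> window m) x" and w="indicator (window m)"])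
      show "approximable (\<lambda>x. \<Sum>i<k. 1 * indicator (A i \<inter> window m) x)" for k
        by (rule approximable_sum, rule union)
      have eq: "(\<Sum>i<k. 1 * indicator (A i \<inter> window m) x) = (indicator ((\<Union>i<k. A i) \<inter> window m) x :: real)" for k x
      proof -
        have "disjoint_family_on (\<lambda>i. A i \<inter> window m) {..<k}"
          using union(1) by (auto simp: disjoint_family_on_def)
        then show ?thesis by (simp add: indicator_UN_disjoint[symmetric] Int_UN_distrib2)
      qed
      show "(\<lambda>k. \<Sum>i<k. 1 * indicator (A i \<inter> window m) x) \<longlonglongrightarrow> (indicator (\<Union> (range A) \<inter> window m) x :: real)" for x
      proof (cases "x \<in> \<Union> (range A)")
        case True
        then obtain i where i: "x \<in> A i" by auto
        have "eventually (\<lambda>k. indicator ((\<Union>i<k. A i) \<inter> window m) x = (indicator (\<Union> (range A) \<inter> window m) x :: real)) sequentially"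
          using eventually_gt_at_top[of i] by eventually_elim (use i in \<open>auto simp: indicator_def\<close>)
        then show ?thesis unfolding eq by (rule tendsto_eventually)
      qed (auto simp: eq indicator_def)
      show "(indicator (\<Union> (range A) \<inter> window m) x - (\<Sum>i<k. 1 * indicator (A i \<inter> window m) x))\<^sup>2 \<le> (indicator (window m) x :: real)" for k x
        unfolding eq by (auto simp: indicator_def)
      show "(\<integral>\<^sup>+ x. ennreal (indicator (window m) x) \<partial>M) < \<infinity>"
        using window_finite[of m] by (simp add: ennreal_indicator window_def[symmetric])
    qed measurable
  qed
qed

lemma approximable_L2:
  fixes f :: "'x \<Rightarrow> real"
  assumes f[measurable]: "f \<in> borel_measurable M" and sq: "(\<integral>\<^sup>+x. ennreal ((f x)\<^sup>2) \<partial>M) < \<infinity>"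
  shows "approximable f"
proof -
  obtain u :: "nat \<Rightarrow> 'x \<Rightarrow> real" where u: "\<And>i. simple_function M (u i)"
    and lim: "\<And>x. x \<in> space M \<Longrightarrow> (\<lambda>i. u i x) \<longlonglongrightarrow> f x"
    and bound: "\<And>i x. x \<in> space M \<Longrightarrow> \<bar>u i x\<bar> \<le> 2 * \<bar>f x\<bar>"
    using borel_measurable_implies_sequence_metric[OF f, of 0, unfolded dist_real_def diff_0_right] by blast
  show ?thesis
  \<comment> \<open>The simple functions are cut to growing windows of finite measure. Since
    \<open>\<bar>u k x\<bar> \<le> 2 * \<bar>f x\<bar>\<close>, the error is at most
    \<open>3 * \<bar>f x\<bar>\<close>, whence the constant 9.\<close>
  proof (rule approximable_limit[where g="\<lambda>k x. u k x * indicator (window k) x" and w="\<lambda>x. 9 * (f x)\<^sup>2"])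
    show "approximable (\<lambda>x. u k x * indicator (window k) x)" for k
    proof -
      have "approximable (\<lambda>x. \<Sum>y\<in>u k ` space M. y * indicator ((u k -` {y} \<inter> space M) \<inter> window k) x)"
        by (rule approximable_sum, rule approximable_indicator, rule simple_functionD(2)[OF u(1)])
      also have "(\<lambda>x. \<Sum>y\<in>u k ` space M. y * indicator ((u k -` {y} \<inter> space M) \<inter> window k) x) = (\<lambda>x. u k x * indicator (window k) x)"
      proof
        fix x
        show "(\<Sum>y\<in>u k ` space M. y * indicator ((u k -` {y} \<inter> space M) \<inter> window k) x) = u k x * indicator (window k) x"
        proof (cases "x \<in> window k")
          case True
          then have x: "x \<in> space M" by (auto simp: window_def)
          have "(\<Sum>y\<in>u k ` space M. y * indicator ((u k -` {y} \<inter> space M) \<inter> window k) x) = (\<Sum>y\<in>u k ` space M. if y = u k x then y else 0)"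
            using True x by (intro sum.cong) (auto simp: indicator_def)
          also have "\<dots> = u k x" using simple_functionD(1)[OF u(1)[of k]] x by simp
          finally show ?thesis using True by simp
        qed simp
      qed
      finally show ?thesis .
    qed
    show "(\<lambda>k. u k x * indicator (window k) x) \<longlonglongrightarrow> f x" if x: "x \<in> space M" for x
    proof -
      obtain n where n: "\<not> out (c n x)" using cover[OF x] by auto
      have "eventually (\<lambda>k. u k x = u k x * indicator (window k) x) sequentially"
        using eventually_ge_at_top[of n]
      proof eventually_elim
        case (elim k)
        then have "x \<in> window k" using n x window_mono[of n k] by (auto simp: window_def)
        then show ?case by simp
      qed
      then show ?thesis using lim[OF x] by (rule Lim_transform_eventually[rotated])
    qed
    show "(f x - u k x * indicator (window k) x)\<^sup>2 \<le> 9 * (f x)\<^sup>2" if x: "x \<in> space M" for k x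
    proof -
      have "\<bar>f x - u k x * indicator (window k) x\<bar> \<le> \<bar>3 * f x\<bar>"
        using bound[OF x, of k] by (auto simp: indicator_def)
      then have "(f x - u k x * indicator (window k) x)\<^sup>2 \<le> (3 * f x)\<^sup>2" by (simp only: abs_le_square_iff)
      then show ?thesis by (simp add: power_mult_distrib)
    qed
    show "(\<integral>\<^sup>+ x. ennreal (9 * (f x)\<^sup>2) \<partial>M) < \<infinity>"
      using sq by (simp add: ennreal_mult nn_integral_cmult ennreal_mult_less_top)
  qed measurable
qed

text \<open>Conditional expectation given the level \<open>n\<close> cell, as a function of the
  code. Division by 0 gives the value 0 on null cells.\<close>

definition cell_mean :: "nat \<Rightarrow> ('x \<Rightarrow> real) \<Rightarrow> 'c \<Rightarrow> real" where
  "cell_mean n f b = (if out b then 0 else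
     (\<integral>x. f x * indicator {x \<in> space M. c n x = b} x \<partial>M) / measure M {x \<in> space M. c n x = b})"

lemma cell_sets[measurable]: "{x \<in> space M. c n x = b} \<in> sets M"
  by measurable

lemma nn_integral_cells:
  assumes [measurable]: "g \<in> borel_measurable M"
  shows "(\<integral>\<^sup>+x. g x \<partial>M) = (\<integral>\<^sup>+b. (\<integral>\<^sup>+x. g x * indicator {x \<in> space M. c n x = b} x \<partial>M) \<partial>count_space UNIV)"
proof -
  have "(\<integral>\<^sup>+x. g x \<partial>M) = (\<integral>\<^sup>+x. (\<integral>\<^sup>+b. g x * indicator {x \<in> space M. c n x = b} x \<partial>count_space UNIV) \<partial>M)"
  proof (intro nn_integral_cong)
    fix x assume x: "x \<in> space M"
    have "(\<integral>\<^sup>+b. g x * indicator {x \<in> space M. c n x = b} x \<partial>count_space UNIV) = (\<integral>\<^sup>+b. g x * indicator {b} (c n x) \<partial>count_space UNIV)"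
      by (intro nn_integral_cong) (use x in \<open>auto simp: indicator_def\<close>)
    then show "g x = (\<integral>\<^sup>+b. g x * indicator {x \<in> space M. c n x = b} x \<partial>count_space UNIV)"
      by (simp add: nn_integral_count_space_indicator_single)
  qed
  also have "\<dots> = (\<integral>\<^sup>+b. (\<integral>\<^sup>+x. g x * indicator {x \<in> space M. c n x = b} x \<partial>M) \<partial>count_space UNIV)"
    by (intro nn_integral_count_space_nn_integral) auto
  finally show ?thesis .
qed

text \<open>The minimization is done cell by cell with \<open>mean_minimizes_sq\<close>. On excluded
  cells both approximants are 0 and the errors coincide.\<close>

lemma cell_mean_best:
  fixes f :: "'x \<Rightarrow> real"
  assumes [measurable]: "f \<in> borel_measurable M" and sq: "(\<integral>\<^sup>+x. ennreal ((f x)\<^sup>2) \<partial>M) < \<infinity>"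
    and \<phi>: "\<forall>b. out b \<longrightarrow> \<phi> b = 0"
  shows "(\<integral>\<^sup>+x. ennreal ((f x - cell_mean n f (c n x))\<^sup>2) \<partial>M) \<le> (\<integral>\<^sup>+x. ennreal ((f x - \<phi> (c n x))\<^sup>2) \<partial>M)"
proof -
  have "(\<integral>\<^sup>+x. ennreal ((f x - cell_mean n f (c n x))\<^sup>2) * indicator {x \<in> space M. c n x = b} x \<partial>M)
    \<le> (\<integral>\<^sup>+x. ennreal ((f x - \<phi> (c n x))\<^sup>2) * indicator {x \<in> space M. c n x = b} x \<partial>M)" (is "?L \<le> ?R") for b
  proof -
    have L: "?L = (\<integral>\<^sup>+x. ennreal ((f x - cell_mean n f b)\<^sup>2) * indicator {x \<in> space M. c n x = b} x \<partial>M)"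
      by (intro nn_integral_cong) (auto simp: indicator_def)
    have R: "?R = (\<integral>\<^sup>+x. ennreal ((f x - \<phi> b)\<^sup>2) * indicator {x \<in> space M. c n x = b} x \<partial>M)"
      by (intro nn_integral_cong) (auto simp: indicator_def)
    show ?thesis
    proof (cases "out b")
      case True
      then show ?thesis unfolding L R using \<phi> by (simp add: cell_mean_def)
    next
      case False
      then have "{x \<in> space M. c n x = b} \<subseteq> {x \<in> space M. \<not> out (c n x)}" by auto
      then have fin: "emeasure M {x \<in> space M. c n x = b} < \<infinity>"
        using window_finite[of n] window_sets[of n] emeasure_mono[of "{x \<in> space M. c n x = b}" "window n" M]
        by (auto simp: window_def)
      have "(\<integral>\<^sup>+x. ennreal ((f x)\<^sup>2) * indicator {x \<in> space M. c n x = b} x \<partial>M) < \<infinity>"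
        by (rule le_less_trans[OF nn_integral_mono sq]) (auto simp: indicator_def)
      from mean_minimizes_sq[OF _ _ fin this, of "\<phi> b"] show ?thesis
        unfolding L R using False by (simp add: cell_mean_def)
    qed
  qed
  then show ?thesis
    by (subst (1 2) nn_integral_cells[where n=n]) (simp_all add: nn_integral_mono)
qed

text \<open>Takes the place of martingale convergence: an approximant of a fixed level
  \<open>m\<close> lifts to every level \<open>n \<ge> m\<close>, and there the average is at least
  as close to \<open>f\<close>.\<close>

lemma cell_mean_L2:
  fixes f :: "'x \<Rightarrow> real"
  assumes [measurable]: "f \<in> borel_measurable M" and sq: "(\<integral>\<^sup>+x. ennreal ((f x)\<^sup>2) \<partial>M) < \<infinity>"
  shows "(\<lambda>n. \<integral>\<^sup>+x. ennreal ((f x - cell_mean n f (c n x))\<^sup>2) \<partial>M) \<longlonglongrightarrow> 0"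
proof (rule order_tendstoI)
  fix y :: ennreal assume "0 < y"
  then obtain z where z: "0 < z" "z < y" using dense by blast
  define e where "e = enn2real z"
  have "z < \<top>" using z(2) by (rule less_le_trans) simp
  then have e: "0 < e" "ennreal e < y"
    using z by (auto simp: e_def enn2real_positive_iff)
  obtain m \<phi> where m: "\<forall>b. out b \<longrightarrow> \<phi> b = 0" "(\<integral>\<^sup>+x. ennreal ((f x - \<phi> (c m x))\<^sup>2) \<partial>M) \<le> ennreal e"
    using approximable_L2[OF assms] e(1) unfolding approximable_def by meson
  show "eventually (\<lambda>n. (\<integral>\<^sup>+x. ennreal ((f x - cell_mean n f (c n x))\<^sup>2) \<partial>M) < y) sequentially"
    using eventually_ge_at_top[of m]
  proof eventually_elim
    case (elim n)
    obtain \<psi> where \<psi>: "\<forall>b. out b \<longrightarrow> \<psi> b = (0::real)" "\<And>x. x \<in> space M \<Longrightarrow> \<psi> (c n x) = \<phi> (c m x)"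
      using level_lift[OF elim m(1)] by blast
    have "(\<integral>\<^sup>+x. ennreal ((f x - cell_mean n f (c n x))\<^sup>2) \<partial>M) \<le> (\<integral>\<^sup>+x. ennreal ((f x - \<psi> (c n x))\<^sup>2) \<partial>M)"
      by (rule cell_mean_best) (use assms \<psi> in auto)
    also have "\<dots> = (\<integral>\<^sup>+x. ennreal ((f x - \<phi> (c m x))\<^sup>2) \<partial>M)" using \<psi> by (simp cong: nn_integral_cong)
    also have "\<dots> < y" using m(2) e(2) by simp
    finally show ?case .
  qed
qed simp

end

section \<open>Configurations and cells\<close>

text \<open>Multisets of cell codes serve as codes in \<open>code_filtration\<close>, which asks for
  a countable type.\<close>

instance multiset :: (countable) countable
proof
  have "surj (mset :: 'a list \<Rightarrow> 'a multiset)" by (metis ex_mset surjI surj_def)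
  then have "countable (UNIV :: 'a multiset set)" by (metis countable_image countableI_type)
  then show "\<exists>to_nat :: 'a multiset \<Rightarrow> nat. inj to_nat" by (auto simp: countable_def)
qed

text \<open>A countable base of balls whose pieces are made relatively compact by intersection with
  the compact sets \<open>K n\<close>. In a space that is not locally compact no base of open sets
  with this property exists, so the sets \<open>A i\<close> are Borel and not open.\<close>

lemma sigma_compact_base:
  assumes "sigma_compact (UNIV :: 'a::metric_space set)"
  obtains A :: "nat \<Rightarrow> 'a::metric_space set" where "\<And>i. A i \<in> sets borel" "\<And>i. \<exists>K. compact K \<and> A i \<subseteq> K"
    "\<And>U y. open U \<Longrightarrow> y \<in> U \<Longrightarrow> \<exists>i. y \<in> A i \<and> A i \<subseteq> U"
proof -
  obtain K :: "nat \<Rightarrow> 'a set" where K: "\<And>n. compact (K n)" "(\<Union>n. K n) = UNIV"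
    using assms unfolding sigma_compact_def by blast
  have "\<exists>C. finite C \<and> K n \<subseteq> (\<Union>x\<in>C. ball x (1 / real (Suc m)))" for n m
    using K(1)[of n] unfolding compact_eq_totally_bounded by (meson divide_pos_pos of_nat_0_less_iff zero_less_Suc zero_less_one)
  then obtain C where C: "\<And>n m. finite (C n m)" "\<And>n m. K n \<subseteq> (\<Union>x\<in>C n m. ball x (1 / real (Suc m)))"
    by metis
  define \<A> where "\<A> = (\<Union>n m. (\<lambda>x. ball x (1 / real (Suc m)) \<inter> K n) ` C n m)"
  have cnt: "countable \<A>" unfolding \<A>_def by (intro countable_UN countable_image) (auto intro: countable_finite C)
  have base: "\<exists>B\<in>\<A>. y \<in> B \<and> B \<subseteq> U" if "open U" "y \<in> U" for U y
  proof -
    from that obtain e where e: "e > 0" "ball y e \<subseteq> U" by (meson openE)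
    have "e / 2 > 0" using e(1) by simp
    then obtain m where m: "1 / real (Suc m) < e / 2" by (rule nat_approx_posE)
    obtain n where n: "y \<in> K n" using K(2) by blast
    then obtain x where x: "x \<in> C n m" "y \<in> ball x (1 / real (Suc m))" using C(2)[of n m] by blast
    have "ball x (1 / real (Suc m)) \<subseteq> ball y e"
    proof
      fix z assume "z \<in> ball x (1 / real (Suc m))"
      then show "z \<in> ball y e"
        using m x(2) dist_triangle[of y z x] by (simp add: dist_commute)
    qed
    then show ?thesis using x n e(2) unfolding \<A>_def by blast
  qed
  have ne: "\<A> \<noteq> {}" using base[OF open_UNIV UNIV_I] by blast
  show ?thesis
  proof (rule that[of "from_nat_into \<A>"])
    fix i
    have "from_nat_into \<A> i \<in> \<A>" by (rule from_nat_into[OF ne])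
    then obtain x n m where B: "from_nat_into \<A> i = ball x (1 / real (Suc m)) \<inter> K n"
      unfolding \<A>_def by blast
    have "closed (K n)" using K(1) by (rule compact_imp_closed)
    then show "from_nat_into \<A> i \<in> sets borel" unfolding B by (intro sets.Int borel_open borel_closed) auto
    show "\<exists>K. compact K \<and> from_nat_into \<A> i \<subseteq> K" unfolding B using K(1) by blast
  next
    fix U y assume "open U" "y \<in> (U :: 'a set)"
    then show "\<exists>i. y \<in> from_nat_into \<A> i \<and> from_nat_into \<A> i \<subseteq> U"
      using base cnt by (metis from_nat_into_to_nat_on)
  qed
qed

lemma emeasure_dirac_sum_count:
  assumes "B \<in> sets borel"
  shows "emeasure (dirac_sum \<omega>) B = (if finite (B \<inter> \<omega>) then of_nat (card (B \<inter> \<omega>)) else \<infinity>)"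
proof -
  have "emeasure (dirac_sum \<omega>) B = emeasure (count_space \<omega>) (B \<inter> \<omega>)"
    unfolding dirac_sum_def by (subst emeasure_distr) (use assms in auto)
  then show ?thesis by (simp add: emeasure_count_space)
qed

lemma sets_dirac_sum[simp, measurable_cong]: "sets (dirac_sum \<omega>) = sets borel"
  and space_dirac_sum[simp]: "space (dirac_sum \<omega>) = UNIV"
  by (simp_all add: dirac_sum_def)

lemma radon_measure_compact:
  assumes M: "radon_measure M" and K: "compact K"
  shows "emeasure M K < \<infinity>"
proof -
  have sets: "sets M = sets borel" using M by (simp add: radon_measure_def)
  obtain U where U: "\<And>x. open (U x)" "\<And>x. x \<in> U x" "\<And>x. emeasure M (U x) < \<infinity>"
    using M unfolding radon_measure_def by metis
  obtain T where T: "T \<subseteq> K" "finite T" "K \<subseteq> (\<Union>x\<in>T. U x)"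
    using compactE_image[OF K, of K U] U by blast
  have "emeasure M K \<le> emeasure M (\<Union>x\<in>T. U x)"
    using T U by (intro emeasure_mono) (auto simp: sets intro!: borel_open)
  also have "\<dots> \<le> (\<Sum>x\<in>T. emeasure M (U x))"
    using T U by (intro emeasure_subadditive_finite) (auto simp: sets intro!: borel_open)
  also have "\<dots> < \<infinity>" using T U by simp
  finally show ?thesis .
qed

lemma config_space_compact:
  assumes "\<omega> \<in> config_space" "compact K"
  shows "finite (\<omega> \<inter> K)"
proof (rule ccontr)
  assume inf: "infinite (\<omega> \<inter> K)"
  have "radon_measure (dirac_sum \<omega>)" using assms by (simp add: config_space_def)
  from radon_measure_compact[OF this assms(2)] inf show False
    using assms(2) by (simp add: emeasure_dirac_sum_count borel_compact Int_commute)
qed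

text \<open>Inner regularity holds because finite sets are compact: a finite
  \<open>B \<inter> \<omega>\<close> is itself such a set, and an infinite one contains finite sets
  of every size, so the supremum is infinite.\<close>

lemma radon_dirac_sum:
  assumes loc: "\<And>x. \<exists>U. open U \<and> x \<in> U \<and> finite (U \<inter> \<omega>)"
  shows "radon_measure (dirac_sum \<omega>)"
  unfolding radon_measure_def
proof (intro conjI allI ballI)
  fix x
  obtain U where "open U" "x \<in> U" "finite (U \<inter> \<omega>)" using loc by blast
  then show "\<exists>U. open U \<and> x \<in> U \<and> emeasure (dirac_sum \<omega>) U < \<infinity>"
    by (intro exI[of _ U]) (auto simp: emeasure_dirac_sum_count of_nat_less_top)
next
  fix B :: "'a set" assume B: "B \<in> sets borel"
  let ?S = "SUP K\<in>{K. compact K \<and> K \<subseteq> B}. emeasure (dirac_sum \<omega>) K"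
  have fin: "of_nat (card F) \<le> ?S" if "finite F" "F \<subseteq> B \<inter> \<omega>" for F
  proof -
    have "F \<inter> \<omega> = F" using that by auto
    then have "emeasure (dirac_sum \<omega>) F = of_nat (card F)" using that
      by (subst emeasure_dirac_sum_count) (auto intro: borel_closed finite_imp_closed)
    then show ?thesis using that by (intro SUP_upper2[of F]) (auto intro: finite_imp_compact)
  qed
  show "emeasure (dirac_sum \<omega>) B = ?S"
  proof (rule antisym)
    show "emeasure (dirac_sum \<omega>) B \<le> ?S"
    proof (cases "finite (B \<inter> \<omega>)")
      case True
      then show ?thesis using fin[of "B \<inter> \<omega>"] B by (simp add: emeasure_dirac_sum_count)
    next
      case False
      have "?S = \<top>"
      proof (rule ccontr)
        assume "?S \<noteq> \<top>"
        then have "?S < \<top>" by (simp only: less_top[symmetric] not_False_eq_True)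
        from ennreal_Ex_less_of_nat[OF this] obtain n :: nat where n: "?S < of_nat n" by blast
        obtain F where "finite F" "F \<subseteq> B \<inter> \<omega>" "card F = n"
          using infinite_arbitrarily_large[OF False] by blast
        then show False using fin[of F] n by simp
      qed
      then show ?thesis by (simp only: top_greatest)
    qed
    show "?S \<le> emeasure (dirac_sum \<omega>) B"
      by (intro SUP_least emeasure_mono) (auto simp: B)
  qed
qed simp

lemma config_space_insert:
  assumes "\<omega> \<in> config_space"
  shows "insert y \<omega> \<in> config_space"
proof -
  have "\<exists>U. open U \<and> x \<in> U \<and> finite (U \<inter> insert y \<omega>)" for x
  proof -
    obtain U where U: "open U" "x \<in> U" "emeasure (dirac_sum \<omega>) U < \<infinity>"
      using assms unfolding config_space_def radon_measure_def by blast
    then have "finite (U \<inter> \<omega>)" by (auto simp: emeasure_dirac_sum_count split: if_splits)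
    then have "finite (U \<inter> insert y \<omega>)" by (auto simp: Int_insert_right)
    then show ?thesis using U by blast
  qed
  then show ?thesis using assms by (auto simp: config_space_def radon_dirac_sum)
qed

lemma space_config_algebra[simp]: "space config_algebra = config_space"
  unfolding config_algebra_def by (rule space_measure_of) auto

lemma measurable_count_config[measurable]:
  assumes B: "B \<in> sets borel"
  shows "(\<lambda>\<omega>. emeasure (dirac_sum \<omega>) B) \<in> borel_measurable config_algebra"
proof (rule measurableI)
  fix S :: "ennreal set" assume "S \<in> sets borel"
  then have "{\<omega> \<in> config_space. emeasure (dirac_sum \<omega>) B \<in> S} \<in> sets config_algebra"
    unfolding config_algebra_def by (subst sets_measure_of) (use B in \<open>auto intro!: sigma_sets.Basic\<close>)
  then show "(\<lambda>\<omega>. emeasure (dirac_sum \<omega>) B) -` S \<inter> space config_algebra \<in> sets config_algebra"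
    by (simp add: vimage_def Collect_conj_eq Int_commute)
qed simp

section \<open>Nested finite partitions and counting profiles\<close>

locale cell_base =
  fixes A :: "nat \<Rightarrow> 'a::metric_space set"
  assumes A_borel[measurable]: "A i \<in> sets borel"
    and A_compact: "\<exists>K. compact K \<and> A i \<subseteq> K"
    and A_base: "open U \<Longrightarrow> y \<in> U \<Longrightarrow> \<exists>i. y \<in> A i \<and> A i \<subseteq> U"
begin

text \<open>The level \<open>n\<close> cells are the atoms of the algebra generated by \<open>A 0, ..., A (n - 1)\<close>; code 0 is the complement of their union.\<close>

definition cell :: "nat \<Rightarrow> 'a \<Rightarrow> nat" where
  "cell n y = set_encode {i. i < n \<and> y \<in> A i}"

text \<open>All nonzero codes of the level, including those of empty atoms. These have mass 0, so
  their terms vanish in the sums over \<open>cells n\<close>.\<close>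

definition cells :: "nat \<Rightarrow> nat set" where
  "cells n = set_encode ` Pow {..<n} - {0}"

definition coarsen :: "nat \<Rightarrow> nat \<Rightarrow> nat" where
  "coarsen m j = set_encode {i \<in> set_decode j. i < m}"

lemma finite_cells[simp]: "finite (cells n)" by (simp add: cells_def)

lemma zero_not_cells[simp]: "0 \<notin> cells n" by (simp add: cells_def)

lemma set_decode_cell[simp]: "set_decode (cell n y) = {i. i < n \<and> y \<in> A i}"
  by (simp add: cell_def set_encode_inverse)

lemma cell_eq_0: "cell n y = 0 \<longleftrightarrow> (\<forall>i<n. y \<notin> A i)"
proof
  assume "cell n y = 0"
  then have "set_decode (cell n y) = set_decode 0" by simp
  then show "\<forall>i<n. y \<notin> A i" by auto
next
  assume "\<forall>i<n. y \<notin> A i"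
  then have "{i. i < n \<and> y \<in> A i} = {}" by auto
  then show "cell n y = 0" by (simp only: cell_def set_encode_empty)
qed

lemma cell_in_cells: "cell n y \<noteq> 0 \<Longrightarrow> cell n y \<in> cells n"
  by (auto simp: cells_def cell_def)

lemma coarsen_cell: "m \<le> n \<Longrightarrow> coarsen m (cell n y) = cell m y"
proof -
  assume "m \<le> n"
  then have "{i \<in> set_decode (cell n y). i < m} = {i. i < m \<and> y \<in> A i}" by auto
  then show ?thesis by (simp add: coarsen_def cell_def)
qed

lemma coarsen_0[simp]: "coarsen m 0 = 0" by (simp add: coarsen_def)

lemma cell_vimage_borel: "cell n -` S \<in> sets borel"
proof -
  have "cell n -` S = (\<Union>T\<in>{T. T \<subseteq> {..<n} \<and> set_encode T \<in> S}. {y. \<forall>i<n. y \<in> A i \<longleftrightarrow> i \<in> T})"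
  proof (intro set_eqI iffI)
    fix y assume "y \<in> cell n -` S"
    then show "y \<in> (\<Union>T\<in>{T. T \<subseteq> {..<n} \<and> set_encode T \<in> S}. {y. \<forall>i<n. y \<in> A i \<longleftrightarrow> i \<in> T})"
      by (intro UN_I[of "{i. i < n \<and> y \<in> A i}"]) (auto simp: cell_def)
  next
    fix y assume "y \<in> (\<Union>T\<in>{T. T \<subseteq> {..<n} \<and> set_encode T \<in> S}. {y. \<forall>i<n. y \<in> A i \<longleftrightarrow> i \<in> T})"
    then obtain T where T: "T \<subseteq> {..<n}" "set_encode T \<in> S" "\<And>i. i < n \<Longrightarrow> y \<in> A i \<longleftrightarrow> i \<in> T" by blast
    then have "{i. i < n \<and> y \<in> A i} = T" by auto
    then show "y \<in> cell n -` S" using T by (simp add: cell_def)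
  qed
  also have "\<dots> \<in> sets borel"
  proof (intro sets.finite_UN)
    show "finite {T. T \<subseteq> {..<n} \<and> set_encode T \<in> S}" by (rule finite_subset[of _ "Pow {..<n}"]) auto
    fix T
    have "{y. \<forall>i<n. y \<in> A i \<longleftrightarrow> i \<in> T} = {y \<in> space borel. \<forall>i\<in>{..<n}. y \<in> A i \<longleftrightarrow> i \<in> T}" by auto
    also have "\<dots> \<in> sets borel" by measurable
    finally show "{y. \<forall>i<n. y \<in> A i \<longleftrightarrow> i \<in> T} \<in> sets borel" .
  qed
  finally show ?thesis .
qed

lemma cell_collect_borel: "{y. cell n y \<in> S} \<in> sets borel"
  using cell_vimage_borel[of n S] by (simp add: vimage_def)

lemma measurable_cell[measurable]: "cell n \<in> measurable borel (count_space UNIV)"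
  by (intro measurableI) (auto simp: cell_vimage_borel)

text \<open>\<open>A i\<close> is a union of cells of level \<open>Suc i\<close>, and every open set
  is a countable union of sets \<open>A i\<close> by the base property.\<close>

lemma borel_cells: "sets borel = sigma_sets UNIV {cell n -` S \<inter> UNIV | n S. True}"
proof (rule antisym)
  show "sigma_sets UNIV {cell n -` S \<inter> UNIV | n S. True} \<subseteq> sets borel"
    using sets.sigma_sets_subset[of "{cell n -` S \<inter> UNIV | n S. True}" borel] cell_vimage_borel by auto
  have A: "A i \<in> sigma_sets UNIV {cell n -` S \<inter> UNIV | n S. True}" for i
  proof -
    have "A i = cell (Suc i) -` {j. i \<in> set_decode j} \<inter> UNIV" by auto
    then show ?thesis by (intro sigma_sets.Basic) blast
  qed
  have "U \<in> sigma_sets UNIV {cell n -` S \<inter> UNIV | n S. True}" if "open U" for U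
  proof -
    have "U = (\<Union>i\<in>{i. A i \<subseteq> U}. A i)" using A_base[OF that] by blast
    also have "\<dots> = (\<Union>i. if A i \<subseteq> U then A i else {})" by auto
    also have "\<dots> \<in> sigma_sets UNIV {cell n -` S \<inter> UNIV | n S. True}"
    proof (rule sigma_sets.Union)
      show "(if A i \<subseteq> U then A i else {}) \<in> sigma_sets UNIV {cell n -` S \<inter> UNIV | n S. True}" for i
        using A[of i] sigma_sets.Empty by (simp only: split: if_split) blast
    qed
    finally show ?thesis .
  qed
  then show "sets borel \<subseteq> sigma_sets UNIV {cell n -` S \<inter> UNIV | n S. True}"
    by (subst borel_def, subst sets_measure_of) (auto intro!: sigma_sets_mono)
qed

definition window :: "nat \<Rightarrow> 'a set" where "window n = {y. cell n y \<noteq> 0}"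

lemma window_eq: "window n = (\<Union>i<n. A i)"
  by (auto simp: window_def cell_eq_0)

lemma window_borel[measurable]: "window n \<in> sets borel"
  by (simp add: window_eq)

lemma window_compact: "\<exists>K. compact K \<and> window n \<subseteq> K"
proof -
  obtain K where "\<And>i. compact (K i)" "\<And>i. A i \<subseteq> K i" using A_compact by metis
  then show ?thesis unfolding window_eq by (intro exI[of _ "\<Union>i<n. K i"]) (auto intro!: compact_UN)
qed

lemma window_mono: "m \<le> n \<Longrightarrow> window m \<subseteq> window n"
  unfolding window_eq by (intro UN_mono) auto

lemma window_cover: "\<exists>n. y \<in> window n"
  using A_base[of UNIV y] by (auto simp: window_eq)

lemma config_window: "\<omega> \<in> config_space \<Longrightarrow> finite (\<omega> \<inter> window n)"
  using window_compact[of n] config_space_compact by (meson finite_subset inf_mono order_refl)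

text \<open>The vector of cell counts, encoded as a multiset so that a new point acts as
  \<open>add_mset\<close>, the move made by the discrete generators. Restricting to the window keeps
  it finite.\<close>

definition profile :: "nat \<Rightarrow> 'a set \<Rightarrow> nat multiset" where
  "profile n \<omega> = image_mset (cell n) (mset_set (\<omega> \<inter> window n))"

lemma profile_cells:
  assumes "\<omega> \<in> config_space" shows "set_mset (profile n \<omega>) \<subseteq> cells n"
  using config_window[OF assms, of n] by (auto simp: profile_def window_def cell_in_cells)

lemma profile_count:
  assumes \<omega>: "\<omega> \<in> config_space" and T: "0 \<notin> T"
  shows "emeasure (dirac_sum \<omega>) {y. cell n y \<in> T} = of_nat (size (filter_mset (\<lambda>j. j \<in> T) (profile n \<omega>)))"
proof -
  have eq: "{y. cell n y \<in> T} \<inter> \<omega> = {y \<in> \<omega> \<inter> window n. cell n y \<in> T}" using T by (auto simp: window_def intro!: gr0I)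
  have "filter_mset (\<lambda>j. j \<in> T) (profile n \<omega>) = image_mset (cell n) (mset_set {y \<in> \<omega> \<inter> window n. cell n y \<in> T})"
    unfolding profile_def filter_mset_image_mset using config_window[OF \<omega>, of n] by (simp add: filter_mset_mset_set)
  moreover have "finite {y \<in> \<omega> \<inter> window n. cell n y \<in> T}"
    by (rule finite_subset[OF _ config_window[OF \<omega>, of n]]) auto
  ultimately show ?thesis
    by (subst emeasure_dirac_sum_count[OF cell_collect_borel]) (simp add: eq)
qed

lemma profile_eq_iff:
  assumes \<omega>: "\<omega> \<in> config_space"
  shows "profile n \<omega> = k \<longleftrightarrow> set_mset k \<subseteq> cells n \<and> (\<forall>i\<in>cells n. emeasure (dirac_sum \<omega>) {y. cell n y = i} = of_nat (count k i))"
proof -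
  have c: "emeasure (dirac_sum \<omega>) {y. cell n y = i} = of_nat (count (profile n \<omega>) i)" if "i \<in> cells n" for i
  proof -
    have "i \<noteq> 0" using that by (metis zero_not_cells)
    then show ?thesis using profile_count[OF \<omega>, of "{i}" n] by (simp add: filter_eq_replicate_mset)
  qed
  show ?thesis
  proof
    assume "profile n \<omega> = k" then show "set_mset k \<subseteq> cells n \<and> (\<forall>i\<in>cells n. emeasure (dirac_sum \<omega>) {y. cell n y = i} = of_nat (count k i))"
      using c profile_cells[OF \<omega>] by auto
  next
    assume k: "set_mset k \<subseteq> cells n \<and> (\<forall>i\<in>cells n. emeasure (dirac_sum \<omega>) {y. cell n y = i} = of_nat (count k i))"
    show "profile n \<omega> = k"
    proof (rule multiset_eqI)
      fix i
      show "count (profile n \<omega>) i = count k i"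
      proof (cases "i \<in> cells n")
        case True then show ?thesis using c k by (metis of_nat_eq_iff)
      next
        case False then show ?thesis using k profile_cells[OF \<omega>, of n] by (metis not_in_iff subsetD)
      qed
    qed
  qed
qed

text \<open>Points of the fine window outside the coarse one are sent to code 0 by
  \<open>coarsen m\<close>; the filter removes them.\<close>

lemma profile_coarsen:
  assumes \<omega>: "\<omega> \<in> config_space" and mn: "m \<le> n"
  shows "profile m \<omega> = filter_mset (\<lambda>j. j \<noteq> 0) (image_mset (coarsen m) (profile n \<omega>))"
proof -
  have "image_mset (coarsen m) (profile n \<omega>) = image_mset (cell m) (mset_set (\<omega> \<inter> window n))"
    unfolding profile_def multiset.map_comp comp_def coarsen_cell[OF mn] ..
  also have "filter_mset (\<lambda>j. j \<noteq> 0) \<dots> = image_mset (cell m) (mset_set {y \<in> \<omega> \<inter> window n. cell m y \<noteq> 0})"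
    unfolding filter_mset_image_mset using config_window[OF \<omega>, of n] by (simp add: filter_mset_mset_set)
  also have "{y \<in> \<omega> \<inter> window n. cell m y \<noteq> 0} = \<omega> \<inter> window m"
    using window_mono[OF mn] by (auto simp: window_def)
  finally show ?thesis by (simp add: profile_def)
qed

lemma profile_insert:
  assumes \<omega>: "\<omega> \<in> config_space" and y: "y \<notin> \<omega>" "cell n y \<noteq> 0"
  shows "profile n (insert y \<omega>) = add_mset (cell n y) (profile n \<omega>)"
proof -
  have "insert y \<omega> \<inter> window n = insert y (\<omega> \<inter> window n)" using y by (auto simp: window_def)
  then show ?thesis using y config_window[OF \<omega>, of n] by (simp add: profile_def)
qed

lemma measurable_profile[measurable]: "profile n \<in> measurable config_algebra (count_space UNIV)"
proof (subst measurable_count_space_eq2_countable, safe)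
  fix k
  have "profile n -` {k} \<inter> space config_algebra = {\<omega> \<in> space config_algebra. set_mset k \<subseteq> cells n \<and>
     (\<forall>i\<in>cells n. emeasure (dirac_sum \<omega>) {y. cell n y = i} = of_nat (count k i))}"
    using profile_eq_iff[of _ n k] by auto
  also have "\<dots> \<in> sets config_algebra"
  proof -
    have [measurable]: "{y. cell n y = i} \<in> sets borel" for i using cell_collect_borel[of n "{i}"] by simp
    show ?thesis by measurable
  qed
  finally show "profile n -` {k} \<inter> space config_algebra \<in> sets config_algebra" .
qed (auto intro: countableI_type)

lemma Int_stable_cells: "Int_stable {cell n -` S \<inter> UNIV | n S. True}"
proof (rule Int_stableI)
  fix B C assume "B \<in> {cell n -` S \<inter> UNIV | n S. True}" "C \<in> {cell n -` S \<inter> UNIV | n S. True}"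
  then obtain m S n T where BC: "B = cell m -` S" "C = cell n -` T" by auto
  have "B \<inter> C = cell (max m n) -` {j. coarsen m j \<in> S \<and> coarsen n j \<in> T} \<inter> UNIV"
    by (auto simp: BC coarsen_cell)
  then show "B \<inter> C \<in> {cell n -` S \<inter> UNIV | n S. True}" by blast
qed

text \<open>The hard inclusion asks for all Borel counts to be functions of the profiles up to
  limits. Dynkin induction is run on \<open>B \<inter> window n\<close>, where counts are finite and
  the count of a complement is a genuine difference; then \<open>n\<close> tends to infinity by
  monotone continuity.\<close>

lemma config_algebra_profiles:
  "sets config_algebra = sigma_sets config_space {profile n -` S \<inter> config_space | n S. True}" (is "_ = sigma_sets _ ?G")
proof (rule antisym)
  have "?G \<subseteq> sets config_algebra"
    using measurable_sets[OF measurable_profile] by auto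
  then show "sigma_sets config_space ?G \<subseteq> sets config_algebra"
    using sets.sigma_sets_subset[of ?G config_algebra] by simp
  define \<Sigma> where "\<Sigma> = sigma config_space ?G"
  have sp: "space \<Sigma> = config_space" and st: "sets \<Sigma> = sigma_sets config_space ?G"
    unfolding \<Sigma>_def by (auto intro!: space_measure_of sets_measure_of)
  have prof[measurable]: "profile n \<in> measurable \<Sigma> (count_space UNIV)" for n
    by (rule measurableI) (auto simp: sp st intro!: sigma_sets.Basic)
  have window_part: "(\<lambda>\<omega>. emeasure (dirac_sum \<omega>) (B \<inter> window n)) \<in> borel_measurable \<Sigma>" if "B \<in> sets borel" for B n
  proof -
    have "{cell n -` S \<inter> UNIV | n S. True} \<subseteq> Pow UNIV" by auto
    with Int_stable_cells show ?thesis using that[unfolded borel_cells]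
    proof (induction rule: sigma_sets_induct_disjoint)
      case (basic B)
      then obtain m S where B: "B = cell m -` S" by auto
      define T where "T = {j. coarsen m j \<in> S \<and> coarsen n j \<noteq> 0}"
      have "B \<inter> window n = {y. cell (max m n) y \<in> T}" by (auto simp: B T_def coarsen_cell window_def)
      moreover have "0 \<notin> T" by (simp add: T_def)
      ultimately have "emeasure (dirac_sum \<omega>) (B \<inter> window n) = of_nat (size (filter_mset (\<lambda>j. j \<in> T) (profile (max m n) \<omega>)))"
        if "\<omega> \<in> space \<Sigma>" for \<omega> using profile_count that sp by simp
      then show ?case
        by (subst measurable_cong) (auto intro!: measurable_compose[OF prof, of "\<lambda>k. of_nat (size (filter_mset (\<lambda>j. j \<in> T) k))"])
    next
      case empty then show ?case by simp
    next
      case (compl B)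
      have B: "B \<in> sets borel" using compl(1) borel_cells by simp
      have W: "(\<lambda>\<omega>. emeasure (dirac_sum \<omega>) (window n)) \<in> borel_measurable \<Sigma>"
      proof -
        have "emeasure (dirac_sum \<omega>) (window n) = of_nat (size (filter_mset (\<lambda>j. j \<in> - {0}) (profile n \<omega>)))"
          if "\<omega> \<in> space \<Sigma>" for \<omega> using profile_count[of \<omega> "- {0}" n] that sp by (simp add: window_def)
        then show ?thesis
          by (subst measurable_cong) (auto intro!: measurable_compose[OF prof, of "\<lambda>k. of_nat (size (filter_mset (\<lambda>j. j \<in> - {0}) k))"])
      qed
      have "emeasure (dirac_sum \<omega>) ((UNIV - B) \<inter> window n) = emeasure (dirac_sum \<omega>) (window n) - emeasure (dirac_sum \<omega>) (B \<inter> window n)"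
        if "\<omega> \<in> space \<Sigma>" for \<omega>
      proof -
        have "finite (window n \<inter> \<omega>)" using config_window[of \<omega> n] that sp by (simp add: Int_commute)
        then have "finite (B \<inter> window n \<inter> \<omega>)" by (rule finite_subset[rotated]) auto
        then have "emeasure (dirac_sum \<omega>) (B \<inter> window n) \<noteq> \<infinity>"
          using B by (simp add: emeasure_dirac_sum_count)
        moreover have "(UNIV - B) \<inter> window n = window n - (B \<inter> window n)" by auto
        ultimately show ?thesis using B by (simp add: emeasure_Diff)
      qed
      then show ?case
        by (rule measurable_cong[THEN iffD2]) (use W compl(2) in auto)
    next
      case (union B)
      have B: "B i \<in> sets borel" for i using union(2) borel_cells by auto
      have "emeasure (dirac_sum \<omega>) (\<Union> (range B) \<inter> window n) = (\<Sum>i. emeasure (dirac_sum \<omega>) (B i \<inter> window n))" for \<omega>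
      proof -
        have "disjoint_family (\<lambda>i. B i \<inter> window n)" using union(1) by (auto simp: disjoint_family_on_def)
        then have "(\<Sum>i. emeasure (dirac_sum \<omega>) (B i \<inter> window n)) = emeasure (dirac_sum \<omega>) (\<Union>i. B i \<inter> window n)"
          using B by (intro suminf_emeasure) auto
        then show ?thesis by (simp add: Int_UN_distrib2)
      qed
      then show ?case using union(3) by simp
    qed
  qed
  have "(\<lambda>\<omega>. emeasure (dirac_sum \<omega>) B) \<in> borel_measurable \<Sigma>" if B: "B \<in> sets borel" for B
  proof -
    have "emeasure (dirac_sum \<omega>) B = (SUP n. emeasure (dirac_sum \<omega>) (B \<inter> window n))" for \<omega>
    proof -
      have "(SUP n. emeasure (dirac_sum \<omega>) (B \<inter> window n)) = emeasure (dirac_sum \<omega>) (\<Union>n. B \<inter> window n)"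
        using B window_mono by (intro SUP_emeasure_incseq) (auto simp: incseq_def)
      also have "(\<Union>n. B \<inter> window n) = B" using window_cover by auto
      finally show ?thesis ..
    qed
    then show ?thesis using window_part[OF B] by simp
  qed
  then have "{{\<omega> \<in> config_space. emeasure (dirac_sum \<omega>) B \<in> S} | B S. B \<in> sets borel \<and> S \<in> sets borel} \<subseteq> sets \<Sigma>"
    using measurable_sets[of "\<lambda>\<omega>. emeasure (dirac_sum \<omega>) _" \<Sigma> borel] by (fastforce simp: sp vimage_def Int_def conj_commute)
  then have d: "sigma_sets config_space {{\<omega> \<in> config_space. emeasure (dirac_sum \<omega>) B \<in> S} | B S. B \<in> sets borel \<and> S \<in> sets borel} \<subseteq> sets \<Sigma>"
    using sets.sigma_sets_subset[of _ \<Sigma>] sp by simp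
  have e: "sets config_algebra = sigma_sets config_space {{\<omega> \<in> config_space. emeasure (dirac_sum \<omega>) B \<in> S} | B S. B \<in> sets borel \<and> S \<in> sets borel}"
    unfolding config_algebra_def by (rule sets_measure_of) auto
  show "sets config_algebra \<subseteq> sigma_sets config_space ?G" using d unfolding st e .
qed

text \<open>Membership is expressed by countably many counts, which makes it jointly measurable in
  the configuration and the point. If \<open>y\<close> is not in \<open>\<omega>\<close>, removing
  the finitely many points of \<open>\<omega>\<close> from a small neighbourhood leaves an open set
  around \<open>y\<close>, and some \<open>A i\<close> inside it has count 0.\<close>

lemma mem_config_iff:
  assumes "\<omega> \<in> config_space"
  shows "y \<in> \<omega> \<longleftrightarrow> (\<forall>i. y \<in> A i \<longrightarrow> emeasure (dirac_sum \<omega>) (A i) \<noteq> 0)"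
proof
  assume y: "y \<in> \<omega>"
  show "\<forall>i. y \<in> A i \<longrightarrow> emeasure (dirac_sum \<omega>) (A i) \<noteq> 0"
    using y by (auto simp: emeasure_dirac_sum_count card_eq_0_iff)
next
  assume *: "\<forall>i. y \<in> A i \<longrightarrow> emeasure (dirac_sum \<omega>) (A i) \<noteq> 0"
  show "y \<in> \<omega>"
  proof (rule ccontr)
    assume y: "y \<notin> \<omega>"
    obtain U where U: "open U" "y \<in> U" "emeasure (dirac_sum \<omega>) U < \<infinity>"
      using assms unfolding config_space_def radon_measure_def by blast
    then have "finite (U \<inter> \<omega>)" by (auto simp: emeasure_dirac_sum_count split: if_splits)
    then have "open (U - (U \<inter> \<omega>))" using U by (intro open_Diff finite_imp_closed)
    moreover have "y \<in> U - (U \<inter> \<omega>)" using U y by auto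
    ultimately obtain i where "y \<in> A i" "A i \<subseteq> U - (U \<inter> \<omega>)" using A_base by blast
    moreover from this have "A i \<inter> \<omega> = {}" by auto
    ultimately show False using * by (auto simp: emeasure_dirac_sum_count)
  qed
qed

end

section \<open>The Poisson measure and the Mecke formula\<close>

locale poisson_cells = cell_base A for A :: "nat \<Rightarrow> 'a::metric_space set" +
  fixes \<nu> :: "'a measure" and P :: "'a set measure"
  assumes radon: "radon_measure \<nu>" and diffuse: "diffuse \<nu>" and poisson: "poisson_measure \<nu> P"
begin

lemma sets_\<nu>[simp, measurable_cong]: "sets \<nu> = sets borel"
  using radon by (simp add: radon_measure_def)

lemma space_\<nu>[simp]: "space \<nu> = UNIV"
  using sets_eq_imp_space_eq[OF sets_\<nu>] by simp

lemma sets_P[simp, measurable_cong]: "sets P = sets config_algebra"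
  using poisson by (simp add: poisson_measure_def)

lemma space_P[simp]: "space P = config_space"
  using sets_eq_imp_space_eq[OF sets_P] by simp

sublocale P: prob_space P
  using poisson unfolding poisson_measure_def by blast

lemma window_\<nu>: "emeasure \<nu> (window n) < \<infinity>"
proof -
  obtain K where K: "compact K" "window n \<subseteq> K" using window_compact by blast
  then have "emeasure \<nu> (window n) \<le> emeasure \<nu> K" by (intro emeasure_mono) (auto simp: borel_compact)
  also have "\<dots> < \<infinity>" by (rule radon_measure_compact[OF radon K(1)])
  finally show ?thesis .
qed

sublocale N: sigma_finite_measure \<nu>
proof
  show "\<exists>C. countable C \<and> C \<subseteq> sets \<nu> \<and> \<Union> C = space \<nu> \<and> (\<forall>a\<in>C. emeasure \<nu> a \<noteq> \<infinity>)"
    using window_cover window_\<nu> by (intro exI[of _ "range window"]) (force simp: less_top)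
qed

sublocale PN: pair_sigma_finite P \<nu> ..

sublocale PP: pair_sigma_finite P P ..

lemma poisson_counts:
  fixes n :: nat
  assumes "\<forall>i<n. B i \<in> sets borel \<and> emeasure \<nu> (B i) < \<infinity>" "disjoint_family_on B {..<n}"
  shows "measure P {\<omega> \<in> space P. \<forall>i<n. emeasure (dirac_sum \<omega>) (B i) = of_nat (k i)} =
    (\<Prod>i<n. measure \<nu> (B i) ^ k i / fact (k i) * exp (- measure \<nu> (B i)))"
  using poisson[unfolded poisson_measure_def, THEN conjunct2, THEN conjunct2, THEN spec, THEN spec, THEN spec, THEN mp, THEN mp, OF assms] .

definition cell_set :: "nat \<Rightarrow> nat \<Rightarrow> 'a set" where "cell_set n i = {y. cell n y = i}"

lemma cell_set_borel[measurable]: "cell_set n i \<in> sets borel"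
  using cell_collect_borel[of n "{i}"] by (simp add: cell_set_def)

lemma cell_set_finite: "i \<noteq> 0 \<Longrightarrow> emeasure \<nu> (cell_set n i) < \<infinity>"
  using window_\<nu>[of n] emeasure_mono[of "cell_set n i" "window n" \<nu>] by (force simp: cell_set_def window_def)

definition mass :: "nat \<Rightarrow> nat \<Rightarrow> real" where "mass n i = measure \<nu> (cell_set n i)"

definition profile_prob :: "nat \<Rightarrow> nat multiset \<Rightarrow> real" where "profile_prob n k = measure P {\<omega> \<in> space P. profile n \<omega> = k}"

lemma emeasure_cell_set: "i \<in> cells n \<Longrightarrow> emeasure \<nu> (cell_set n i) = ennreal (mass n i)"
  using cell_set_finite[of i n] by (metis mass_def emeasure_eq_ennreal_measure infinity_ennreal_def order_less_irrefl zero_not_cells)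

lemma measurable_profile_P[measurable]: "profile n \<in> measurable P (count_space UNIV)"
  using measurable_profile[of n] by (simp cong: measurable_cong_sets)

lemma emeasure_profile: "emeasure P {\<omega> \<in> space P. profile n \<omega> = k} = ennreal (profile_prob n k)"
  by (simp add: profile_prob_def P.emeasure_eq_measure)

lemma profile_prob_nonneg[simp]: "0 \<le> profile_prob n k" by (simp add: profile_prob_def)

lemma mass_nonneg[simp]: "0 \<le> mass n i" by (simp add: mass_def)

lemma profile_prob_supp: "\<not> set_mset k \<subseteq> cells n \<Longrightarrow> profile_prob n k = 0"
proof -
  assume "\<not> set_mset k \<subseteq> cells n"
  then have "{\<omega> \<in> space P. profile n \<omega> = k} = {}" using profile_cells by auto
  then show ?thesis by (simp only: profile_prob_def measure_empty)
qed

lemma profile_prob_prod: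
  assumes k: "set_mset k \<subseteq> cells n"
  shows "profile_prob n k = (\<Prod>i\<in>cells n. mass n i ^ count k i / fact (count k i) * exp (- mass n i))"
proof -
  \<comment> \<open>\<open>poisson_measure\<close> speaks of families indexed by an initial segment
    of the naturals, so the cells are enumerated.\<close>
  obtain h where h: "bij_betw h {0..<card (cells n)} (cells n)" using ex_bij_betw_nat_finite[OF finite_cells] by blast
  have h': "bij_betw h {..<card (cells n)} (cells n)" using h by (simp add: atLeast0LessThan)
  have hc: "h j \<in> cells n" if "j < card (cells n)" for j using h' that by (auto simp: bij_betw_def)
  have dj: "disjoint_family_on (\<lambda>j. cell_set n (h j)) {..<card (cells n)}"
    using h' by (auto simp: disjoint_family_on_def cell_set_def bij_betw_def inj_on_def)
  have fn: "\<forall>j<card (cells n). cell_set n (h j) \<in> sets borel \<and> emeasure \<nu> (cell_set n (h j)) < \<infinity>"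
    using hc by (auto simp: emeasure_cell_set)
  have "measure P {\<omega> \<in> space P. \<forall>j<card (cells n). emeasure (dirac_sum \<omega>) (cell_set n (h j)) = of_nat (count k (h j))} =
    (\<Prod>j<card (cells n). measure \<nu> (cell_set n (h j)) ^ count k (h j) / fact (count k (h j)) * exp (- measure \<nu> (cell_set n (h j))))"
    by (rule poisson_counts[OF fn dj])
  also have "(\<Prod>j<card (cells n). measure \<nu> (cell_set n (h j)) ^ count k (h j) / fact (count k (h j)) * exp (- measure \<nu> (cell_set n (h j))))
    = (\<Prod>i\<in>cells n. mass n i ^ count k i / fact (count k i) * exp (- mass n i))"
    unfolding mass_def by (rule prod.reindex_bij_betw[OF h'])
  also have "{\<omega> \<in> space P. \<forall>j<card (cells n). emeasure (dirac_sum \<omega>) (cell_set n (h j)) = of_nat (count k (h j))} = {\<omega> \<in> space P. profile n \<omega> = k}"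
  proof -
    have "(\<forall>j<card (cells n). emeasure (dirac_sum \<omega>) (cell_set n (h j)) = of_nat (count k (h j))) \<longleftrightarrow>
      (\<forall>i\<in>cells n. emeasure (dirac_sum \<omega>) (cell_set n i) = of_nat (count k i))" for \<omega>
    proof -
      have im: "h ` {..<card (cells n)} = cells n" using h' by (rule bij_betw_imp_surj_on)
      have "(\<forall>i\<in>h ` {..<card (cells n)}. Q i) \<longleftrightarrow> (\<forall>j<card (cells n). Q (h j))" for Q by auto
      then show ?thesis unfolding im by simp
    qed
    moreover have "profile n \<omega> = k \<longleftrightarrow> (\<forall>i\<in>cells n. emeasure (dirac_sum \<omega>) (cell_set n i) = of_nat (count k i))" if "\<omega> \<in> space P" for \<omega>
      using profile_eq_iff[of \<omega> n k] k that by (simp add: cell_set_def)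
    ultimately show ?thesis by (intro Collect_cong) (simp only: cong: conj_cong)
  qed
  finally show ?thesis by (simp add: profile_prob_def)
qed

text \<open>Adding a point to cell \<open>i\<close> changes only the \<open>i\<close>-th Poisson
  factor, by \<open>mass n i / Suc (count k i)\<close>. Outside the support both sides are
  0.\<close>

lemma profile_prob_stein:
  assumes i: "i \<in> cells n"
  shows "mass n i * profile_prob n k = real (Suc (count k i)) * profile_prob n (add_mset i k)"
proof (cases "set_mset k \<subseteq> cells n")
  case True
  let ?g = "\<lambda>k j. mass n j ^ count k j / fact (count k j) * exp (- mass n j)"
  have "profile_prob n k = ?g k i * (\<Prod>j\<in>cells n - {i}. ?g k j)"
    using i by (simp add: profile_prob_prod[OF True] prod.remove)
  moreover have "profile_prob n (add_mset i k) = ?g (add_mset i k) i * (\<Prod>j\<in>cells n - {i}. ?g (add_mset i k) j)"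
    using i True by (subst profile_prob_prod) (simp_all add: prod.remove)
  moreover have "(\<Prod>j\<in>cells n - {i}. ?g (add_mset i k) j) = (\<Prod>j\<in>cells n - {i}. ?g k j)"
    by (intro prod.cong) auto
  moreover have "mass n i * ?g k i = real (Suc (count k i)) * ?g (add_mset i k) i"
    by (simp add: field_simps del: of_nat_Suc)
  ultimately show ?thesis by (simp only: mult.assoc[symmetric])
next
  case False
  then show ?thesis using profile_prob_supp[of k n] profile_prob_supp[of "add_mset i k" n] by simp
qed

text \<open>The count on a single point is Poisson with mean 0, as \<open>\<nu>\<close> is
  diffuse.\<close>

lemma AE_not_mem: "AE \<omega> in P. y \<notin> \<omega>"
proof -
  have y: "{y} \<in> sets borel" "emeasure \<nu> {y} = 0" using diffuse by (auto simp: diffuse_def)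
  have dj: "disjoint_family_on (\<lambda>j::nat. {y}) {..<1}" by (auto simp: disjoint_family_on_def)
  have fn: "\<forall>j<(1::nat). {y} \<in> sets borel \<and> emeasure \<nu> {y} < \<infinity>" using y by simp
  have *: "measure P {\<omega> \<in> space P. \<forall>j<(1::nat). emeasure (dirac_sum \<omega>) {y} = of_nat 0} =
    (\<Prod>j<(1::nat). measure \<nu> {y} ^ 0 / fact 0 * exp (- measure \<nu> {y}))"
    by (rule poisson_counts[OF fn dj, of "\<lambda>_. 0"])
  have "P.prob {\<omega> \<in> space P. emeasure (dirac_sum \<omega>) {y} = 0} = 1"
  proof -
    have "measure \<nu> {y} = 0" using y by (simp add: measure_def)
    then show ?thesis using * by simp
  qed
  then have "AE \<omega> in P. emeasure (dirac_sum \<omega>) {y} = 0"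
  proof (subst (asm) P.prob_Collect_eq_1)
    have [measurable]: "{y} \<in> sets borel" by (rule y)
    show "{\<omega> \<in> space P. emeasure (dirac_sum \<omega>) {y} = 0} \<in> P.events" by measurable
  qed
  then show ?thesis
    by eventually_elim (use y in \<open>auto simp: emeasure_dirac_sum_count split: if_splits\<close>)
qed

lemma measurable_mem: "{x \<in> space (P \<Otimes>\<^sub>M \<nu>). snd x \<in> fst x} \<in> sets (P \<Otimes>\<^sub>M \<nu>)"
proof -
  have "{x \<in> space (P \<Otimes>\<^sub>M \<nu>). snd x \<in> fst x}
    = {x \<in> space (P \<Otimes>\<^sub>M \<nu>). \<forall>i. snd x \<in> A i \<longrightarrow> emeasure (dirac_sum (fst x)) (A i) \<noteq> 0}"
    by (auto simp: space_pair_measure mem_config_iff)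
  also have "\<dots> \<in> sets (P \<Otimes>\<^sub>M \<nu>)" by measurable
  finally show ?thesis .
qed

lemma AE_pair_not_mem: "AE x in P \<Otimes>\<^sub>M \<nu>. snd x \<notin> fst x"
proof -
  have m: "{x \<in> space (P \<Otimes>\<^sub>M \<nu>). snd x \<notin> fst x} \<in> sets (P \<Otimes>\<^sub>M \<nu>)"
    using measurable_mem by (rule sets.sets_Collect_neg)
  have "AE \<omega> in P. AE y in \<nu>. y \<notin> \<omega>"
    by (subst PN.AE_commute) (use m AE_not_mem in auto)
  then show ?thesis using PN.AE_pair_iff[of "\<lambda>\<omega> y. y \<notin> \<omega>"] m by simp
qed

lemma profile_insert_cases:
  assumes "\<omega> \<in> config_space"
  shows "profile n (insert y \<omega>) = (if y \<in> \<omega> \<or> cell n y = 0 then profile n \<omega> else add_mset (cell n y) (profile n \<omega>))"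
proof -
  have "insert y \<omega> \<inter> window n = \<omega> \<inter> window n" if "cell n y = 0" using that by (auto simp: window_def)
  then show ?thesis using profile_insert[OF assms] by (auto simp: insert_absorb profile_def)
qed

text \<open>Makes \<open>F (insert y \<omega>)\<close> jointly measurable. Preimages of profile
  events suffice, and the profile after insertion is a function of the old profile, the cell of
  \<open>y\<close> and whether \<open>y\<close> was already present.\<close>

lemma measurable_insert[measurable]: "(\<lambda>x. insert (snd x) (fst x)) \<in> measurable (P \<Otimes>\<^sub>M \<nu>) P"
proof (rule measurable_sigma_sets[where A="{profile n -` S \<inter> config_space | n S. True}" and \<Omega>=config_space])
  show "(\<lambda>x. insert (snd x) (fst x)) \<in> space (P \<Otimes>\<^sub>M \<nu>) \<rightarrow> config_space"
    by (auto simp: space_pair_measure config_space_insert)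
  fix Y assume "Y \<in> {profile n -` S \<inter> config_space | n S. True}"
  then obtain n S where Y: "Y = profile n -` S \<inter> config_space" by blast
  have fc: "fst x \<in> config_space" if "x \<in> space (P \<Otimes>\<^sub>M \<nu>)" for x
    using that by (auto simp: space_pair_measure)
  have "(\<lambda>x. insert (snd x) (fst x)) -` Y \<inter> space (P \<Otimes>\<^sub>M \<nu>) = {x \<in> space (P \<Otimes>\<^sub>M \<nu>). profile n (insert (snd x) (fst x)) \<in> S}"
    using fc by (auto simp: Y config_space_insert)
  also have "\<dots> = {x \<in> space (P \<Otimes>\<^sub>M \<nu>). if snd x \<in> fst x \<or> cell n (snd x) = 0 then profile n (fst x) \<in> S else add_mset (cell n (snd x)) (profile n (fst x)) \<in> S}"
    by (rule Collect_cong) (simp add: profile_insert_cases[OF fc] cong: conj_cong)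
  also have "\<dots> \<in> sets (P \<Otimes>\<^sub>M \<nu>)"
  proof -
    note [measurable] = measurable_mem
    have [measurable]: "Measurable.pred (P \<Otimes>\<^sub>M \<nu>) (\<lambda>x. snd x \<in> fst x)" using measurable_mem by (simp add: pred_def)
    have [measurable]: "(\<lambda>x. (cell n (snd x), profile n (fst x))) \<in> measurable (P \<Otimes>\<^sub>M \<nu>) (count_space UNIV)"
      by (subst pair_measure_countable[symmetric, of UNIV UNIV, simplified]) simp_all
    have [measurable]: "Measurable.pred (P \<Otimes>\<^sub>M \<nu>) (\<lambda>x. add_mset (cell n (snd x)) (profile n (fst x)) \<in> S)"
      using measurable_compose[OF \<open>(\<lambda>x. (cell n (snd x), profile n (fst x))) \<in> _\<close>, of "\<lambda>p. add_mset (fst p) (snd p) \<in> S" "count_space UNIV"] by simp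
    have [measurable]: "Measurable.pred (P \<Otimes>\<^sub>M \<nu>) (\<lambda>x. profile n (fst x) \<in> S)" by measurable
    show ?thesis by measurable
  qed
  finally show "(\<lambda>x. insert (snd x) (fst x)) -` Y \<inter> space (P \<Otimes>\<^sub>M \<nu>) \<in> sets (P \<Otimes>\<^sub>M \<nu>)" .
qed (auto simp: config_algebra_profiles)

text \<open>No cell is excluded here, since \<open>P\<close> is finite.\<close>

sublocale Om: code_filtration P profile "\<lambda>_. False"
proof
  fix m n :: nat assume "m \<le> n"
  then show "\<exists>r. \<forall>x\<in>space P. profile m x = r (profile n x)"
    by (intro exI[of _ "\<lambda>k. filter_mset (\<lambda>j. j \<noteq> 0) (image_mset (coarsen m) k)"]) (auto simp: profile_coarsen)
qed (auto simp: config_algebra_profiles P.emeasure_eq_measure)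

lemma measurable_pair_code[measurable]:
  "(\<lambda>x. (profile n (fst x), cell n (snd x))) \<in> measurable (P \<Otimes>\<^sub>M \<nu>) (count_space UNIV)"
  by (subst pair_measure_countable[symmetric, of UNIV UNIV, simplified]) simp_all

text \<open>Codes are pairs of a profile and a cell. The complement of the window is excluded
  because \<open>\<nu>\<close> may be infinite there.\<close>

sublocale OX: code_filtration "P \<Otimes>\<^sub>M \<nu>" "\<lambda>n x. (profile n (fst x), cell n (snd x))" "\<lambda>b. snd b = 0"
proof
  fix m n :: nat assume mn: "m \<le> n"
  show "\<exists>r. \<forall>x\<in>space (P \<Otimes>\<^sub>M \<nu>). (profile m (fst x), cell m (snd x)) = r (profile n (fst x), cell n (snd x))"
    by (intro exI[of _ "\<lambda>(k, i). (filter_mset (\<lambda>j. j \<noteq> 0) (image_mset (coarsen m) k), coarsen m i)"])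
      (use mn in \<open>auto simp: space_pair_measure profile_coarsen coarsen_cell\<close>)
  show "snd (profile m (fst x), cell m (snd x)) = 0" if "snd (profile n (fst x), cell n (snd x)) = 0" for x
    using that mn by (auto simp: cell_eq_0)
next
  let ?G = "{(\<lambda>x. (profile n (fst x), cell n (snd x))) -` S \<inter> space (P \<Otimes>\<^sub>M \<nu>) | n S. True}"
  let ?E = "{profile n -` S \<inter> config_space | n S. True}" and ?C = "{cell n -` S \<inter> UNIV | n S. True}"
  have "?G \<subseteq> sets (P \<Otimes>\<^sub>M \<nu>)" using measurable_sets[OF measurable_pair_code] by auto
  then have 1: "sigma_sets (space (P \<Otimes>\<^sub>M \<nu>)) ?G \<subseteq> sets (P \<Otimes>\<^sub>M \<nu>)" by (rule sets.sigma_sets_subset)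
  have "sets (P \<Otimes>\<^sub>M \<nu>) = sets (sigma (space P \<times> space \<nu>) {a \<times> b | a b. a \<in> ?E \<and> b \<in> ?C})"
  proof (rule sets_pair_eq)
    show "sets P = sigma_sets (space P) ?E" by (simp add: config_algebra_profiles)
    show "sets \<nu> = sigma_sets (space \<nu>) ?C" using borel_cells by simp
    show "{config_space} \<subseteq> ?E" using exI[of "\<lambda>n. \<exists>S. config_space = profile n -` S \<inter> config_space" 0] by auto
    show "{UNIV} \<subseteq> ?C" by (auto intro!: exI[of _ 0] exI[of _ UNIV])
  qed auto
  also have "\<dots> = sigma_sets (space P \<times> space \<nu>) {a \<times> b | a b. a \<in> ?E \<and> b \<in> ?C}"
    by (rule sets_measure_of) auto
  also have "\<dots> \<subseteq> sigma_sets (space (P \<Otimes>\<^sub>M \<nu>)) ?G"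
  proof (unfold space_pair_measure, rule sigma_sets_mono')
    show "{a \<times> b | a b. a \<in> ?E \<and> b \<in> ?C} \<subseteq> {(\<lambda>x. (profile n (fst x), cell n (snd x))) -` S \<inter> space P \<times> space \<nu> | n S. True}"
    proof safe
      fix m n :: nat and S T
      let ?L = "max m n"
      have "(profile m -` S \<inter> config_space) \<times> (cell n -` T \<inter> UNIV) =
        (\<lambda>x. (profile ?L (fst x), cell ?L (snd x))) -` {(k, i). filter_mset (\<lambda>j. j \<noteq> 0) (image_mset (coarsen m) k) \<in> S \<and> coarsen n i \<in> T} \<inter> space P \<times> space \<nu>"
        by (auto simp: profile_coarsen[of _ m ?L] coarsen_cell)
      then show "\<exists>na Sa. (profile m -` S \<inter> config_space) \<times> (cell n -` T \<inter> UNIV) =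
        (\<lambda>x. (profile na (fst x), cell na (snd x))) -` Sa \<inter> space P \<times> space \<nu> \<and> True" by blast
    qed
  qed
  finally show "sets (P \<Otimes>\<^sub>M \<nu>) = sigma_sets (space (P \<Otimes>\<^sub>M \<nu>)) ?G" using 1 by blast
next
  fix x assume "x \<in> space (P \<Otimes>\<^sub>M \<nu>)"
  show "\<exists>n. snd (profile n (fst x), cell n (snd x)) \<noteq> 0"
    using window_cover[of "snd x"] by (auto simp: window_def)
next
  fix n
  have *: "{x \<in> space (P \<Otimes>\<^sub>M \<nu>). snd (profile n (fst x), cell n (snd x)) \<noteq> 0} = space P \<times> window n"
    by (auto simp: space_pair_measure window_def)
  show "emeasure (P \<Otimes>\<^sub>M \<nu>) {x \<in> space (P \<Otimes>\<^sub>M \<nu>). snd (profile n (fst x), cell n (snd x)) \<noteq> 0} < \<infinity>"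
  proof -
    have "emeasure (P \<Otimes>\<^sub>M \<nu>) (space P \<times> window n) = emeasure P (space P) * emeasure \<nu> (window n)"
      using sets.top[of P] by (intro N.emeasure_pair_measure_Times) auto
    then show ?thesis using window_\<nu>[of n] * by (simp only: P.emeasure_space_1 mult_1)
  qed
qed (rule measurable_pair_code)

end

lemma (in poisson_cells) nn_integral_profile:
  "(\<integral>\<^sup>+\<omega>. \<phi> (profile n \<omega>) \<partial>P) = (\<integral>\<^sup>+k. ennreal (profile_prob n k) * \<phi> k \<partial>count_space UNIV)"
proof -
  have "(\<integral>\<^sup>+\<omega>. \<phi> (profile n \<omega>) \<partial>P) = (\<integral>\<^sup>+k. (\<integral>\<^sup>+\<omega>. \<phi> (profile n \<omega>) * indicator {\<omega> \<in> space P. profile n \<omega> = k} \<omega> \<partial>P) \<partial>count_space UNIV)"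
    by (rule Om.nn_integral_cells) measurable
  also have "\<dots> = (\<integral>\<^sup>+k. ennreal (profile_prob n k) * \<phi> k \<partial>count_space UNIV)"
  proof (intro nn_integral_cong)
    fix k
    have "(\<integral>\<^sup>+\<omega>. \<phi> (profile n \<omega>) * indicator {\<omega> \<in> space P. profile n \<omega> = k} \<omega> \<partial>P)
      = (\<integral>\<^sup>+\<omega>. \<phi> k * indicator {\<omega> \<in> space P. profile n \<omega> = k} \<omega> \<partial>P)"
      by (intro nn_integral_cong) (auto simp: indicator_def)
    also have "\<dots> = \<phi> k * emeasure P {\<omega> \<in> space P. profile n \<omega> = k}"
      by (intro nn_integral_cmult_indicator Om.cell_sets)
    finally show "(\<integral>\<^sup>+\<omega>. \<phi> (profile n \<omega>) * indicator {\<omega> \<in> space P. profile n \<omega> = k} \<omega> \<partial>P) = ennreal (profile_prob n k) * \<phi> k"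
      by (simp only: emeasure_profile mult.commute)
  qed
  finally show ?thesis .
qed

section \<open>The Mecke formula and averaged gradients\<close>

context poisson_cells
begin

lemma config_space_sets[measurable, simp]: "config_space \<in> sets config_algebra"
  using sets.top[of config_algebra] by simp

lemma nn_integral_cell:
  "(\<integral>\<^sup>+y. \<phi> (cell n y) * indicator (window n) y \<partial>\<nu>) = (\<Sum>i\<in>cells n. ennreal (mass n i) * \<phi> i)"
proof -
  have "(\<integral>\<^sup>+y. \<phi> (cell n y) * indicator (window n) y \<partial>\<nu>) = (\<integral>\<^sup>+y. (\<Sum>i\<in>cells n. \<phi> i * indicator (cell_set n i) y) \<partial>\<nu>)"
  proof (intro nn_integral_cong)
    fix y
    show "\<phi> (cell n y) * indicator (window n) y = (\<Sum>i\<in>cells n. \<phi> i * indicator (cell_set n i) y)"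
    proof (cases "cell n y = 0")
      case True
      then have "(\<Sum>i\<in>cells n. \<phi> i * indicator (cell_set n i) y) = (\<Sum>i\<in>cells n. 0)"
        by (intro sum.cong) (auto simp: cell_set_def indicator_def)
      then show ?thesis using True by (simp add: window_def)
    next
      case False
      then have "(\<Sum>i\<in>cells n. \<phi> i * indicator (cell_set n i) y) = (\<Sum>i\<in>cells n. if i = cell n y then \<phi> i else 0)"
        by (intro sum.cong) (auto simp: cell_set_def indicator_def)
      then show ?thesis using cell_in_cells[OF False] False by (simp add: window_def)
    qed
  qed
  also have "\<dots> = (\<Sum>i\<in>cells n. \<phi> i * emeasure \<nu> (cell_set n i))"
    by (subst nn_integral_sum) (auto intro!: sum.cong nn_integral_cmult_indicator)
  finally show ?thesis by (simp add: emeasure_cell_set mult.commute)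
qed

lemma count_profile_coarsen:
  assumes "\<omega> \<in> config_space" "n \<le> m" "i \<in> cells n"
  shows "count (profile n \<omega>) i = (\<Sum>j\<in>{j\<in>cells m. coarsen n j = i}. count (profile m \<omega>) j)"
proof -
  have i: "i \<noteq> 0" using assms(3) by (metis zero_not_cells)
  have "count (profile n \<omega>) i = count (image_mset (coarsen n) (profile m \<omega>)) i"
    using i by (simp add: profile_coarsen[OF assms(1,2)])
  also have "\<dots> = (\<Sum>j | j \<in># profile m \<omega> \<and> i = coarsen n j. count (profile m \<omega>) j)"
    by (rule count_image_mset')
  also have "\<dots> = (\<Sum>j\<in>{j\<in>cells m. coarsen n j = i}. count (profile m \<omega>) j)"
    using profile_cells[OF assms(1), of m] by (intro sum.mono_neutral_left) (auto simp: not_in_iff)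
  finally show ?thesis .
qed

text \<open>The point-inserting side of the Mecke formula as a measure: the image of
  \<open>P \<Otimes>\<^sub>M \<nu>\<close>, restricted to points of the cell, under insertion. The
  formula then becomes an equality of measures, to be tested on a generator.\<close>

definition add_point :: "nat \<Rightarrow> nat \<Rightarrow> 'a set measure" where
  "add_point n i = distr (density (P \<Otimes>\<^sub>M \<nu>) (\<lambda>x. indicator (cell_set n i) (snd x))) P (\<lambda>x. insert (snd x) (fst x))"

lemma nn_integral_add_point:
  assumes [measurable]: "g \<in> borel_measurable P"
  shows "(\<integral>\<^sup>+\<omega>. g \<omega> \<partial>add_point n i) = (\<integral>\<^sup>+x. indicator (cell_set n i) (snd x) * g (insert (snd x) (fst x)) \<partial>(P \<Otimes>\<^sub>M \<nu>))"
proof -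
  have [measurable]: "(\<lambda>x. indicator (cell_set n i) (snd x) :: ennreal) \<in> borel_measurable (P \<Otimes>\<^sub>M \<nu>)" by measurable
  have "(\<integral>\<^sup>+\<omega>. g \<omega> \<partial>add_point n i) = (\<integral>\<^sup>+x. g (insert (snd x) (fst x)) \<partial>density (P \<Otimes>\<^sub>M \<nu>) (\<lambda>x. indicator (cell_set n i) (snd x)))"
    unfolding add_point_def by (rule nn_integral_distr) measurable
  also have "\<dots> = (\<integral>\<^sup>+x. indicator (cell_set n i) (snd x) * g (insert (snd x) (fst x)) \<partial>(P \<Otimes>\<^sub>M \<nu>))"
    by (rule nn_integral_density) measurable
  finally show ?thesis .
qed

lemma sets_add_point[simp, measurable_cong]: "sets (add_point n i) = sets P"
  by (simp add: add_point_def)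

text \<open>At the finer level \<open>m\<close> the inserted point falls into some subcell
  \<open>j\<close> of \<open>i\<close>, so the old profile was \<open>k - {#j#}\<close>. The Stein
  equation turns \<open>mass m j\<close> times its probability into
  \<open>count k j * profile_prob m k\<close>, and the counts of the subcells add up to the count of
  \<open>i\<close>.\<close>

lemma mecke_profile:
  assumes i: "i \<in> cells n" and nm: "n \<le> m"
  shows "(\<integral>\<^sup>+\<omega>. indicator {k} (profile m \<omega>) \<partial>add_point n i) = (\<integral>\<^sup>+\<omega>. of_nat (count (profile n \<omega>) i) * indicator {k} (profile m \<omega>) \<partial>P)"
proof -
  have i0: "i \<noteq> 0" using i by (metis zero_not_cells)
  let ?J = "{j \<in> cells m. coarsen n j = i}"
  have ind: "(indicator {k} (add_mset j a) :: ennreal) = indicator {a. add_mset j a = k} a" for j a by (simp add: indicator_def)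
  have "(\<integral>\<^sup>+\<omega>. indicator {k} (profile m \<omega>) \<partial>add_point n i)
    = (\<integral>\<^sup>+x. indicator (cell_set n i) (snd x) * indicator {k} (profile m (insert (snd x) (fst x))) \<partial>(P \<Otimes>\<^sub>M \<nu>))"
    by (rule nn_integral_add_point) measurable
  also have "\<dots> = (\<integral>\<^sup>+x. (indicator (cell_set n i) (snd x) * indicator {k} (add_mset (cell m (snd x)) (profile m (fst x)))) * indicator (window m) (snd x) \<partial>(P \<Otimes>\<^sub>M \<nu>))"
  proof (rule nn_integral_cong_AE)
    show "AE x in P \<Otimes>\<^sub>M \<nu>. (indicator (cell_set n i) (snd x) :: ennreal) * indicator {k} (profile m (insert (snd x) (fst x)))
      = (indicator (cell_set n i) (snd x) * indicator {k} (add_mset (cell m (snd x)) (profile m (fst x)))) * indicator (window m) (snd x)"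
      using AE_pair_not_mem AE_space
    proof eventually_elim
      case (elim x)
      show ?case
      proof (cases "cell n (snd x) = i")
        case True
        \<comment> \<open>The code at level \<open>n\<close> is a coarsening of this one and is not
          0, so the new point is also counted at level \<open>m\<close>.\<close>
        have "cell m (snd x) \<noteq> 0"
        proof
          assume "cell m (snd x) = 0"
          then have "cell n (snd x) = 0" using coarsen_cell[OF nm, of "snd x"] by simp
          then show False using i0 True by simp
        qed
        then show ?thesis using elim by (simp add: window_def profile_insert_cases space_pair_measure mem_Times_iff)
      qed (simp add: cell_set_def)
    qed
  qed
  also have "\<dots> = (\<integral>\<^sup>+\<omega>. \<integral>\<^sup>+y. (indicator (cell_set n i) y * indicator {k} (add_mset (cell m y) (profile m \<omega>))) * indicator (window m) y \<partial>\<nu> \<partial>P)"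
  proof (subst N.nn_integral_fst[symmetric])
    have "(\<lambda>x. indicator {k} (add_mset (cell m (snd x)) (profile m (fst x))) :: ennreal) \<in> borel_measurable (P \<Otimes>\<^sub>M \<nu>)"
      by (rule OX.measurable_code[of "\<lambda>b. indicator {k} (add_mset (snd b) (fst b))" m, unfolded fst_conv snd_conv])
    then show "(\<lambda>x. (indicator (cell_set n i) (snd x) * indicator {k} (add_mset (cell m (snd x)) (profile m (fst x)))) * indicator (window m) (snd x) :: ennreal) \<in> borel_measurable (P \<Otimes>\<^sub>M \<nu>)"
      by measurable
  qed simp
  also have "\<dots> = (\<integral>\<^sup>+\<omega>. (\<Sum>j\<in>cells m. ennreal (mass m j) * (indicator ?J j * indicator {k} (add_mset j (profile m \<omega>)))) \<partial>P)"
  proof (intro nn_integral_cong)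
    fix \<omega>
    have "(\<integral>\<^sup>+y. (indicator (cell_set n i) y * indicator {k} (add_mset (cell m y) (profile m \<omega>))) * indicator (window m) y \<partial>\<nu>)
      = (\<integral>\<^sup>+y. (indicator ?J (cell m y) * indicator {k} (add_mset (cell m y) (profile m \<omega>))) * indicator (window m) y \<partial>\<nu>)"
      by (intro nn_integral_cong) (auto simp: cell_set_def indicator_def window_def coarsen_cell[OF nm] intro: cell_in_cells)
    then show "(\<integral>\<^sup>+y. (indicator (cell_set n i) y * indicator {k} (add_mset (cell m y) (profile m \<omega>))) * indicator (window m) y \<partial>\<nu>)
      = (\<Sum>j\<in>cells m. ennreal (mass m j) * (indicator ?J j * indicator {k} (add_mset j (profile m \<omega>))))"
      by (simp only: nn_integral_cell[of "\<lambda>j. indicator ?J j * indicator {k} (add_mset j (profile m \<omega>))"])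
  qed
  also have "\<dots> = (\<Sum>j\<in>cells m. ennreal (mass m j) * (indicator ?J j * (\<integral>\<^sup>+\<omega>. indicator {k} (add_mset j (profile m \<omega>)) \<partial>P)))"
    by (subst nn_integral_sum) (auto simp: nn_integral_cmult)
  also have "\<dots> = (\<Sum>j\<in>?J. ennreal (mass m j) * (\<integral>\<^sup>+\<omega>. indicator {k} (add_mset j (profile m \<omega>)) \<partial>P))"
    by (intro sum.mono_neutral_cong_right) auto
  also have "\<dots> = (\<Sum>j\<in>?J. of_nat (count k j) * ennreal (profile_prob m k))"
  proof (intro sum.cong refl)
    fix j assume j: "j \<in> ?J"
    show "ennreal (mass m j) * (\<integral>\<^sup>+\<omega>. indicator {k} (add_mset j (profile m \<omega>)) \<partial>P) = of_nat (count k j) * ennreal (profile_prob m k)"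
    proof (cases "j \<in># k")
      case True
      then have "(\<integral>\<^sup>+\<omega>. indicator {k} (add_mset j (profile m \<omega>)) \<partial>P) = (\<integral>\<^sup>+\<omega>. indicator {\<omega> \<in> space P. profile m \<omega> = k - {#j#}} \<omega> \<partial>P)"
        by (intro nn_integral_cong) (auto simp: indicator_def)
      also have "\<dots> = ennreal (profile_prob m (k - {#j#}))" using emeasure_profile[of m "k - {#j#}"] by simp
      finally show ?thesis
        using profile_prob_stein[of j m "k - {#j#}"] j True
        by (simp add: ennreal_mult'[symmetric] ennreal_of_nat_eq_real_of_nat del: of_nat_Suc)
    next
      case False
      then have "(\<integral>\<^sup>+\<omega>. indicator {k} (add_mset j (profile m \<omega>)) \<partial>P) = (\<integral>\<^sup>+\<omega>. 0 \<partial>P)"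
        by (intro nn_integral_cong) (auto simp: indicator_def)
      then show ?thesis using False by (simp add: not_in_iff)
    qed
  qed
  also have "\<dots> = of_nat (\<Sum>j\<in>?J. count k j) * ennreal (profile_prob m k)" by (simp add: sum_distrib_right)
  also have "\<dots> = (\<integral>\<^sup>+\<omega>. of_nat (\<Sum>j\<in>?J. count k j) * indicator {\<omega> \<in> space P. profile m \<omega> = k} \<omega> \<partial>P)"
    by (subst nn_integral_cmult_indicator[OF Om.cell_sets]) (simp only: emeasure_profile)
  also have "\<dots> = (\<integral>\<^sup>+\<omega>. of_nat (count (profile n \<omega>) i) * indicator {k} (profile m \<omega>) \<partial>P)"
    by (intro nn_integral_cong) (auto simp: indicator_def count_profile_coarsen[OF _ nm i])
  finally show ?thesis .
qed

text \<open>Two measures of finite total mass that agree on the intersection-stable family of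
  profile events coincide. The total mass is the mass of the cell.\<close>

lemma mecke:
  assumes i: "i \<in> cells n"
  shows "add_point n i = density P (\<lambda>\<omega>. of_nat (count (profile n \<omega>) i))" (is "?M1 = ?M2")
proof (rule measure_eqI_generator_eq_countable[where A="{config_space}" and E="{profile n -` S \<inter> config_space | n S. True}" and \<Omega>=config_space])
  show "Int_stable {profile n -` S \<inter> config_space | n S. True}" using Om.Int_stable_gen by simp
  have meas: "(\<lambda>\<omega>. of_nat (count (profile m \<omega>) j) :: ennreal) \<in> borel_measurable P" for m j
    by measurable
  have key: "emeasure ?M1 {\<omega> \<in> space P. profile m \<omega> \<in> S} = emeasure ?M2 {\<omega> \<in> space P. profile m \<omega> \<in> S}" if nm: "n \<le> m" for m S
  proof -
    have "distr ?M1 (count_space UNIV) (profile m) = distr ?M2 (count_space UNIV) (profile m)"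
    proof (rule measure_eqI_countable[of _ UNIV])
      fix k
      have s: "{\<omega> \<in> space P. profile m \<omega> = k} \<in> sets P" by (rule Om.cell_sets)
      have "emeasure ?M1 {\<omega> \<in> space P. profile m \<omega> = k} = (\<integral>\<^sup>+\<omega>. indicator {k} (profile m \<omega>) \<partial>?M1)"
      proof -
        have "(\<integral>\<^sup>+\<omega>. indicator {k} (profile m \<omega>) \<partial>?M1) = (\<integral>\<^sup>+\<omega>. indicator {\<omega> \<in> space P. profile m \<omega> = k} \<omega> \<partial>?M1)"
          by (intro nn_integral_cong) (auto simp: indicator_def add_point_def)
        then show ?thesis using s by simp
      qed
      also have "\<dots> = (\<integral>\<^sup>+\<omega>. of_nat (count (profile n \<omega>) i) * indicator {k} (profile m \<omega>) \<partial>P)"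
        by (rule mecke_profile[OF i nm])
      also have "\<dots> = (\<integral>\<^sup>+\<omega>. of_nat (count (profile n \<omega>) i) * indicator {\<omega> \<in> space P. profile m \<omega> = k} \<omega> \<partial>P)"
        by (intro nn_integral_cong) (auto simp: indicator_def)
      also have "\<dots> = emeasure ?M2 {\<omega> \<in> space P. profile m \<omega> = k}"
        by (rule emeasure_density[symmetric]) (use s in measurable)
      finally have e: "emeasure ?M1 {\<omega> \<in> space P. profile m \<omega> = k} = emeasure ?M2 {\<omega> \<in> space P. profile m \<omega> = k}" .
      have "profile m -` {k} \<inter> config_space = {\<omega> \<in> space P. profile m \<omega> = k}" by auto
      then show "emeasure (distr ?M1 (count_space UNIV) (profile m)) {k} = emeasure (distr ?M2 (count_space UNIV) (profile m)) {k}"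
        using e by (simp add: emeasure_distr add_point_def)
    qed auto
    then have "emeasure (distr ?M1 (count_space UNIV) (profile m)) S = emeasure (distr ?M2 (count_space UNIV) (profile m)) S" by simp
    moreover have "profile m -` S \<inter> config_space = {\<omega> \<in> space P. profile m \<omega> \<in> S}" by auto
    ultimately show ?thesis by (simp add: emeasure_distr add_point_def)
  qed
  show "emeasure ?M1 X = emeasure ?M2 X" if "X \<in> {profile n -` S \<inter> config_space | n S. True}" for X
  proof -
    from that obtain p S where X: "X = profile p -` S \<inter> config_space" by blast
    \<comment> \<open>The event is rewritten at a level of at least \<open>n\<close>, because the
      density counts points in a cell of level \<open>n\<close> and must be readable from the
      profile.\<close>
    have "X = {\<omega> \<in> space P. profile (max p n) \<omega> \<in> {k. filter_mset (\<lambda>j. j \<noteq> 0) (image_mset (coarsen p) k) \<in> S}}"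
      by (auto simp: X profile_coarsen[of _ p "max p n"])
    then show ?thesis using key[of "max p n" "{k. filter_mset (\<lambda>j. j \<noteq> 0) (image_mset (coarsen p) k) \<in> S}"] by simp
  qed
  show "sets ?M1 = sigma_sets config_space {profile n -` S \<inter> config_space | n S. True}"
    "sets ?M2 = sigma_sets config_space {profile n -` S \<inter> config_space | n S. True}"
    by (simp_all add: config_algebra_profiles)
  have "profile 0 -` UNIV \<inter> config_space = config_space" by simp
  then show "{config_space} \<subseteq> {profile n -` S \<inter> config_space | n S. True}" by blast
  fix a :: "'a set set" assume "a \<in> {config_space}"
  then have a: "a = space P" by simp
  have "emeasure ?M1 (space P) = (\<integral>\<^sup>+\<omega>. 1 \<partial>?M1)" by (simp add: add_point_def)
  also have "\<dots> = (\<integral>\<^sup>+x. indicator (cell_set n i) (snd x) * 1 \<partial>(P \<Otimes>\<^sub>M \<nu>))"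
    by (rule nn_integral_add_point) simp
  also have "\<dots> = (\<integral>\<^sup>+x. indicator (space P \<times> cell_set n i) x \<partial>(P \<Otimes>\<^sub>M \<nu>))"
    by (intro nn_integral_cong) (auto simp: indicator_def space_pair_measure)
  also have "\<dots> = emeasure P (space P) * emeasure \<nu> (cell_set n i)"
  proof (subst nn_integral_indicator)
    show s: "space P \<times> cell_set n i \<in> sets (P \<Otimes>\<^sub>M \<nu>)" using sets.top[of P] by (intro pair_measureI) auto
    show "emeasure (P \<Otimes>\<^sub>M \<nu>) (space P \<times> cell_set n i) = emeasure P (space P) * emeasure \<nu> (cell_set n i)"
      using sets.top[of P] by (intro N.emeasure_pair_measure_Times) auto
  qed
  also have "\<dots> < \<infinity>" using i by (simp only: P.emeasure_space_1 emeasure_cell_set) simp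
  finally show "emeasure ?M1 a \<noteq> \<infinity>" unfolding a by simp
qed auto

lemma integral_add_point:
  fixes F :: "'a set \<Rightarrow> real"
  assumes [measurable]: "F \<in> borel_measurable P" and i: "i \<in> cells n"
  shows "(\<integral>x. indicator (cell_set n i) (snd x) * F (insert (snd x) (fst x)) \<partial>(P \<Otimes>\<^sub>M \<nu>)) = (\<integral>\<omega>. real (count (profile n \<omega>) i) * F \<omega> \<partial>P)"
proof -
  have "(\<integral>\<omega>. F \<omega> \<partial>add_point n i) = (\<integral>x. F (insert (snd x) (fst x)) \<partial>density (P \<Otimes>\<^sub>M \<nu>) (\<lambda>x. ennreal (indicator (cell_set n i) (snd x))))"
    unfolding add_point_def ennreal_indicator by (rule integral_distr) measurable
  also have "\<dots> = (\<integral>x. indicator (cell_set n i) (snd x) *\<^sub>R F (insert (snd x) (fst x)) \<partial>(P \<Otimes>\<^sub>M \<nu>))"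
    by (rule integral_density) auto
  finally have 1: "(\<integral>\<omega>. F \<omega> \<partial>add_point n i) = (\<integral>x. indicator (cell_set n i) (snd x) * F (insert (snd x) (fst x)) \<partial>(P \<Otimes>\<^sub>M \<nu>))"
    by simp
  have [measurable]: "(\<lambda>\<omega>. real (count (profile n \<omega>) i)) \<in> borel_measurable P" by measurable
  have "(\<integral>\<omega>. F \<omega> \<partial>add_point n i) = (\<integral>\<omega>. F \<omega> \<partial>density P (\<lambda>\<omega>. ennreal (real (count (profile n \<omega>) i))))"
    unfolding mecke[OF i] ennreal_of_nat_eq_real_of_nat ..
  also have "\<dots> = (\<integral>\<omega>. real (count (profile n \<omega>) i) *\<^sub>R F \<omega> \<partial>P)"
    by (rule integral_density) auto
  finally show ?thesis using 1 by simp
qed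

lemma cell_mean_profile:
  "profile_prob n k * Om.cell_mean n F k = (\<integral>\<omega>. F \<omega> * indicator {\<omega> \<in> space P. profile n \<omega> = k} \<omega> \<partial>P)"
proof (cases "profile_prob n k = 0")
  case True
  then have "{\<omega> \<in> space P. profile n \<omega> = k} \<in> null_sets P"
    using Om.cell_sets[of n k] emeasure_profile[of n k] by (simp add: null_sets_def)
  then have "AE \<omega> in P. F \<omega> * indicator {\<omega> \<in> space P. profile n \<omega> = k} \<omega> = 0"
    by (rule AE_not_in[THEN eventually_mono]) simp
  then have "(\<integral>\<omega>. F \<omega> * indicator {\<omega> \<in> space P. profile n \<omega> = k} \<omega> \<partial>P) = 0"
    by (rule integral_eq_zero_AE)
  then show ?thesis using True by simp
qed (simp add: Om.cell_mean_def profile_prob_def)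

text \<open>Averaging over cells and taking differences commute. By \<open>mecke\<close>, the
  integral of \<open>F (insert y \<omega>)\<close> over profile \<open>k\<close> and
  \<open>y\<close> in cell \<open>i\<close> equals \<open>Suc (count k i)\<close> times the integral
  of \<open>F\<close> over profile \<open>add_mset i k\<close>, and the Stein equation rewrites this
  weight with \<open>mass n i * profile_prob n k\<close>. Boundedness of \<open>F\<close> lets the
  two parts of the gradient be integrated separately on a cell of finite measure.\<close>

lemma cell_mean_diff:
  fixes F :: "'a set \<Rightarrow> real"
  assumes F[measurable]: "F \<in> borel_measurable P" and bound: "\<And>\<omega>. \<bar>F \<omega>\<bar> \<le> C"
    and i: "i \<in> cells n" and pos: "profile_prob n k \<noteq> 0" "mass n i \<noteq> 0"
  shows "OX.cell_mean n (\<lambda>x. F (insert (snd x) (fst x)) - F (fst x)) (k, i) = Om.cell_mean n F (add_mset i k) - Om.cell_mean n F k"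
proof -
  have i0: "i \<noteq> 0" using i by (metis zero_not_cells)
  let ?S = "{\<omega> \<in> space P. profile n \<omega> = k}" and ?S' = "{\<omega> \<in> space P. profile n \<omega> = add_mset i k}"
  let ?Z = "{x \<in> space (P \<Otimes>\<^sub>M \<nu>). (profile n (fst x), cell n (snd x)) = (k, i)}"
  have S: "?S \<in> sets P" by (rule Om.cell_sets)
  have S'[measurable]: "?S' \<in> sets P" by (rule Om.cell_sets)
  have Z: "?Z = ?S \<times> cell_set n i" by (auto simp: space_pair_measure cell_set_def)
  have emZ: "emeasure (P \<Otimes>\<^sub>M \<nu>) ?Z = ennreal (profile_prob n k * mass n i)"
    unfolding Z by (subst N.emeasure_pair_measure_Times) (use S i in \<open>auto simp only: emeasure_profile emeasure_cell_set ennreal_mult profile_prob_nonneg mass_nonneg sets_\<nu> cell_set_borel\<close>)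
  then have mZ: "measure (P \<Otimes>\<^sub>M \<nu>) ?Z = profile_prob n k * mass n i" by (simp add: measure_def)
  have Zs[measurable]: "?Z \<in> sets (P \<Otimes>\<^sub>M \<nu>)" by (rule OX.cell_sets)
  have iC: "integrable (P \<Otimes>\<^sub>M \<nu>) (\<lambda>x. C * indicator ?Z x)"
    by (intro integrable_mult_right integrable_real_indicator Zs) (simp only: emZ infinity_ennreal_def ennreal_less_top)
  have i1: "integrable (P \<Otimes>\<^sub>M \<nu>) (\<lambda>x. F (insert (snd x) (fst x)) * indicator ?Z x)"
    by (rule Bochner_Integration.integrable_bound[OF iC]) (use bound in \<open>auto simp: indicator_def intro: order_trans[OF _ abs_ge_self]\<close>)
  have i2: "integrable (P \<Otimes>\<^sub>M \<nu>) (\<lambda>x. F (fst x) * indicator ?Z x)"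
    by (rule Bochner_Integration.integrable_bound[OF iC]) (use bound in \<open>auto simp: indicator_def intro: order_trans[OF _ abs_ge_self]\<close>)
  have v2: "(\<integral>x. F (fst x) * indicator ?Z x \<partial>(P \<Otimes>\<^sub>M \<nu>)) = mass n i * (profile_prob n k * Om.cell_mean n F k)"
  proof -
    have "(\<integral>x. F (fst x) * indicator ?Z x \<partial>(P \<Otimes>\<^sub>M \<nu>)) = (\<integral>\<omega>. (\<integral>y. F \<omega> * indicator ?Z (\<omega>, y) \<partial>\<nu>) \<partial>P)"
      using PN.integral_fst'[OF i2] by simp
    also have "\<dots> = (\<integral>\<omega>. mass n i * (F \<omega> * indicator ?S \<omega>) \<partial>P)"
    proof (rule Bochner_Integration.integral_cong[OF refl])
      fix \<omega>
      have "(\<integral>y. F \<omega> * indicator ?Z (\<omega>, y) \<partial>\<nu>) = (\<integral>y. (F \<omega> * indicator ?S \<omega>) * indicator (cell_set n i) y \<partial>\<nu>)"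
        unfolding Z indicator_times by (simp add: mult.assoc)
      then show "(\<integral>y. F \<omega> * indicator ?Z (\<omega>, y) \<partial>\<nu>) = mass n i * (F \<omega> * indicator ?S \<omega>)"
        by (simp add: mass_def mult.commute)
    qed
    also have "\<dots> = mass n i * (profile_prob n k * Om.cell_mean n F k)"
      unfolding cell_mean_profile by simp
    finally show ?thesis .
  qed
  have v1: "(\<integral>x. F (insert (snd x) (fst x)) * indicator ?Z x \<partial>(P \<Otimes>\<^sub>M \<nu>)) = mass n i * (profile_prob n k * Om.cell_mean n F (add_mset i k))"
  proof -
    have "(\<integral>x. F (insert (snd x) (fst x)) * indicator ?Z x \<partial>(P \<Otimes>\<^sub>M \<nu>)) =
      (\<integral>x. indicator (cell_set n i) (snd x) * (F (insert (snd x) (fst x)) * indicator ?S' (insert (snd x) (fst x))) \<partial>(P \<Otimes>\<^sub>M \<nu>))"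
    proof (rule integral_cong_AE)
      show "AE x in P \<Otimes>\<^sub>M \<nu>. F (insert (snd x) (fst x)) * indicator ?Z x =
        indicator (cell_set n i) (snd x) * (F (insert (snd x) (fst x)) * indicator ?S' (insert (snd x) (fst x)))"
        using AE_pair_not_mem AE_space
      proof eventually_elim
        case (elim x)
        then have x: "fst x \<in> config_space" "insert (snd x) (fst x) \<in> config_space"
          by (auto simp: space_pair_measure config_space_insert)
        show ?case
        proof (cases "cell n (snd x) = i")
          case True
          then have "x \<in> ?Z \<longleftrightarrow> insert (snd x) (fst x) \<in> ?S'"
            using elim x i0 by (auto simp: profile_insert_cases)
          then show ?thesis using True by (simp add: cell_set_def indicator_def)
        qed (auto simp: cell_set_def)
      qed
    qed measurable
    also have "\<dots> = (\<integral>\<omega>. real (count (profile n \<omega>) i) * (F \<omega> * indicator ?S' \<omega>) \<partial>P)"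
      by (rule integral_add_point[OF _ i]) measurable
    also have "\<dots> = (\<integral>\<omega>. real (Suc (count k i)) * (F \<omega> * indicator ?S' \<omega>) \<partial>P)"
      by (rule Bochner_Integration.integral_cong) (auto simp: indicator_def)
    also have "\<dots> = real (Suc (count k i)) * (profile_prob n (add_mset i k) * Om.cell_mean n F (add_mset i k))"
      unfolding cell_mean_profile by simp
    also have "\<dots> = mass n i * (profile_prob n k * Om.cell_mean n F (add_mset i k))"
      using profile_prob_stein[OF i, of k] by (simp only: mult.assoc[symmetric])
    finally show ?thesis .
  qed
  have "(\<integral>x. (F (insert (snd x) (fst x)) - F (fst x)) * indicator ?Z x \<partial>(P \<Otimes>\<^sub>M \<nu>))
    = profile_prob n k * mass n i * (Om.cell_mean n F (add_mset i k) - Om.cell_mean n F k)"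
    unfolding left_diff_distrib Bochner_Integration.integral_diff[OF i1 i2] v1 v2 by (simp add: algebra_simps)
  then have "OX.cell_mean n (\<lambda>x. F (insert (snd x) (fst x)) - F (fst x)) (k, i)
    = profile_prob n k * mass n i * (Om.cell_mean n F (add_mset i k) - Om.cell_mean n F k) / (profile_prob n k * mass n i)"
    unfolding OX.cell_mean_def mZ using i0 by simp
  then show ?thesis using pos by simp
qed

end

section \<open>Absolutely continuous self-couplings\<close>

lemma ennreal_mult_divide_cancel: "x \<noteq> 0 \<Longrightarrow> x \<noteq> \<top> \<Longrightarrow> x * (c / x) = (c :: ennreal)"
  by (metis ennreal_mult_divide_eq ennreal_times_divide mult.commute)

locale self_coupling = P: prob_space P for P :: "'w measure" +
  fixes Q :: "('w \<times> 'w) measure"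
  assumes sets_Q[simp, measurable_cong]: "sets Q = sets (P \<Otimes>\<^sub>M P)"
    and abs_cont: "absolutely_continuous (P \<Otimes>\<^sub>M P) Q"
    and marginal_fst: "\<And>a. a \<in> borel_measurable P \<Longrightarrow> (\<integral>\<^sup>+x. a (fst x) \<partial>Q) = (\<integral>\<^sup>+\<omega>. a \<omega> \<partial>P)"
    and marginal_snd: "\<And>a. a \<in> borel_measurable P \<Longrightarrow> (\<integral>\<^sup>+x. a (snd x) \<partial>Q) = (\<integral>\<^sup>+\<omega>. a \<omega> \<partial>P)"
begin

sublocale Q: prob_space Q
proof
  have "emeasure Q (space Q) = (\<integral>\<^sup>+x. 1 \<partial>Q)" by simp
  also have "\<dots> = (\<integral>\<^sup>+\<omega>. 1 \<partial>P)" by (rule marginal_fst) simp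
  also have "\<dots> = 1" by (simp add: P.emeasure_space_1)
  finally show "emeasure Q (space Q) = 1" .
qed

lemma measurable_fst_Q[measurable]: "fst \<in> measurable Q P"
  and measurable_snd_Q[measurable]: "snd \<in> measurable Q P"
  by (simp_all cong: measurable_cong_sets)

end

section \<open>Lifting the discrete coupling to configurations\<close>

context poisson_cells
begin

lemma stein_profile: "stein_weights (cells n) (\<lambda>i. ennreal (mass n i)) (\<lambda>k. ennreal (profile_prob n k))"
proof
  fix i k assume "i \<in> cells n"
  then show "ennreal (mass n i) * ennreal (profile_prob n k) = of_nat (Suc (count k i)) * ennreal (profile_prob n (add_mset i k))"
    using profile_prob_stein[of i n k] by (simp add: ennreal_mult'[symmetric] ennreal_of_nat_eq_real_of_nat del: of_nat_Suc)
next
  show "(\<integral>\<^sup>+ k. ennreal (profile_prob n k) \<partial>count_space UNIV) = 1"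
    using nn_integral_profile[of "\<lambda>_. 1" n] by (simp add: P.emeasure_space_1 del: space_P)
qed (auto simp: profile_prob_supp)

definition joint :: "nat \<Rightarrow> nat multiset \<times> nat multiset \<Rightarrow> ennreal" where
  "joint n = stein_weights.coupling (cells n) (\<lambda>i. ennreal (mass n i)) (\<lambda>k. ennreal (profile_prob n k))"

lemmas joint_fst = stein_weights.coupling_fst[OF stein_profile, folded joint_def]
lemmas joint_snd = stein_weights.coupling_snd[OF stein_profile, folded joint_def]
lemmas joint_identity = stein_weights.coupling_identity[OF stein_profile, folded joint_def]

text \<open>A nonnegative mass is 0 if its marginal is. This is the absolute continuity of
  \<open>joint\<close> with respect to the product of the profile laws.\<close>

lemma joint_zero:
  assumes "profile_prob n a = 0 \<or> profile_prob n b = 0"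
  shows "joint n (a, b) = 0"
proof (cases "profile_prob n a = 0")
  case True
  then have "(\<integral>\<^sup>+ b. joint n (a, b) \<partial>count_space UNIV) = 0" by (simp add: joint_fst)
  then show ?thesis by (simp add: nn_integral_0_iff_AE AE_count_space)
next
  case False
  then have "(\<integral>\<^sup>+ a. joint n (a, b) \<partial>count_space UNIV) = 0" using assms by (simp add: joint_snd)
  then show ?thesis by (simp add: nn_integral_0_iff_AE AE_count_space)
qed

text \<open>On profiles of probability 0 the quotient is \<open>0 / 0 = 0\<close>, by the lemma \<open>joint_zero\<close>.\<close>

definition joint_density :: "nat \<Rightarrow> 'a set \<times> 'a set \<Rightarrow> ennreal" where
  "joint_density n x = joint n (profile n (fst x), profile n (snd x)) / (ennreal (profile_prob n (profile n (fst x))) * ennreal (profile_prob n (profile n (snd x))))"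

text \<open>The density depends on the profiles only: given both profiles, the configurations are
  independent with their conditional laws under \<open>P\<close>. This spreads the dependence inside
  the cells and avoids the shared points.\<close>

definition joint_measure :: "nat \<Rightarrow> ('a set \<times> 'a set) measure" where
  "joint_measure n = density (P \<Otimes>\<^sub>M P) (joint_density n)"

lemma measurable_profiles[measurable]:
  "(\<lambda>x. (profile n (fst x), profile n (snd x))) \<in> measurable (P \<Otimes>\<^sub>M P) (count_space UNIV)"
  by (subst pair_measure_countable[symmetric, of UNIV UNIV, simplified]) simp_all

lemma borel_measurable_profiles: "(\<lambda>x. \<phi> (profile n (fst x), profile n (snd x)) :: 'b::topological_space) \<in> borel_measurable (P \<Otimes>\<^sub>M P)"
  using measurable_compose[OF measurable_profiles, of \<phi> borel] by simp

lemma joint_density_measurable[measurable]: "joint_density n \<in> borel_measurable (P \<Otimes>\<^sub>M P)"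
proof -
  have "joint_density n = (\<lambda>x. (\<lambda>p. joint n p / (ennreal (profile_prob n (fst p)) * ennreal (profile_prob n (snd p)))) (profile n (fst x), profile n (snd x)))"
    by (auto simp: joint_density_def)
  then show ?thesis using borel_measurable_profiles[of "\<lambda>p. joint n p / (ennreal (profile_prob n (fst p)) * ennreal (profile_prob n (snd p)))" n] by simp
qed

lemma joint_cancel:
  "ennreal (profile_prob n b) * (joint n (a, b) / (ennreal (profile_prob n a) * ennreal (profile_prob n b))) = joint n (a, b) / ennreal (profile_prob n a)"
proof (cases "profile_prob n a = 0 \<or> profile_prob n b = 0")
  case True then show ?thesis by (simp add: joint_zero)
next
  case False
  then have "inverse (ennreal (profile_prob n a) * ennreal (profile_prob n b)) = inverse (ennreal (profile_prob n a)) * inverse (ennreal (profile_prob n b))"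
    by (intro ennreal_inverse_mult) auto
  then have "ennreal (profile_prob n b) * (joint n (a, b) / (ennreal (profile_prob n a) * ennreal (profile_prob n b)))
    = ennreal (profile_prob n b) * ((joint n (a, b) / ennreal (profile_prob n a)) / ennreal (profile_prob n b))"
    by (simp only: divide_ennreal_def ac_simps)
  also have "\<dots> = joint n (a, b) / ennreal (profile_prob n a)"
    by (rule ennreal_mult_divide_cancel) (use False in auto)
  finally show ?thesis .
qed

lemma AE_profile_pos: "AE \<omega> in P. profile_prob n (profile n \<omega>) \<noteq> 0"
proof -
  have "(\<integral>\<^sup>+\<omega>. indicator {k. profile_prob n k = 0} (profile n \<omega>) \<partial>P) = (\<integral>\<^sup>+(k::nat multiset). 0 \<partial>count_space UNIV)"
    unfolding nn_integral_profile by (intro nn_integral_cong) (auto simp: indicator_def)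
  then have "(\<integral>\<^sup>+\<omega>. indicator {k. profile_prob n k = 0} (profile n \<omega>) \<partial>P) = 0" by simp
  then have "AE \<omega> in P. (indicator {k. profile_prob n k = 0} (profile n \<omega>) :: ennreal) = 0"
    by (subst (asm) nn_integral_0_iff_AE) auto
  then show ?thesis by eventually_elim (auto simp: indicator_def split: if_splits)
qed

lemma joint_density_marginal_fst:
  "AE \<omega> in P. (\<integral>\<^sup>+\<omega>'. joint_density n (\<omega>, \<omega>') \<partial>P) = 1"
  using AE_profile_pos[of n]
proof eventually_elim
  case (elim \<omega>)
  let ?a = "profile n \<omega>"
  have "(\<integral>\<^sup>+\<omega>'. joint_density n (\<omega>, \<omega>') \<partial>P) = (\<integral>\<^sup>+b. ennreal (profile_prob n b) * (joint n (?a, b) / (ennreal (profile_prob n ?a) * ennreal (profile_prob n b))) \<partial>count_space UNIV)"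
    unfolding joint_density_def fst_conv snd_conv by (rule nn_integral_profile)
  also have "\<dots> = (\<integral>\<^sup>+b. joint n (?a, b) \<partial>count_space UNIV) / ennreal (profile_prob n ?a)"
    unfolding joint_cancel by (simp add: divide_ennreal_def nn_integral_multc)
  also have "\<dots> = 1" using elim by (simp add: joint_fst)
  finally show ?case .
qed

lemma joint_density_marginal_snd:
  "AE \<omega>' in P. (\<integral>\<^sup>+\<omega>. joint_density n (\<omega>, \<omega>') \<partial>P) = 1"
  using AE_profile_pos[of n]
proof eventually_elim
  case (elim \<omega>')
  let ?b = "profile n \<omega>'"
  have c: "ennreal (profile_prob n a) * (joint n (a, ?b) / (ennreal (profile_prob n a) * ennreal (profile_prob n ?b))) = joint n (a, ?b) / ennreal (profile_prob n ?b)" for a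
  proof (cases "profile_prob n a = 0")
    case True then show ?thesis by (simp add: joint_zero)
  next
    case False
    then have "inverse (ennreal (profile_prob n a) * ennreal (profile_prob n ?b)) = inverse (ennreal (profile_prob n a)) * inverse (ennreal (profile_prob n ?b))"
      using elim by (intro ennreal_inverse_mult) auto
    then have "ennreal (profile_prob n a) * (joint n (a, ?b) / (ennreal (profile_prob n a) * ennreal (profile_prob n ?b)))
      = ennreal (profile_prob n a) * ((joint n (a, ?b) / ennreal (profile_prob n ?b)) / ennreal (profile_prob n a))"
      by (simp only: divide_ennreal_def ac_simps)
    also have "\<dots> = joint n (a, ?b) / ennreal (profile_prob n ?b)"
      by (rule ennreal_mult_divide_cancel) (use False in auto)
    finally show ?thesis .
  qed
  have "(\<integral>\<^sup>+\<omega>. joint_density n (\<omega>, \<omega>') \<partial>P) = (\<integral>\<^sup>+a. ennreal (profile_prob n a) * (joint n (a, ?b) / (ennreal (profile_prob n a) * ennreal (profile_prob n ?b))) \<partial>count_space UNIV)"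
    unfolding joint_density_def fst_conv snd_conv by (rule nn_integral_profile)
  also have "\<dots> = (\<integral>\<^sup>+a. joint n (a, ?b) \<partial>count_space UNIV) / ennreal (profile_prob n ?b)"
    unfolding c by (simp add: divide_ennreal_def nn_integral_multc)
  also have "\<dots> = 1" using elim by (simp add: joint_snd)
  finally show ?case .
qed

lemma self_coupling_joint: "self_coupling P (joint_measure n)"
proof
  show "sets (joint_measure n) = sets (P \<Otimes>\<^sub>M P)" by (simp add: joint_measure_def)
  show "absolutely_continuous (P \<Otimes>\<^sub>M P) (joint_measure n)"
    unfolding joint_measure_def by (rule absolutely_continuousI_density) measurable
next
  fix a :: "'a set \<Rightarrow> ennreal" assume [measurable]: "a \<in> borel_measurable P"
  have "(\<integral>\<^sup>+x. a (fst x) \<partial>joint_measure n) = (\<integral>\<^sup>+x. joint_density n x * a (fst x) \<partial>(P \<Otimes>\<^sub>M P))"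
    unfolding joint_measure_def by (rule nn_integral_density) measurable
  also have "\<dots> = (\<integral>\<^sup>+\<omega>. \<integral>\<^sup>+\<omega>'. joint_density n (\<omega>, \<omega>') * a \<omega> \<partial>P \<partial>P)"
    by (subst P.nn_integral_fst[symmetric]) simp_all
  also have "\<dots> = (\<integral>\<^sup>+\<omega>. (\<integral>\<^sup>+\<omega>'. joint_density n (\<omega>, \<omega>') \<partial>P) * a \<omega> \<partial>P)"
    by (intro nn_integral_cong nn_integral_multc) measurable
  also have "\<dots> = (\<integral>\<^sup>+\<omega>. a \<omega> \<partial>P)"
    using joint_density_marginal_fst[of n] by (intro nn_integral_cong_AE) (auto elim!: eventually_mono)
  finally show "(\<integral>\<^sup>+x. a (fst x) \<partial>joint_measure n) = (\<integral>\<^sup>+\<omega>. a \<omega> \<partial>P)" .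
next
  fix a :: "'a set \<Rightarrow> ennreal" assume [measurable]: "a \<in> borel_measurable P"
  have "(\<integral>\<^sup>+x. a (snd x) \<partial>joint_measure n) = (\<integral>\<^sup>+x. joint_density n x * a (snd x) \<partial>(P \<Otimes>\<^sub>M P))"
    unfolding joint_measure_def by (rule nn_integral_density) measurable
  also have "\<dots> = (\<integral>\<^sup>+\<omega>'. \<integral>\<^sup>+\<omega>. joint_density n (\<omega>, \<omega>') * a \<omega>' \<partial>P \<partial>P)"
    by (subst PP.nn_integral_snd[symmetric]) simp_all
  also have "\<dots> = (\<integral>\<^sup>+\<omega>'. (\<integral>\<^sup>+\<omega>. joint_density n (\<omega>, \<omega>') \<partial>P) * a \<omega>' \<partial>P)"
    by (intro nn_integral_cong nn_integral_multc) measurable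
  also have "\<dots> = (\<integral>\<^sup>+\<omega>. a \<omega> \<partial>P)"
    using joint_density_marginal_snd[of n] by (intro nn_integral_cong_AE) (auto elim!: eventually_mono)
  finally show "(\<integral>\<^sup>+x. a (snd x) \<partial>joint_measure n) = (\<integral>\<^sup>+\<omega>. a \<omega> \<partial>P)" .
qed

lemma nn_integral_joint_measure:
  "(\<integral>\<^sup>+x. \<Phi> (profile n (fst x), profile n (snd x)) \<partial>joint_measure n) = (\<integral>\<^sup>+p. joint n p * \<Phi> p \<partial>count_space UNIV)"
proof -
  let ?q = "\<lambda>a b. joint n (a, b) / (ennreal (profile_prob n a) * ennreal (profile_prob n b))"
  note [measurable] = borel_measurable_profiles[of \<Phi> n]
  have "(\<integral>\<^sup>+x. \<Phi> (profile n (fst x), profile n (snd x)) \<partial>joint_measure n) = (\<integral>\<^sup>+x. joint_density n x * \<Phi> (profile n (fst x), profile n (snd x)) \<partial>(P \<Otimes>\<^sub>M P))"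
    unfolding joint_measure_def by (rule nn_integral_density) measurable
  also have "\<dots> = (\<integral>\<^sup>+\<omega>. \<integral>\<^sup>+\<omega>'. ?q (profile n \<omega>) (profile n \<omega>') * \<Phi> (profile n \<omega>, profile n \<omega>') \<partial>P \<partial>P)"
    by (subst P.nn_integral_fst[symmetric]) (simp_all add: joint_density_def)
  also have "\<dots> = (\<integral>\<^sup>+\<omega>. \<integral>\<^sup>+b. ennreal (profile_prob n b) * (?q (profile n \<omega>) b * \<Phi> (profile n \<omega>, b)) \<partial>count_space UNIV \<partial>P)"
    by (intro nn_integral_cong nn_integral_profile)
  also have "\<dots> = (\<integral>\<^sup>+a. ennreal (profile_prob n a) * (\<integral>\<^sup>+b. ennreal (profile_prob n b) * (?q a b * \<Phi> (a, b)) \<partial>count_space UNIV) \<partial>count_space UNIV)"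
    by (rule nn_integral_profile)
  also have "\<dots> = (\<integral>\<^sup>+a. \<integral>\<^sup>+b. joint n (a, b) * \<Phi> (a, b) \<partial>count_space UNIV \<partial>count_space UNIV)"
  proof (intro nn_integral_cong)
    fix a
    have "ennreal (profile_prob n a) * (ennreal (profile_prob n b) * (?q a b * \<Phi> (a, b))) = joint n (a, b) * \<Phi> (a, b)" for b
    proof -
      have "ennreal (profile_prob n a) * (ennreal (profile_prob n b) * (?q a b * \<Phi> (a, b))) = ennreal (profile_prob n a) * (joint n (a, b) / ennreal (profile_prob n a)) * \<Phi> (a, b)"
        unfolding joint_cancel[symmetric] by (simp only: mult.assoc)
      also have "ennreal (profile_prob n a) * (joint n (a, b) / ennreal (profile_prob n a)) = joint n (a, b)"
        by (cases "profile_prob n a = 0") (auto simp: joint_zero intro!: ennreal_mult_divide_cancel)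
      finally show ?thesis .
    qed
    then show "ennreal (profile_prob n a) * (\<integral>\<^sup>+b. ennreal (profile_prob n b) * (?q a b * \<Phi> (a, b)) \<partial>count_space UNIV) = (\<integral>\<^sup>+b. joint n (a, b) * \<Phi> (a, b) \<partial>count_space UNIV)"
      by (subst nn_integral_cmult[symmetric]) simp_all
  qed
  also have "\<dots> = (\<integral>\<^sup>+p. joint n p * \<Phi> p \<partial>count_space UNIV)"
    by (subst nn_integral_fst_count_space[symmetric]) simp
  finally show ?thesis .
qed

text \<open>\<open>coupling_identity\<close> for \<open>\<Phi> = f \<otimes> g\<close>;
  nonnegativity allows the passage through \<open>ennreal\<close>, and boundedness makes all four
  terms finite, so that they can be subtracted. Pointwise, \<open>ra - sp\<close> is the sum of
  products of gradients: the idle term of \<open>raise_op\<close> supplies the products without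
  insertion.\<close>

lemma covariance_profile_nonneg:
  fixes f g :: "nat multiset \<Rightarrow> real"
  assumes f: "\<And>k. 0 \<le> f k" "\<And>k. f k \<le> C" and g: "\<And>k. 0 \<le> g k" "\<And>k. g k \<le> C"
  shows "(\<integral>\<omega>. f (profile n \<omega>) * g (profile n \<omega>) \<partial>P) - (\<integral>\<omega>. f (profile n \<omega>) \<partial>P) * (\<integral>\<omega>. g (profile n \<omega>) \<partial>P)
    = (\<integral>x. (\<Sum>i\<in>cells n. mass n i * (f (add_mset i (profile n (fst x))) - f (profile n (fst x))) *
          (g (add_mset i (profile n (snd x))) - g (profile n (snd x)))) \<partial>joint_measure n)"
proof -
  interpret Q: self_coupling P "joint_measure n" by (rule self_coupling_joint)
  define \<Phi> where "\<Phi> p = ennreal (f (fst p) * g (snd p))" for p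
  define sp where "sp p = (\<Sum>i\<in>cells n. mass n i * (f (add_mset i (fst p)) * g (snd p))) + (\<Sum>i\<in>cells n. mass n i * (f (fst p) * g (add_mset i (snd p))))" for p
  define ra where "ra p = (\<Sum>i\<in>cells n. mass n i * (f (add_mset i (fst p)) * g (add_mset i (snd p)))) + (\<Sum>i\<in>cells n. mass n i) * (f (fst p) * g (snd p))" for p
  let ?pr = "\<lambda>x. (profile n (fst x), profile n (snd x))"
  have C: "0 \<le> C" using f(1)[of "{#}"] f(2)[of "{#}"] by simp
  have fg: "0 \<le> f a * g b" "f a * g b \<le> C * C" for a b using f g C by (auto intro!: mult_mono)
  have split: "split_op (cells n) (\<lambda>i. ennreal (mass n i)) \<Phi> p = ennreal (sp p)" for p
    unfolding split_op_def \<Phi>_def sp_def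
    by (auto simp: case_prod_beta ennreal_mult'[symmetric] fg sum_nonneg f g simp flip: ennreal_plus intro!: arg_cong2[where f="(+)"])
  have raise: "raise_op (cells n) (\<lambda>i. ennreal (mass n i)) \<Phi> p = ennreal (ra p)" for p
    unfolding raise_op_def \<Phi>_def ra_def
    by (auto simp: case_prod_beta ennreal_mult'[symmetric] fg sum_nonneg f g simp flip: ennreal_plus intro!: arg_cong2[where f="(+)"])
  define L where "L = (\<Sum>i\<in>cells n. mass n i * (C * C))"
  have sp: "0 \<le> sp p" "sp p \<le> L + L" for p
    unfolding sp_def L_def by (intro add_nonneg_nonneg sum_nonneg mult_nonneg_nonneg add_mono sum_mono mult_left_mono fg f g mass_nonneg)+
  have ra: "0 \<le> ra p" "ra p \<le> L + L" for p
    unfolding ra_def L_def sum_distrib_right by (intro add_nonneg_nonneg sum_nonneg mult_nonneg_nonneg add_mono sum_mono mult_left_mono fg f g mass_nonneg)+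
  have meas: "(\<lambda>x. \<phi> (?pr x) :: real) \<in> borel_measurable (joint_measure n)" for \<phi>
    using borel_measurable_profiles[of \<phi> n] by (simp cong: measurable_cong_sets)
  have intQ: "integrable (joint_measure n) (\<lambda>x. \<phi> (?pr x))" if "\<And>p. 0 \<le> \<phi> p" "\<And>p. \<phi> p \<le> B" for \<phi> :: "_ \<Rightarrow> real" and B
    by (rule Q.Q.integrable_const_bound[of _ B]) (use that meas in auto)
  have nnQ: "(\<integral>\<^sup>+p. joint n p * ennreal (\<phi> p) \<partial>count_space UNIV) = ennreal (\<integral>x. \<phi> (?pr x) \<partial>joint_measure n)"
    if "\<And>p. 0 \<le> \<phi> p" "\<And>p. \<phi> p \<le> B" for \<phi> :: "_ \<Rightarrow> real" and B
    unfolding nn_integral_joint_measure[where \<Phi>="\<lambda>p. ennreal (\<phi> p)", symmetric]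
    by (rule nn_integral_eq_integral[OF intQ]) (use that in auto)
  have measP: "(\<lambda>\<omega>. \<phi> (profile n \<omega>) :: real) \<in> borel_measurable P" for \<phi> by measurable
  have intP: "integrable P (\<lambda>\<omega>. \<phi> (profile n \<omega>))" if "\<And>p. 0 \<le> \<phi> p" "\<And>p. \<phi> p \<le> B" for \<phi> :: "_ \<Rightarrow> real" and B
    by (rule P.integrable_const_bound[of _ B]) (use that measP in auto)
  have nnP: "(\<integral>\<^sup>+k. ennreal (profile_prob n k) * ennreal (\<phi> k) \<partial>count_space UNIV) = ennreal (\<integral>\<omega>. \<phi> (profile n \<omega>) \<partial>P)"
    if "\<And>p. 0 \<le> \<phi> p" "\<And>p. \<phi> p \<le> B" for \<phi> :: "_ \<Rightarrow> real" and B
    unfolding nn_integral_profile[where \<phi>="\<lambda>p. ennreal (\<phi> p)", symmetric]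
    by (rule nn_integral_eq_integral[OF intP]) (use that in auto)
  let ?fg = "\<integral>\<omega>. f (profile n \<omega>) * g (profile n \<omega>) \<partial>P" and ?f = "\<integral>\<omega>. f (profile n \<omega>) \<partial>P" and ?g = "\<integral>\<omega>. g (profile n \<omega>) \<partial>P"
  have 1: "(\<integral>\<^sup>+k. ennreal (profile_prob n k) * \<Phi> (k, k) \<partial>count_space UNIV) = ennreal ?fg"
    unfolding \<Phi>_def fst_conv snd_conv by (rule nnP[of "\<lambda>k. f k * g k" "C * C"]) (auto simp: fg)
  have 2: "(\<integral>\<^sup>+a. ennreal (profile_prob n a) * (\<integral>\<^sup>+b. ennreal (profile_prob n b) * \<Phi> (a, b) \<partial>count_space UNIV) \<partial>count_space UNIV) = ennreal (?f * ?g)"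
  proof -
    have "(\<integral>\<^sup>+b. ennreal (profile_prob n b) * \<Phi> (a, b) \<partial>count_space UNIV) = ennreal (f a) * ennreal ?g" for a
    proof -
      have "(\<integral>\<^sup>+b. ennreal (profile_prob n b) * \<Phi> (a, b) \<partial>count_space UNIV) = (\<integral>\<^sup>+b. ennreal (f a) * (ennreal (profile_prob n b) * ennreal (g b)) \<partial>count_space UNIV)"
        by (intro nn_integral_cong) (simp add: \<Phi>_def ennreal_mult f g mult.left_commute)
      also have "\<dots> = ennreal (f a) * ennreal ?g"
        by (subst nn_integral_cmult) (simp_all add: nnP[of g C] g)
      finally show ?thesis .
    qed
    then have "(\<integral>\<^sup>+a. ennreal (profile_prob n a) * (\<integral>\<^sup>+b. ennreal (profile_prob n b) * \<Phi> (a, b) \<partial>count_space UNIV) \<partial>count_space UNIV)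
      = (\<integral>\<^sup>+a. (ennreal (profile_prob n a) * ennreal (f a)) * ennreal ?g \<partial>count_space UNIV)"
      by (simp add: mult.assoc)
    also have "\<dots> = ennreal ?f * ennreal ?g"
      by (subst nn_integral_multc) (simp_all add: nnP[of f C] f)
    also have "\<dots> = ennreal (?f * ?g)" by (rule ennreal_mult'[symmetric]) (simp add: f Bochner_Integration.integral_nonneg)
    finally show ?thesis .
  qed
  have "ennreal ?fg + ennreal (\<integral>x. sp (?pr x) \<partial>joint_measure n) = ennreal (?f * ?g) + ennreal (\<integral>x. ra (?pr x) \<partial>joint_measure n)"
    using joint_identity[of n \<Phi>] unfolding 1 2 split raise nnQ[OF sp] nnQ[OF ra] .
  then have eq: "?fg + (\<integral>x. sp (?pr x) \<partial>joint_measure n) = ?f * ?g + (\<integral>x. ra (?pr x) \<partial>joint_measure n)"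
  proof -
    have n: "0 \<le> ?fg" "0 \<le> ?f * ?g" "0 \<le> (\<integral>x. sp (?pr x) \<partial>joint_measure n)" "0 \<le> (\<integral>x. ra (?pr x) \<partial>joint_measure n)"
      by (simp_all add: f g fg sp ra Bochner_Integration.integral_nonneg)
    assume "ennreal ?fg + ennreal (\<integral>x. sp (?pr x) \<partial>joint_measure n) = ennreal (?f * ?g) + ennreal (\<integral>x. ra (?pr x) \<partial>joint_measure n)"
    then have "ennreal (?fg + (\<integral>x. sp (?pr x) \<partial>joint_measure n)) = ennreal (?f * ?g + (\<integral>x. ra (?pr x) \<partial>joint_measure n))"
      by (simp only: ennreal_plus[OF n(1,3)] ennreal_plus[OF n(2,4)])
    then show ?thesis by (subst (asm) ennreal_inj) (use n in auto)
  qed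
  have "(\<Sum>i\<in>cells n. mass n i * (f (add_mset i a) - f a) * (g (add_mset i b) - g b)) = ra (a, b) - sp (a, b)" for a b
    unfolding ra_def sp_def sum_distrib_right sum.distrib[symmetric] sum_subtractf[symmetric] fst_conv snd_conv
    by (intro sum.cong refl) (simp add: algebra_simps)
  then have "(\<integral>x. (\<Sum>i\<in>cells n. mass n i * (f (add_mset i (profile n (fst x))) - f (profile n (fst x))) *
          (g (add_mset i (profile n (snd x))) - g (profile n (snd x)))) \<partial>joint_measure n)
    = (\<integral>x. ra (?pr x) - sp (?pr x) \<partial>joint_measure n)" by simp
  also have "\<dots> = (\<integral>x. ra (?pr x) \<partial>joint_measure n) - (\<integral>x. sp (?pr x) \<partial>joint_measure n)"
    by (rule Bochner_Integration.integral_diff[OF intQ[OF ra] intQ[OF sp]])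
  finally show ?thesis using eq by linarith
qed

text \<open>Adding the constant \<open>C\<close> to both functions makes them nonnegative and
  changes neither the covariance nor the gradients.\<close>

lemma covariance_profile:
  fixes f g :: "nat multiset \<Rightarrow> real"
  assumes f: "\<And>k. \<bar>f k\<bar> \<le> C" and g: "\<And>k. \<bar>g k\<bar> \<le> C"
  shows "(\<integral>\<omega>. f (profile n \<omega>) * g (profile n \<omega>) \<partial>P) - (\<integral>\<omega>. f (profile n \<omega>) \<partial>P) * (\<integral>\<omega>. g (profile n \<omega>) \<partial>P)
    = (\<integral>x. (\<Sum>i\<in>cells n. mass n i * (f (add_mset i (profile n (fst x))) - f (profile n (fst x))) *
          (g (add_mset i (profile n (snd x))) - g (profile n (snd x)))) \<partial>joint_measure n)"
proof -
  have C: "0 \<le> C" using f[of "{#}"] by linarith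
  have measP: "(\<lambda>\<omega>. \<phi> (profile n \<omega>) :: real) \<in> borel_measurable P" for \<phi> by measurable
  have int: "integrable P (\<lambda>\<omega>. \<phi> (profile n \<omega>))" if "\<And>p. \<bar>\<phi> p\<bar> \<le> B" for \<phi> :: "_ \<Rightarrow> real" and B
    by (rule P.integrable_const_bound[of _ B]) (use that measP in auto)
  have fg: "\<bar>f k * g k\<bar> \<le> C * C" for k unfolding abs_mult by (intro mult_mono f g C) auto
  have f0: "0 \<le> f k + C" "f k + C \<le> 2 * C" for k using f[of k] by auto
  have g0: "0 \<le> g k + C" "g k + C \<le> 2 * C" for k using g[of k] by auto
  have e: "(f k + C) * (g k + C) = f k * g k + C * f k + C * g k + C * C" for k by (simp add: algebra_simps)
  note i = int[of f C, OF f] int[of g C, OF g] int[of "\<lambda>k. f k * g k", OF fg]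
  have "(\<integral>\<omega>. (f (profile n \<omega>) + C) * (g (profile n \<omega>) + C) \<partial>P) - (\<integral>\<omega>. f (profile n \<omega>) + C \<partial>P) * (\<integral>\<omega>. g (profile n \<omega>) + C \<partial>P)
    = (\<integral>\<omega>. f (profile n \<omega>) * g (profile n \<omega>) \<partial>P) - (\<integral>\<omega>. f (profile n \<omega>) \<partial>P) * (\<integral>\<omega>. g (profile n \<omega>) \<partial>P)"
    unfolding e using i by (simp add: P.prob_space algebra_simps del: space_P)
  then show ?thesis
    using covariance_profile_nonneg[of "\<lambda>k. f k + C" "2 * C" "\<lambda>k. g k + C" n, OF f0 g0] by simp
qed

end

section \<open>The covariance inequality\<close>

definition L2norm :: "'x measure \<Rightarrow> ('x \<Rightarrow> real) \<Rightarrow> real" where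
  "L2norm M f = sqrt (\<integral>x. (f x)\<^sup>2 \<partial>M)"

lemma L2norm_nonneg[simp]: "0 \<le> L2norm M f"
  by (simp add: L2norm_def)

lemma square_integrable_measurable[measurable_dest]: "square_integrable M f \<Longrightarrow> f \<in> borel_measurable M"
  by (simp add: square_integrable_def)

lemma square_integrable_iff_nn:
  "f \<in> borel_measurable M \<Longrightarrow> square_integrable M f \<longleftrightarrow> (\<integral>\<^sup>+x. ennreal ((f x)\<^sup>2) \<partial>M) < \<infinity>"
  by (auto simp: square_integrable_def integrable_iff_bounded)

lemma square_integrable_mult:
  assumes f: "square_integrable M f" and g: "square_integrable M g"
  shows "integrable M (\<lambda>x. f x * g x)"
proof (rule Bochner_Integration.integrable_bound)
  show "integrable M (\<lambda>x. (f x)\<^sup>2 + (g x)\<^sup>2)" using f g by (auto simp: square_integrable_def)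
  show "(\<lambda>x. f x * g x) \<in> borel_measurable M" using f g by (auto simp: square_integrable_def)
  have "\<bar>a * b\<bar> \<le> a\<^sup>2 + b\<^sup>2" for a b :: real
  proof -
    have "0 \<le> (\<bar>a\<bar> - \<bar>b\<bar>)\<^sup>2" by simp
    then have "2 * (\<bar>a\<bar> * \<bar>b\<bar>) \<le> a\<^sup>2 + b\<^sup>2" by (simp add: power2_eq_square algebra_simps)
    moreover have "0 \<le> \<bar>a\<bar> * \<bar>b\<bar>" by simp
    ultimately show ?thesis unfolding abs_mult by linarith
  qed
  then show "AE x in M. norm (f x * g x) \<le> norm ((f x)\<^sup>2 + (g x)\<^sup>2)" by simp
qed

lemma square_integrable_add:
  assumes f: "square_integrable M f" and g: "square_integrable M g"
  shows "square_integrable M (\<lambda>x. f x + g x)"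
proof -
  have "integrable M (\<lambda>x. (f x)\<^sup>2 + 2 * (f x * g x) + (g x)\<^sup>2)"
    using f g square_integrable_mult[OF f g] by (auto simp: square_integrable_def)
  then have "integrable M (\<lambda>x. (f x + g x)\<^sup>2)" by (simp add: power2_sum algebra_simps)
  then show ?thesis using f g by (auto simp: square_integrable_def)
qed

lemma square_integrable_diff:
  assumes f: "square_integrable M f" and g: "square_integrable M g"
  shows "square_integrable M (\<lambda>x. f x - g x)"
proof -
  have "square_integrable M (\<lambda>x. - g x)" using g by (auto simp: square_integrable_def)
  from square_integrable_add[OF f this] show ?thesis by simp
qed

lemma Cauchy_Schwarz_integral:
  assumes f: "square_integrable M f" and g: "square_integrable M g"
  shows "\<bar>\<integral>x. f x * g x \<partial>M\<bar> \<le> L2norm M f * L2norm M g"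
proof -
  note [measurable] = square_integrable_measurable[OF f] square_integrable_measurable[OF g]
  have fg: "integrable M (\<lambda>x. \<bar>f x * g x\<bar>)" using square_integrable_mult[OF f g] by simp
  have e: "(\<integral>\<^sup>+x. ennreal \<bar>f x\<bar> * ennreal \<bar>g x\<bar> \<partial>M) = ennreal (\<integral>x. \<bar>f x * g x\<bar> \<partial>M)"
    by (subst nn_integral_eq_integral[OF fg, symmetric]) (auto simp: abs_mult ennreal_mult)
  have s: "(\<integral>\<^sup>+x. (ennreal \<bar>h x\<bar>)\<^sup>2 \<partial>M) = ennreal (\<integral>x. (h x)\<^sup>2 \<partial>M)" if "square_integrable M h" for h
    using that by (subst nn_integral_eq_integral[symmetric]) (auto simp: square_integrable_def ennreal_power)
  have "(ennreal (\<integral>x. \<bar>f x * g x\<bar> \<partial>M))\<^sup>2 \<le> ennreal (\<integral>x. (f x)\<^sup>2 \<partial>M) * ennreal (\<integral>x. (g x)\<^sup>2 \<partial>M)"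
    using Cauchy_Schwarz_nn_integral[of "\<lambda>x. ennreal \<bar>f x\<bar>" M "\<lambda>x. ennreal \<bar>g x\<bar>"] unfolding e s[OF f] s[OF g] by simp
  then have "(\<integral>x. \<bar>f x * g x\<bar> \<partial>M)\<^sup>2 \<le> (\<integral>x. (f x)\<^sup>2 \<partial>M) * (\<integral>x. (g x)\<^sup>2 \<partial>M)"
    by (simp add: ennreal_power Bochner_Integration.integral_nonneg flip: ennreal_mult)
  then have "(\<integral>x. \<bar>f x * g x\<bar> \<partial>M) \<le> L2norm M f * L2norm M g"
    unfolding L2norm_def real_sqrt_mult[symmetric] by (rule real_le_rsqrt)
  moreover have "\<bar>\<integral>x. f x * g x \<partial>M\<bar> \<le> (\<integral>x. \<bar>f x * g x\<bar> \<partial>M)" by (rule integral_abs_bound)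
  ultimately show ?thesis by linarith
qed

lemma L2norm_tendsto_0:
  fixes f :: "nat \<Rightarrow> 'x \<Rightarrow> real"
  assumes f: "\<And>n. square_integrable M (f n)" and lim: "(\<lambda>n. \<integral>\<^sup>+x. ennreal ((f n x)\<^sup>2) \<partial>M) \<longlonglongrightarrow> 0"
  shows "(\<lambda>n. L2norm M (f n)) \<longlonglongrightarrow> 0"
proof -
  have "(\<integral>\<^sup>+x. ennreal ((f n x)\<^sup>2) \<partial>M) = ennreal (\<integral>x. (f n x)\<^sup>2 \<partial>M)" for n
    using f[of n] by (intro nn_integral_eq_integral) (auto simp: square_integrable_def)
  then have "(\<lambda>n. \<integral>x. (f n x)\<^sup>2 \<partial>M) \<longlonglongrightarrow> 0"
    using lim by (simp add: Bochner_Integration.integral_nonneg flip: ennreal_0)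
  from tendsto_real_sqrt[OF this] show ?thesis by (simp add: L2norm_def)
qed

text \<open>The measures vary with \<open>n\<close>, so neither inner product has to converge; only
  their difference does. Writing f' = f + (f' - f) and likewise for g', Cauchy-Schwarz bounds the
  three error terms with constants independent of \<open>n\<close>.\<close>

lemma inner_product_tendsto:
  fixes f f' g g' :: "nat \<Rightarrow> 'x \<Rightarrow> real"
  assumes si: "\<And>n. square_integrable (M n) (f n)" "\<And>n. square_integrable (M n) (f' n)"
      "\<And>n. square_integrable (M n) (g n)" "\<And>n. square_integrable (M n) (g' n)"
    and F: "(\<lambda>n. L2norm (M n) (\<lambda>x. f' n x - f n x)) \<longlonglongrightarrow> 0" and G: "(\<lambda>n. L2norm (M n) (\<lambda>x. g' n x - g n x)) \<longlonglongrightarrow> 0"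
    and bound: "\<And>n. L2norm (M n) (f n) \<le> A" "\<And>n. L2norm (M n) (g n) \<le> B"
  shows "(\<lambda>n. (\<integral>x. f' n x * g' n x \<partial>M n) - (\<integral>x. f n x * g n x \<partial>M n)) \<longlonglongrightarrow> 0"
proof (rule tendsto_0_le[where K=1])
  let ?e = "\<lambda>n. L2norm (M n) (\<lambda>x. f' n x - f n x)" and ?d = "\<lambda>n. L2norm (M n) (\<lambda>x. g' n x - g n x)"
  have "(\<lambda>n. ?e n * ?d n + ?e n * B + A * ?d n) \<longlonglongrightarrow> 0 * 0 + 0 * B + A * 0"
    by (intro tendsto_intros F G)
  then show "(\<lambda>n. ?e n * ?d n + ?e n * B + A * ?d n) \<longlonglongrightarrow> 0" by simp
  show "\<forall>\<^sub>F n in sequentially. norm ((\<integral>x. f' n x * g' n x \<partial>M n) - (\<integral>x. f n x * g n x \<partial>M n)) \<le> norm (?e n * ?d n + ?e n * B + A * ?d n) * 1"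
  proof (intro always_eventually allI)
    fix n
    note df = square_integrable_diff[OF si(2,1), of n] and dg = square_integrable_diff[OF si(4,3), of n]
    let ?D = "(\<integral>x. f' n x * g' n x \<partial>M n) - (\<integral>x. f n x * g n x \<partial>M n)"
    have "(\<lambda>x. f' n x * g' n x) = (\<lambda>x. ((f' n x - f n x) * (g' n x - g n x) + (f' n x - f n x) * g n x) + (f n x * (g' n x - g n x) + f n x * g n x))"
      by (auto simp: algebra_simps)
    then have D: "?D = (\<integral>x. (f' n x - f n x) * (g' n x - g n x) \<partial>M n) + (\<integral>x. (f' n x - f n x) * g n x \<partial>M n) + (\<integral>x. f n x * (g' n x - g n x) \<partial>M n)"
      using square_integrable_mult[OF df dg] square_integrable_mult[OF df si(3)] square_integrable_mult[OF si(1) dg] square_integrable_mult[OF si(1,3), of n]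
      by simp
    have "\<bar>?D\<bar> \<le> ?e n * ?d n + ?e n * L2norm (M n) (g n) + L2norm (M n) (f n) * ?d n"
      unfolding D using Cauchy_Schwarz_integral[OF df dg] Cauchy_Schwarz_integral[OF df si(3)] Cauchy_Schwarz_integral[OF si(1) dg] by linarith
    moreover have "?e n * L2norm (M n) (g n) \<le> ?e n * B" by (intro mult_left_mono bound) simp
    moreover have "L2norm (M n) (f n) * ?d n \<le> A * ?d n" by (intro mult_right_mono bound) simp
    ultimately have "\<bar>?D\<bar> \<le> ?e n * ?d n + ?e n * B + A * ?d n" by linarith
    also have "\<dots> \<le> \<bar>?e n * ?d n + ?e n * B + A * ?d n\<bar>" by (rule abs_ge_self)
    finally show "norm ?D \<le> norm (?e n * ?d n + ?e n * B + A * ?d n) * 1"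
      unfolding real_norm_def mult_1_right .
  qed
qed

lemma measure_eqI_nn_integral:
  assumes sets: "sets M = sets N" and "\<And>A. A \<in> sets M \<Longrightarrow> (\<integral>\<^sup>+x. indicator A x \<partial>M) = (\<integral>\<^sup>+x. indicator A x \<partial>N)"
  shows "M = N"
proof (rule measure_eqI[OF sets])
  fix A assume "A \<in> sets M"
  then show "emeasure M A = emeasure N A" using assms by (simp flip: nn_integral_indicator)
qed

section \<open>Functions of one coordinate under a self-coupling\<close>

context self_coupling
begin

lemma distr_fst: "distr Q P fst = P"
proof (rule measure_eqI_nn_integral)
  fix A assume "A \<in> sets (distr Q P fst)"
  then have [measurable]: "A \<in> sets P" by simp
  have "(\<integral>\<^sup>+\<omega>. indicator A \<omega> \<partial>distr Q P fst) = (\<integral>\<^sup>+x. indicator A (fst x) \<partial>Q)"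
    by (rule nn_integral_distr) measurable
  also have "\<dots> = (\<integral>\<^sup>+\<omega>. indicator A \<omega> \<partial>P)" by (rule marginal_fst) measurable
  finally show "(\<integral>\<^sup>+\<omega>. indicator A \<omega> \<partial>distr Q P fst) = (\<integral>\<^sup>+\<omega>. indicator A \<omega> \<partial>P)" .
qed simp

lemma distr_snd: "distr Q P snd = P"
proof (rule measure_eqI_nn_integral)
  fix A assume "A \<in> sets (distr Q P snd)"
  then have [measurable]: "A \<in> sets P" by simp
  have "(\<integral>\<^sup>+\<omega>. indicator A \<omega> \<partial>distr Q P snd) = (\<integral>\<^sup>+x. indicator A (snd x) \<partial>Q)"
    by (rule nn_integral_distr) measurable
  also have "\<dots> = (\<integral>\<^sup>+\<omega>. indicator A \<omega> \<partial>P)" by (rule marginal_snd) measurable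
  finally show "(\<integral>\<^sup>+\<omega>. indicator A \<omega> \<partial>distr Q P snd) = (\<integral>\<^sup>+\<omega>. indicator A \<omega> \<partial>P)" .
qed simp

lemma AE_fst: "AE \<omega> in P. R \<omega> \<Longrightarrow> AE x in Q. R (fst x)"
  using AE_distrD[OF measurable_fst_Q, of R] unfolding distr_fst .

lemma AE_snd: "AE \<omega> in P. R \<omega> \<Longrightarrow> AE x in Q. R (snd x)"
  using AE_distrD[OF measurable_snd_Q, of R] unfolding distr_snd .

lemma distr_pair:
  fixes N :: "'y measure"
  assumes N: "sigma_finite_measure N" and p[measurable]: "p \<in> measurable Q P" and d: "distr Q P p = P"
  shows "distr (Q \<Otimes>\<^sub>M N) (P \<Otimes>\<^sub>M N) (\<lambda>z. (p (fst z), snd z)) = P \<Otimes>\<^sub>M N"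
proof (rule measure_eqI_nn_integral)
  interpret N: sigma_finite_measure N by (rule N)
  fix A assume "A \<in> sets (distr (Q \<Otimes>\<^sub>M N) (P \<Otimes>\<^sub>M N) (\<lambda>z. (p (fst z), snd z)))"
  then have A[measurable]: "A \<in> sets (P \<Otimes>\<^sub>M N)" by simp
  have "(\<integral>\<^sup>+x. indicator A x \<partial>distr (Q \<Otimes>\<^sub>M N) (P \<Otimes>\<^sub>M N) (\<lambda>z. (p (fst z), snd z))) = (\<integral>\<^sup>+z. indicator A (p (fst z), snd z) \<partial>(Q \<Otimes>\<^sub>M N))"
    by (rule nn_integral_distr) measurable
  also have "\<dots> = (\<integral>\<^sup>+x. \<integral>\<^sup>+y. indicator A (p x, y) \<partial>N \<partial>Q)"
    by (subst N.nn_integral_fst[symmetric]) simp_all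
  also have "\<dots> = (\<integral>\<^sup>+\<omega>. \<integral>\<^sup>+y. indicator A (\<omega>, y) \<partial>N \<partial>distr Q P p)"
    by (rule nn_integral_distr[symmetric]) measurable
  also have "\<dots> = (\<integral>\<^sup>+x. indicator A x \<partial>(P \<Otimes>\<^sub>M N))"
    unfolding d by (subst N.nn_integral_fst[symmetric]) simp_all
  finally show "(\<integral>\<^sup>+x. indicator A x \<partial>distr (Q \<Otimes>\<^sub>M N) (P \<Otimes>\<^sub>M N) (\<lambda>z. (p (fst z), snd z))) = (\<integral>\<^sup>+x. indicator A x \<partial>(P \<Otimes>\<^sub>M N))" .
qed simp

text \<open>Composition with a coordinate \<open>p\<close> of law \<open>P\<close> is an isometry
  from L2 of \<open>P \<Otimes>\<^sub>M N\<close> into L2 of \<open>Q \<Otimes>\<^sub>M N\<close>.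
  The norms therefore do not depend on the coupling, which is the source of all uniformity
  below.\<close>

lemma lift_L2:
  fixes N :: "'y measure" and a :: "'w \<times> 'y \<Rightarrow> real"
  assumes N: "sigma_finite_measure N" and p[measurable]: "p \<in> measurable Q P" and d: "distr Q P p = P"
    and a: "a \<in> borel_measurable (P \<Otimes>\<^sub>M N)"
  shows "square_integrable (Q \<Otimes>\<^sub>M N) (\<lambda>z. a (p (fst z), snd z)) \<longleftrightarrow> square_integrable (P \<Otimes>\<^sub>M N) a"
    and "L2norm (Q \<Otimes>\<^sub>M N) (\<lambda>z. a (p (fst z), snd z)) = L2norm (P \<Otimes>\<^sub>M N) a"
proof -
  have m[measurable]: "(\<lambda>z. (p (fst z), snd z)) \<in> measurable (Q \<Otimes>\<^sub>M N) (P \<Otimes>\<^sub>M N)" by measurable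
  note [measurable] = a
  have "integrable (Q \<Otimes>\<^sub>M N) (\<lambda>z. (a (p (fst z), snd z))\<^sup>2) \<longleftrightarrow> integrable (P \<Otimes>\<^sub>M N) (\<lambda>x. (a x)\<^sup>2)"
    using integrable_distr_eq[OF m, of "\<lambda>x. (a x)\<^sup>2"] unfolding distr_pair[OF N p d] by simp
  moreover have "(\<lambda>z. a (p (fst z), snd z)) \<in> borel_measurable (Q \<Otimes>\<^sub>M N)" by measurable
  ultimately show "square_integrable (Q \<Otimes>\<^sub>M N) (\<lambda>z. a (p (fst z), snd z)) \<longleftrightarrow> square_integrable (P \<Otimes>\<^sub>M N) a"
    using a by (simp add: square_integrable_def)
  show "L2norm (Q \<Otimes>\<^sub>M N) (\<lambda>z. a (p (fst z), snd z)) = L2norm (P \<Otimes>\<^sub>M N) a"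
    using integral_distr[OF m, of "\<lambda>x. (a x)\<^sup>2"] unfolding distr_pair[OF N p d] L2norm_def by simp
qed

end

text \<open>For gradients this is the right-hand side of the covariance identity, the expectation
  over a pair of configurations of the integral of \<open>a(\<omega>, y) b(\<omega>', y)\<close> in
  \<open>y\<close>.\<close>

definition pair_form :: "('w \<times> 'w) measure \<Rightarrow> 'y measure \<Rightarrow> ('w \<times> 'y \<Rightarrow> real) \<Rightarrow> ('w \<times> 'y \<Rightarrow> real) \<Rightarrow> real" where
  "pair_form Q N a b = (\<integral>z. a (fst (fst z), snd z) * b (snd (fst z), snd z) \<partial>(Q \<Otimes>\<^sub>M N))"

text \<open>Uniform continuity of the forms: by \<open>lift_L2\<close> the hypotheses of
  \<open>inner_product_tendsto\<close> hold for an arbitrary sequence of self-couplings.\<close>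

lemma pair_form_tendsto:
  fixes P :: "'w measure" and N :: "'y measure" and a b :: "'w \<times> 'y \<Rightarrow> real" and a' b' :: "nat \<Rightarrow> 'w \<times> 'y \<Rightarrow> real"
  assumes Q: "\<And>n. self_coupling P (Q n)" and N: "sigma_finite_measure N"
    and si: "square_integrable (P \<Otimes>\<^sub>M N) a" "square_integrable (P \<Otimes>\<^sub>M N) b"
      "\<And>n. square_integrable (P \<Otimes>\<^sub>M N) (a' n)" "\<And>n. square_integrable (P \<Otimes>\<^sub>M N) (b' n)"
    and lim: "(\<lambda>n. L2norm (P \<Otimes>\<^sub>M N) (\<lambda>x. a' n x - a x)) \<longlonglongrightarrow> 0" "(\<lambda>n. L2norm (P \<Otimes>\<^sub>M N) (\<lambda>x. b' n x - b x)) \<longlonglongrightarrow> 0"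
  shows "(\<lambda>n. pair_form (Q n) N (a' n) (b' n) - pair_form (Q n) N a b) \<longlonglongrightarrow> 0"
proof -
  note m = si[THEN square_integrable_measurable]
  note L = self_coupling.lift_L2[OF Q N self_coupling.measurable_fst_Q[OF Q] self_coupling.distr_fst[OF Q]]
  note R = self_coupling.lift_L2[OF Q N self_coupling.measurable_snd_Q[OF Q] self_coupling.distr_snd[OF Q]]
  show ?thesis unfolding pair_form_def
  proof (rule inner_product_tendsto)
    show "(\<lambda>n. L2norm (Q n \<Otimes>\<^sub>M N) (\<lambda>z. a' n (fst (fst z), snd z) - a (fst (fst z), snd z))) \<longlonglongrightarrow> 0"
      using lim(1) L(2)[of "\<lambda>x. a' _ x - a x"] m by simp
    show "(\<lambda>n. L2norm (Q n \<Otimes>\<^sub>M N) (\<lambda>z. b' n (snd (fst z), snd z) - b (snd (fst z), snd z))) \<longlonglongrightarrow> 0"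
      using lim(2) R(2)[of "\<lambda>x. b' _ x - b x"] m by simp
    show "L2norm (Q n \<Otimes>\<^sub>M N) (\<lambda>z. a (fst (fst z), snd z)) \<le> L2norm (P \<Otimes>\<^sub>M N) a" for n using L(2)[OF m(1)] by simp
    show "L2norm (Q n \<Otimes>\<^sub>M N) (\<lambda>z. b (snd (fst z), snd z)) \<le> L2norm (P \<Otimes>\<^sub>M N) b" for n using R(2)[OF m(2)] by simp
  qed (use L(1)[OF m(1)] L(1)[OF m(3)] R(1)[OF m(2)] R(1)[OF m(4)] si in auto)
qed

lemma (in self_coupling) pair_form_Fubini:
  fixes N :: "'y measure" and a b :: "'w \<times> 'y \<Rightarrow> real"
  assumes N: "sigma_finite_measure N"
    and a: "square_integrable (P \<Otimes>\<^sub>M N) a" and b: "square_integrable (P \<Otimes>\<^sub>M N) b"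
  shows "pair_form Q N a b = (\<integral>x. (\<integral>y. a (fst x, y) * b (snd x, y) \<partial>N) \<partial>Q)"
    and "integrable Q (\<lambda>x. \<integral>y. a (fst x, y) * b (snd x, y) \<partial>N)"
proof -
  interpret N: sigma_finite_measure N by (rule N)
  interpret QN: pair_sigma_finite Q N ..
  have i: "integrable (Q \<Otimes>\<^sub>M N) (\<lambda>z. a (fst (fst z), snd z) * b (snd (fst z), snd z))"
  proof (rule square_integrable_mult)
    show "square_integrable (Q \<Otimes>\<^sub>M N) (\<lambda>z. a (fst (fst z), snd z))"
      by (rule lift_L2(1)[OF N measurable_fst_Q distr_fst square_integrable_measurable[OF a], THEN iffD2, OF a])
    show "square_integrable (Q \<Otimes>\<^sub>M N) (\<lambda>z. b (snd (fst z), snd z))"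
      by (rule lift_L2(1)[OF N measurable_snd_Q distr_snd square_integrable_measurable[OF b], THEN iffD2, OF b])
  qed
  show "pair_form Q N a b = (\<integral>x. (\<integral>y. a (fst x, y) * b (snd x, y) \<partial>N) \<partial>Q)"
    unfolding pair_form_def using QN.integral_fst'[OF i] by simp
  show "integrable Q (\<lambda>x. \<integral>y. a (fst x, y) * b (snd x, y) \<partial>N)"
    using QN.integrable_fst'[OF i] by simp
qed

lemma L2_dominated:
  fixes f :: "'x \<Rightarrow> real" and f' :: "nat \<Rightarrow> 'x \<Rightarrow> real"
  assumes f: "square_integrable M f" and f'[measurable]: "\<And>m. f' m \<in> borel_measurable M"
    and dom: "\<And>m x. \<bar>f' m x\<bar> \<le> \<bar>f x\<bar>" and lim: "\<And>x. (\<lambda>m. f' m x) \<longlonglongrightarrow> f x"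
  shows "square_integrable M (f' m)" and "(\<lambda>m. L2norm M (\<lambda>x. f' m x - f x)) \<longlonglongrightarrow> 0"
proof -
  have [measurable]: "f \<in> borel_measurable M" by (rule square_integrable_measurable[OF f])
  have f2: "integrable M (\<lambda>x. (f x)\<^sup>2)" using f by (simp add: square_integrable_def)
  have "integrable M (\<lambda>x. (f' m x)\<^sup>2)"
    by (rule Bochner_Integration.integrable_bound[OF f2]) (use dom in \<open>auto simp: abs_le_square_iff[symmetric]\<close>)
  then show "square_integrable M (f' m)" by (simp add: square_integrable_def)
  have "(\<lambda>m. \<integral>x. (f' m x - f x)\<^sup>2 \<partial>M) \<longlonglongrightarrow> (\<integral>x. 0 \<partial>M)"
  \<comment> \<open>The factor 4 is the square of 2, from
    \<open>\<bar>f' m x - f x\<bar> \<le> 2 * \<bar>f x\<bar>\<close>.\<close>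
  proof (rule integral_dominated_convergence[where w="\<lambda>x. 4 * (f x)\<^sup>2"])
    show "AE x in M. (\<lambda>m. (f' m x - f x)\<^sup>2) \<longlonglongrightarrow> 0"
    proof (intro AE_I2)
      fix x
      have "(\<lambda>m. (f' m x - f x)\<^sup>2) \<longlonglongrightarrow> (f x - f x)\<^sup>2" by (intro tendsto_intros lim)
      then show "(\<lambda>m. (f' m x - f x)\<^sup>2) \<longlonglongrightarrow> 0" by simp
    qed
    show "AE x in M. norm ((f' m x - f x)\<^sup>2) \<le> 4 * (f x)\<^sup>2" for m
    proof (intro AE_I2)
      fix x
      have "\<bar>f' m x - f x\<bar> \<le> \<bar>2 * f x\<bar>" using dom[of m x] by linarith
      then have "(f' m x - f x)\<^sup>2 \<le> (2 * f x)\<^sup>2" by (simp only: abs_le_square_iff)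
      then show "norm ((f' m x - f x)\<^sup>2) \<le> 4 * (f x)\<^sup>2" by (simp add: power_mult_distrib)
    qed
  qed (use f2 in auto)
  from tendsto_real_sqrt[OF this] show "(\<lambda>m. L2norm M (\<lambda>x. f' m x - f x)) \<longlonglongrightarrow> 0"
    by (simp add: L2norm_def)
qed

lemma (in code_filtration) cell_mean_square_integrable:
  assumes f: "square_integrable M f"
  shows "square_integrable M (\<lambda>x. cell_mean n f (c n x))"
    and "(\<lambda>n. L2norm M (\<lambda>x. cell_mean n f (c n x) - f x)) \<longlonglongrightarrow> 0"
proof -
  have m[measurable]: "f \<in> borel_measurable M" by (rule square_integrable_measurable[OF f])
  have fin: "(\<integral>\<^sup>+x. ennreal ((f x)\<^sup>2) \<partial>M) < \<infinity>" using f square_integrable_iff_nn[OF m] by blast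
  have si: "square_integrable M (\<lambda>x. f x - cell_mean n f (c n x))" for n
  proof (subst square_integrable_iff_nn)
    have "(\<integral>\<^sup>+x. ennreal ((f x - cell_mean n f (c n x))\<^sup>2) \<partial>M) \<le> (\<integral>\<^sup>+x. ennreal ((f x - 0)\<^sup>2) \<partial>M)"
      using cell_mean_best[OF m fin, of "\<lambda>_. 0" n] by simp
    also have "\<dots> < \<infinity>" using fin by simp
    finally show "(\<integral>\<^sup>+x. ennreal ((f x - cell_mean n f (c n x))\<^sup>2) \<partial>M) < \<infinity>" .
  qed measurable
  show "square_integrable M (\<lambda>x. cell_mean n f (c n x))"
    using square_integrable_diff[OF f si[of n]] by simp
  show "(\<lambda>n. L2norm M (\<lambda>x. cell_mean n f (c n x) - f x)) \<longlonglongrightarrow> 0"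
    using L2norm_tendsto_0[OF si cell_mean_L2[OF m fin]] by (simp add: L2norm_def power2_commute)
qed

definition grad :: "('a set \<Rightarrow> real) \<Rightarrow> 'a set \<times> 'a \<Rightarrow> real" where
  "grad F x = F (insert (snd x) (fst x)) - F (fst x)"

lemma grad_diff_op: "(\<lambda>(\<omega>, y). diff_op F y \<omega>) = grad F"
  by (auto simp: grad_def diff_op_def)

lemma dom_diff_iff: "F \<in> dom_diff \<nu> P \<longleftrightarrow> square_integrable P F \<and> square_integrable (P \<Otimes>\<^sub>M \<nu>) (grad F)"
  by (simp add: dom_diff_def grad_diff_op)

text \<open>A contraction fixing 0: truncating \<open>F\<close> shrinks both \<open>F\<close> and
  its gradient pointwise in absolute value, so both converge in L2 by domination.\<close>

definition truncate :: "real \<Rightarrow> real \<Rightarrow> real" where "truncate C x = max (- C) (min C x)"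

lemma truncate_bounds: "0 \<le> C \<Longrightarrow> \<bar>truncate C x\<bar> \<le> C" "0 \<le> C \<Longrightarrow> \<bar>truncate C x\<bar> \<le> \<bar>x\<bar>"
  "\<bar>truncate C x - truncate C y\<bar> \<le> \<bar>x - y\<bar>"
  by (auto simp: truncate_def max_def min_def)

lemma truncate_tendsto: "(\<lambda>m. truncate (real m) x) \<longlonglongrightarrow> x"
proof (rule tendsto_eventually)
  obtain m0 :: nat where m0: "\<bar>x\<bar> \<le> real m0" using real_arch_simple by blast
  show "\<forall>\<^sub>F m in sequentially. truncate (real m) x = x"
    using eventually_ge_at_top[of m0] by eventually_elim (use m0 in \<open>auto simp: truncate_def\<close>)
qed

lemma truncate_measurable[measurable]: "truncate C \<in> borel_measurable borel"
  unfolding truncate_def[abs_def] by measurable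

text \<open>Expectations are inner products with the constant 1, so every term falls under
  \<open>inner_product_tendsto\<close>.\<close>

lemma (in prob_space) covariance_tendsto:
  fixes f g :: "'a \<Rightarrow> real" and f' g' :: "nat \<Rightarrow> 'a \<Rightarrow> real"
  assumes f: "square_integrable M f" "\<And>n. square_integrable M (f' n)" and F: "(\<lambda>n. L2norm M (\<lambda>x. f' n x - f x)) \<longlonglongrightarrow> 0"
    and g: "square_integrable M g" "\<And>n. square_integrable M (g' n)" and G: "(\<lambda>n. L2norm M (\<lambda>x. g' n x - g x)) \<longlonglongrightarrow> 0"
  shows "(\<lambda>n. (\<integral>x. f' n x * g' n x \<partial>M) - (\<integral>x. f' n x \<partial>M) * (\<integral>x. g' n x \<partial>M))
    \<longlonglongrightarrow> (\<integral>x. f x * g x \<partial>M) - (\<integral>x. f x \<partial>M) * (\<integral>x. g x \<partial>M)"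
proof -
  have one: "square_integrable M (\<lambda>_. 1)" by (simp add: square_integrable_def)
  have "(\<lambda>n. (\<integral>x. f' n x * g' n x \<partial>M) - (\<integral>x. f x * g x \<partial>M)) \<longlonglongrightarrow> 0"
    by (rule inner_product_tendsto[where A="L2norm M f" and B="L2norm M g"]) (use f g F G in auto)
  then have 1: "(\<lambda>n. (\<integral>x. f' n x * g' n x \<partial>M)) \<longlonglongrightarrow> (\<integral>x. f x * g x \<partial>M)" by (rule LIM_zero_cancel)
  have z: "(\<lambda>n. L2norm M (\<lambda>x. 1 - 1)) \<longlonglongrightarrow> 0" by (simp add: L2norm_def)
  have "(\<lambda>n. (\<integral>x. f' n x * 1 \<partial>M) - (\<integral>x. f x * 1 \<partial>M)) \<longlonglongrightarrow> 0"
    by (rule inner_product_tendsto[where A="L2norm M f" and B="L2norm M (\<lambda>_. 1)"]) (use f F one z in auto)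
  then have 2: "(\<lambda>n. (\<integral>x. f' n x \<partial>M)) \<longlonglongrightarrow> (\<integral>x. f x \<partial>M)" by (simp add: LIM_zero_cancel)
  have "(\<lambda>n. (\<integral>x. g' n x * 1 \<partial>M) - (\<integral>x. g x * 1 \<partial>M)) \<longlonglongrightarrow> 0"
    by (rule inner_product_tendsto[where A="L2norm M g" and B="L2norm M (\<lambda>_. 1)"]) (use g G one z in auto)
  then have 3: "(\<lambda>n. (\<integral>x. g' n x \<partial>M)) \<longlonglongrightarrow> (\<integral>x. g x \<partial>M)" by (simp add: LIM_zero_cancel)
  show ?thesis by (intro tendsto_intros 1 2 3)
qed

section \<open>From profiles to the domain of the gradient\<close>

context poisson_cells
begin

lemma grad_measurable[measurable]:
  assumes [measurable]: "F \<in> borel_measurable P"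
  shows "grad F \<in> borel_measurable (P \<Otimes>\<^sub>M \<nu>)"
  unfolding grad_def[abs_def] by measurable

lemma cell_mean_bounded:
  fixes F :: "'a set \<Rightarrow> real"
  assumes F[measurable]: "F \<in> borel_measurable P" and bound: "\<And>\<omega>. \<bar>F \<omega>\<bar> \<le> C"
  shows "\<bar>Om.cell_mean n F k\<bar> \<le> C"
proof (cases "profile_prob n k = 0")
  case True
  then show ?thesis using bound[of "{}"] by (simp add: Om.cell_mean_def profile_prob_def)
next
  case False
  then have pos: "0 < profile_prob n k" using profile_prob_nonneg[of n k] by linarith
  let ?S = "{\<omega> \<in> space P. profile n \<omega> = k}"
  have iC: "integrable P (\<lambda>\<omega>. C * indicator ?S \<omega>)"
    by (intro integrable_mult_right integrable_real_indicator Om.cell_sets) (simp only: emeasure_profile infinity_ennreal_def ennreal_less_top)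
  have "profile_prob n k * \<bar>Om.cell_mean n F k\<bar> = \<bar>\<integral>\<omega>. F \<omega> * indicator ?S \<omega> \<partial>P\<bar>"
    unfolding cell_mean_profile[symmetric] abs_mult by simp
  also have "\<dots> \<le> (\<integral>\<omega>. C * indicator ?S \<omega> \<partial>P)"
    by (rule order_trans[OF integral_abs_bound integral_mono'[OF iC]])
      (use bound order_trans[OF abs_ge_zero bound] in \<open>auto simp: indicator_def\<close>)
  also have "\<dots> = profile_prob n k * C"
  proof -
    have "?S \<inter> space P = ?S" by blast
    then have "(\<integral>\<omega>. C * indicator ?S \<omega> \<partial>P) = C * measure P ?S"
      by (simp only: integral_mult_right_zero Bochner_Integration.integral_indicator)
    then show ?thesis by (simp only: profile_prob_def mult.commute)
  qed
  finally show ?thesis using pos by simp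
qed

lemma integral_cell:
  fixes \<phi> :: "nat \<Rightarrow> real"
  assumes "\<phi> 0 = 0"
  shows "(\<integral>y. \<phi> (cell n y) \<partial>\<nu>) = (\<Sum>i\<in>cells n. mass n i * \<phi> i)"
proof -
  have "\<phi> (cell n y) = (\<Sum>i\<in>cells n. \<phi> i * indicator (cell_set n i) y)" for y
  proof -
    have "(\<Sum>i\<in>cells n. \<phi> i * indicator (cell_set n i) y) = (\<Sum>i\<in>cells n. if i = cell n y then \<phi> i else 0)"
      by (intro sum.cong) (auto simp: cell_set_def indicator_def)
    also have "\<dots> = (if cell n y \<in> cells n then \<phi> (cell n y) else 0)" by simp
    finally show ?thesis using cell_in_cells[of n y] assms by (cases "cell n y = 0") simp_all
  qed
  then have "(\<integral>y. \<phi> (cell n y) \<partial>\<nu>) = (\<integral>y. (\<Sum>i\<in>cells n. \<phi> i * indicator (cell_set n i) y) \<partial>\<nu>)" by simp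
  also have "\<dots> = (\<Sum>i\<in>cells n. (\<integral>y. \<phi> i * indicator (cell_set n i) y \<partial>\<nu>))"
    by (intro Bochner_Integration.integral_sum integrable_mult_right integrable_real_indicator) (auto simp: emeasure_cell_set)
  also have "\<dots> = (\<Sum>i\<in>cells n. mass n i * \<phi> i)"
    by (intro sum.cong) (auto simp: mass_def mult.commute)
  finally show ?thesis .
qed

text \<open>\<open>covariance_profile\<close> for the conditional means, with the discrete gradients
  replaced by cell averages of \<open>grad F\<close> and \<open>grad G\<close> through
  \<open>cell_mean_diff\<close>. That lemma asks for profiles of positive probability, which holds
  almost surely under both marginals; cells of mass 0 contribute nothing.\<close>

lemma covariance_level:
  fixes F G :: "'a set \<Rightarrow> real"
  assumes F[measurable]: "F \<in> borel_measurable P" and bF: "\<And>\<omega>. \<bar>F \<omega>\<bar> \<le> C" and sF: "square_integrable (P \<Otimes>\<^sub>M \<nu>) (grad F)"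
    and G[measurable]: "G \<in> borel_measurable P" and bG: "\<And>\<omega>. \<bar>G \<omega>\<bar> \<le> C" and sG: "square_integrable (P \<Otimes>\<^sub>M \<nu>) (grad G)"
  shows "(\<integral>\<omega>. Om.cell_mean n F (profile n \<omega>) * Om.cell_mean n G (profile n \<omega>) \<partial>P)
      - (\<integral>\<omega>. Om.cell_mean n F (profile n \<omega>) \<partial>P) * (\<integral>\<omega>. Om.cell_mean n G (profile n \<omega>) \<partial>P)
    = pair_form (joint_measure n) \<nu> (\<lambda>x. OX.cell_mean n (grad F) (profile n (fst x), cell n (snd x)))
        (\<lambda>x. OX.cell_mean n (grad G) (profile n (fst x), cell n (snd x)))" (is "_ = pair_form _ _ ?u ?v")
proof -
  interpret Q: self_coupling P "joint_measure n" by (rule self_coupling_joint)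
  let ?f = "Om.cell_mean n F" and ?g = "Om.cell_mean n G"
  let ?h = "\<lambda>p. \<Sum>i\<in>cells n. mass n i * (?f (add_mset i (fst p)) - ?f (fst p)) * (?g (add_mset i (snd p)) - ?g (snd p))"
  note Fub = Q.pair_form_Fubini[OF N.sigma_finite_measure_axioms OX.cell_mean_square_integrable(1)[OF sF, of n] OX.cell_mean_square_integrable(1)[OF sG, of n]]
  have "pair_form (joint_measure n) \<nu> ?u ?v = (\<integral>x. (\<integral>y. ?u (fst x, y) * ?v (snd x, y) \<partial>\<nu>) \<partial>joint_measure n)"
    by (rule Fub(1))
  also have "\<dots> = (\<integral>x. ?h (profile n (fst x), profile n (snd x)) \<partial>joint_measure n)"
  proof (rule integral_cong_AE)
    show "(\<lambda>x. \<integral>y. ?u (fst x, y) * ?v (snd x, y) \<partial>\<nu>) \<in> borel_measurable (joint_measure n)"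
      using Fub(2) by (rule borel_measurable_integrable)
    show "(\<lambda>x. ?h (profile n (fst x), profile n (snd x))) \<in> borel_measurable (joint_measure n)"
      using borel_measurable_profiles[of ?h n] by (simp cong: measurable_cong_sets)
    show "AE x in joint_measure n. (\<integral>y. ?u (fst x, y) * ?v (snd x, y) \<partial>\<nu>) = ?h (profile n (fst x), profile n (snd x))"
      using Q.AE_fst[OF AE_profile_pos[of n]] Q.AE_snd[OF AE_profile_pos[of n]]
    proof eventually_elim
      case (elim x)
      let ?a = "profile n (fst x)" and ?b = "profile n (snd x)"
      have "(\<integral>y. ?u (fst x, y) * ?v (snd x, y) \<partial>\<nu>) = (\<Sum>i\<in>cells n. mass n i * (OX.cell_mean n (grad F) (?a, i) * OX.cell_mean n (grad G) (?b, i)))"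
        using integral_cell[of "\<lambda>i. OX.cell_mean n (grad F) (?a, i) * OX.cell_mean n (grad G) (?b, i)" n] by (simp add: OX.cell_mean_def)
      also have "\<dots> = ?h (?a, ?b)"
      proof (intro sum.cong refl)
        fix i assume i: "i \<in> cells n"
        show "mass n i * (OX.cell_mean n (grad F) (?a, i) * OX.cell_mean n (grad G) (?b, i)) =
          mass n i * (?f (add_mset i (fst (?a, ?b))) - ?f (fst (?a, ?b))) * (?g (add_mset i (snd (?a, ?b))) - ?g (snd (?a, ?b)))"
        proof (cases "mass n i = 0")
          case False
          have "OX.cell_mean n (grad F) (?a, i) = ?f (add_mset i ?a) - ?f ?a"
            using cell_mean_diff[OF F bF i elim(1) False] by (simp add: grad_def[abs_def])
          moreover have "OX.cell_mean n (grad G) (?b, i) = ?g (add_mset i ?b) - ?g ?b"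
            using cell_mean_diff[OF G bG i elim(2) False] by (simp add: grad_def[abs_def])
          ultimately show ?thesis by simp
        qed simp
      qed
      finally show ?case .
    qed
  qed
  also have "\<dots> = (\<integral>\<omega>. ?f (profile n \<omega>) * ?g (profile n \<omega>) \<partial>P) - (\<integral>\<omega>. ?f (profile n \<omega>) \<partial>P) * (\<integral>\<omega>. ?g (profile n \<omega>) \<partial>P)"
    using covariance_profile[of ?f C ?g n, OF cell_mean_bounded[OF F bF] cell_mean_bounded[OF G bG]] by simp
  finally show ?thesis by simp
qed

text \<open>The covariances of the conditional means tend to the covariance, and they equal the
  forms of the averaged gradients. The latter are asymptotic to the forms of \<open>grad F\<close>
  and \<open>grad G\<close> by L2 convergence.\<close>

lemma covariance_bounded_tendsto:
  fixes F G :: "'a set \<Rightarrow> real"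
  assumes F[measurable]: "F \<in> borel_measurable P" and bF: "\<And>\<omega>. \<bar>F \<omega>\<bar> \<le> C" and sF: "square_integrable (P \<Otimes>\<^sub>M \<nu>) (grad F)"
    and G[measurable]: "G \<in> borel_measurable P" and bG: "\<And>\<omega>. \<bar>G \<omega>\<bar> \<le> C" and sG: "square_integrable (P \<Otimes>\<^sub>M \<nu>) (grad G)"
  shows "(\<lambda>n. pair_form (joint_measure n) \<nu> (grad F) (grad G)) \<longlonglongrightarrow> (\<integral>\<omega>. F \<omega> * G \<omega> \<partial>P) - (\<integral>\<omega>. F \<omega> \<partial>P) * (\<integral>\<omega>. G \<omega> \<partial>P)"
proof -
  have si: "square_integrable P F'" if "F' \<in> borel_measurable P" "\<And>\<omega>. \<bar>F' \<omega>\<bar> \<le> C" for F' :: "'a set \<Rightarrow> real"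
  proof -
    have "(F' \<omega>)\<^sup>2 \<le> C\<^sup>2" for \<omega> using that(2)[of \<omega>] abs_le_square_iff[of "F' \<omega>" C] by linarith
    then have "integrable P (\<lambda>\<omega>. (F' \<omega>)\<^sup>2)" using that(1) by (intro P.integrable_const_bound[of _ "C\<^sup>2"]) auto
    then show ?thesis using that by (simp add: square_integrable_def)
  qed
  note siF = si[OF F bF] and siG = si[OF G bG]
  let ?c = "\<lambda>n. (\<integral>\<omega>. Om.cell_mean n F (profile n \<omega>) * Om.cell_mean n G (profile n \<omega>) \<partial>P)
      - (\<integral>\<omega>. Om.cell_mean n F (profile n \<omega>) \<partial>P) * (\<integral>\<omega>. Om.cell_mean n G (profile n \<omega>) \<partial>P)"
  have c: "?c \<longlonglongrightarrow> (\<integral>\<omega>. F \<omega> * G \<omega> \<partial>P) - (\<integral>\<omega>. F \<omega> \<partial>P) * (\<integral>\<omega>. G \<omega> \<partial>P)"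
    by (intro P.covariance_tendsto siF siG Om.cell_mean_square_integrable)
  have "(\<lambda>n. ?c n - pair_form (joint_measure n) \<nu> (grad F) (grad G)) \<longlonglongrightarrow> 0"
    unfolding covariance_level[OF assms]
    by (intro pair_form_tendsto[OF self_coupling_joint N.sigma_finite_measure_axioms] sF sG OX.cell_mean_square_integrable)
  from tendsto_diff[OF c this] show ?thesis by simp
qed

text \<open>The covariance is a limit of forms of the untruncated gradients under absolutely
  continuous couplings, and each such form is at most \<open>c\<close> times the mean of
  \<open>w\<close>, since the first marginal is \<open>P\<close>.\<close>

lemma covariance_le:
  fixes F G w :: "'a set \<Rightarrow> real"
  assumes F: "F \<in> dom_diff \<nu> P" and G: "G \<in> dom_diff \<nu> P" and w: "integrable P w"
    and bound: "AE x in P \<Otimes>\<^sub>M P. (\<integral>y. grad G (fst x, y) * grad F (snd x, y) \<partial>\<nu>) \<le> c * w (fst x)"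
  shows "(\<integral>\<omega>. F \<omega> * G \<omega> \<partial>P) - (\<integral>\<omega>. F \<omega> \<partial>P) * (\<integral>\<omega>. G \<omega> \<partial>P) \<le> c * (\<integral>\<omega>. w \<omega> \<partial>P)"
proof -
  define tr where "tr H m \<omega> = truncate (real m) (H \<omega>)" for H :: "'a set \<Rightarrow> real" and m \<omega>
  have trm: "tr H m \<in> borel_measurable P" if "H \<in> borel_measurable P" for H m
    unfolding tr_def using measurable_compose[OF that truncate_measurable] by simp
  have tr: "square_integrable P (tr H m)" "(\<lambda>m. L2norm P (\<lambda>x. tr H m x - H x)) \<longlonglongrightarrow> 0"
    "square_integrable (P \<Otimes>\<^sub>M \<nu>) (grad (tr H m))" "(\<lambda>m. L2norm (P \<Otimes>\<^sub>M \<nu>) (\<lambda>x. grad (tr H m) x - grad H x)) \<longlonglongrightarrow> 0"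
    if H: "H \<in> dom_diff \<nu> P" for H m
  proof -
    have s: "square_integrable P H" "square_integrable (P \<Otimes>\<^sub>M \<nu>) (grad H)" using H by (simp_all add: dom_diff_iff)
    note Hm = trm[OF square_integrable_measurable[OF s(1)]]
    have d: "\<bar>tr H m x\<bar> \<le> \<bar>H x\<bar>" "(\<lambda>m. tr H m x) \<longlonglongrightarrow> H x" for m x
      by (simp_all add: tr_def truncate_bounds truncate_tendsto)
    have e: "\<bar>grad (tr H m) x\<bar> \<le> \<bar>grad H x\<bar>" "(\<lambda>m. grad (tr H m) x) \<longlonglongrightarrow> grad H x" for m x
      by (simp_all add: grad_def tr_def truncate_bounds truncate_tendsto tendsto_diff)
    show "square_integrable P (tr H m)" "(\<lambda>m. L2norm P (\<lambda>x. tr H m x - H x)) \<longlonglongrightarrow> 0"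
      by (rule L2_dominated[OF s(1) Hm d])+
    show "square_integrable (P \<Otimes>\<^sub>M \<nu>) (grad (tr H m))" "(\<lambda>m. L2norm (P \<Otimes>\<^sub>M \<nu>) (\<lambda>x. grad (tr H m) x - grad H x)) \<longlonglongrightarrow> 0"
      by (rule L2_dominated[OF s(2) grad_measurable[OF Hm] e])+
  qed
  have sF: "square_integrable P F" "square_integrable (P \<Otimes>\<^sub>M \<nu>) (grad F)"
    and sG: "square_integrable P G" "square_integrable (P \<Otimes>\<^sub>M \<nu>) (grad G)" using F G by (simp_all add: dom_diff_iff)
  let ?C = "(\<integral>\<omega>. G \<omega> * F \<omega> \<partial>P) - (\<integral>\<omega>. G \<omega> \<partial>P) * (\<integral>\<omega>. F \<omega> \<partial>P)"
  define cv where "cv m = (\<integral>\<omega>. tr G m \<omega> * tr F m \<omega> \<partial>P) - (\<integral>\<omega>. tr G m \<omega> \<partial>P) * (\<integral>\<omega>. tr F m \<omega> \<partial>P)" for m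
  have cv: "cv \<longlonglongrightarrow> ?C" unfolding cv_def
    by (rule P.covariance_tendsto[OF sG(1) tr(1,2)[OF G] sF(1) tr(1,2)[OF F]])
  \<comment> \<open>Bounded functions are required for the covariance limit, hence the truncation at
    height \<open>m\<close>. For each \<open>m\<close> a level is then chosen at which the form is
    within 1 / (m + 1) of the truncated covariance.\<close>
  have "\<exists>n. \<bar>pair_form (joint_measure n) \<nu> (grad (tr G m)) (grad (tr F m)) - cv m\<bar> < 1 / real (Suc m)" for m
  proof -
    have "(\<lambda>n. pair_form (joint_measure n) \<nu> (grad (tr G m)) (grad (tr F m))) \<longlonglongrightarrow> cv m"
      unfolding cv_def
      by (rule covariance_bounded_tendsto[OF trm _ tr(3)[OF G] trm _ tr(3)[OF F], where C="real m"])
        (auto simp: tr_def truncate_bounds square_integrable_measurable[OF sF(1)] square_integrable_measurable[OF sG(1)])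
    from LIMSEQ_D[OF this, of "1 / real (Suc m)"] show ?thesis by (auto simp: real_norm_def)
  qed
  then obtain \<kappa> where \<kappa>: "\<And>m. \<bar>pair_form (joint_measure (\<kappa> m)) \<nu> (grad (tr G m)) (grad (tr F m)) - cv m\<bar> < 1 / real (Suc m)" by metis
  have "(\<lambda>m. pair_form (joint_measure (\<kappa> m)) \<nu> (grad (tr G m)) (grad (tr F m)) - cv m) \<longlonglongrightarrow> 0"
    by (rule tendsto_0_le[where K=1, OF lim_inverse_n'[THEN LIMSEQ_Suc]]) (use \<kappa> in \<open>auto intro!: always_eventually less_imp_le\<close>)
  from tendsto_add[OF this cv] have 1: "(\<lambda>m. pair_form (joint_measure (\<kappa> m)) \<nu> (grad (tr G m)) (grad (tr F m))) \<longlonglongrightarrow> ?C" by simp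
  \<comment> \<open>The truncation is undone along the diagonal sequence of couplings. This precedes
    the estimate because \<open>bound\<close> concerns the original gradients.\<close>
  have "(\<lambda>m. pair_form (joint_measure (\<kappa> m)) \<nu> (grad (tr G m)) (grad (tr F m)) - pair_form (joint_measure (\<kappa> m)) \<nu> (grad G) (grad F)) \<longlonglongrightarrow> 0"
    by (rule pair_form_tendsto[OF self_coupling_joint N.sigma_finite_measure_axioms sG(2) sF(2) tr(3)[OF G] tr(3)[OF F] tr(4)[OF G] tr(4)[OF F]])
  from tendsto_diff[OF 1 this] have 2: "(\<lambda>m. pair_form (joint_measure (\<kappa> m)) \<nu> (grad G) (grad F)) \<longlonglongrightarrow> ?C" by simp
  have "pair_form (joint_measure n) \<nu> (grad G) (grad F) \<le> c * (\<integral>\<omega>. w \<omega> \<partial>P)" for n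
  proof -
    interpret Q: self_coupling P "joint_measure n" by (rule self_coupling_joint)
    note Fub = Q.pair_form_Fubini[OF N.sigma_finite_measure_axioms sG(2) sF(2)]
    have wm[measurable]: "w \<in> borel_measurable P" using w by simp
    have wi: "integrable (joint_measure n) (\<lambda>x. w (fst x))"
      using integrable_distr_eq[OF Q.measurable_fst_Q wm] w unfolding Q.distr_fst by simp
    have wv: "(\<integral>x. w (fst x) \<partial>joint_measure n) = (\<integral>\<omega>. w \<omega> \<partial>P)"
      using integral_distr[OF Q.measurable_fst_Q wm] unfolding Q.distr_fst by simp
    have "pair_form (joint_measure n) \<nu> (grad G) (grad F) = (\<integral>x. (\<integral>y. grad G (fst x, y) * grad F (snd x, y) \<partial>\<nu>) \<partial>joint_measure n)"
      by (rule Fub(1))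
    also have "\<dots> \<le> (\<integral>x. c * w (fst x) \<partial>joint_measure n)"
    proof (rule integral_mono_AE[OF Fub(2)])
      show "integrable (joint_measure n) (\<lambda>x. c * w (fst x))" using wi by simp
      \<comment> \<open>Here absolute continuity transfers the bound from
        \<open>P \<Otimes>\<^sub>M P\<close> to the coupling.\<close>
      show "AE x in joint_measure n. (\<integral>y. grad G (fst x, y) * grad F (snd x, y) \<partial>\<nu>) \<le> c * w (fst x)"
        by (rule absolutely_continuous_AE[OF Q.sets_Q Q.abs_cont bound])
    qed
    also have "\<dots> = c * (\<integral>\<omega>. w \<omega> \<partial>P)" using wv by simp
    finally show ?thesis .
  qed
  then have "?C \<le> c * (\<integral>\<omega>. w \<omega> \<partial>P)" by (intro LIMSEQ_le_const2[OF 2]) auto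
  then show ?thesis by (simp add: mult.commute)
qed

end

section \<open>Deviation bounds from the moment generating function\<close>

text \<open>Square integrability of \<open>F\<close> and of \<open>exp (t0 * F)\<close> makes
  \<open>\<bar>F\<bar> * (1 + exp (t0 * F))\<close> integrable, a common dominating function for the
  difference quotients of \<open>exp (s * F)\<close> on the whole closed interval.\<close>

locale exp_moment = prob_space M for M :: "'w measure" +
  fixes F :: "'w \<Rightarrow> real" and t0 :: real
  assumes F_L2: "square_integrable M F" and t0: "0 < t0" and exp_L2: "square_integrable M (\<lambda>x. exp (t0 * F x))"
begin

lemma F_measurable[measurable]: "F \<in> borel_measurable M"
  by (rule square_integrable_measurable[OF F_L2])

lemma one_L2: "square_integrable M (\<lambda>_. 1)"
  by (simp add: square_integrable_def)

lemma exp_le: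
  assumes "0 \<le> s" "s \<le> t0"
  shows "exp (s * y) \<le> 1 + exp (t0 * y)"
proof (cases "0 \<le> y")
  case True
  then have "s * y \<le> t0 * y" using assms by (intro mult_right_mono)
  then show ?thesis by (simp add: add_increasing)
next
  case False
  then have "exp (s * y) \<le> 1" using assms by (simp add: mult_nonneg_nonpos)
  then show ?thesis by (simp add: add_increasing2)
qed

lemma dominating: "integrable M (\<lambda>x. \<bar>F x\<bar> * (1 + exp (t0 * F x)))"
proof -
  have "square_integrable M (\<lambda>x. \<bar>F x\<bar>)" using F_L2 by (simp add: square_integrable_def)
  from square_integrable_mult[OF this square_integrable_add[OF one_L2 exp_L2]] show ?thesis .
qed

lemma integrable_exp:
  assumes "s \<in> {0..t0}"
  shows "integrable M (\<lambda>x. exp (s * F x))"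
proof (rule Bochner_Integration.integrable_bound)
  show "integrable M (\<lambda>x. 1 + exp (t0 * F x))" using square_integrable_mult[OF exp_L2 one_L2] by simp
  show "AE x in M. norm (exp (s * F x)) \<le> norm (1 + exp (t0 * F x))"
    using exp_le[of s] assms by (intro AE_I2) (simp add: add_pos_pos)
qed measurable

definition mgf :: "real \<Rightarrow> real" where "mgf s = (\<integral>x. exp (s * F x) \<partial>M)"

definition mgf' :: "real \<Rightarrow> real" where "mgf' s = (\<integral>x. F x * exp (s * F x) \<partial>M)"

lemma mgf_pos: "s \<in> {0..t0} \<Longrightarrow> 0 < mgf s"
  unfolding mgf_def by (rule expectation_greater[OF integrable_exp]) auto

text \<open>Convexity in the form \<open>1 + x \<le> exp x\<close> replaces the mean value theorem.
  The last factor does not depend on \<open>s\<close> and \<open>u\<close>.\<close>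

lemma exp_diff_le:
  assumes "s \<in> {0..t0}" "u \<in> {0..t0}"
  shows "\<bar>exp (u * y) - exp (s * y)\<bar> \<le> \<bar>u - s\<bar> * (\<bar>y\<bar> * (1 + exp (t0 * y)))"
proof -
  have *: "\<bar>exp a - exp b\<bar> \<le> \<bar>a - b\<bar> * max (exp a) (exp b)" for a b :: real
  proof -
    have le: "exp a - exp b \<le> (a - b) * exp a" for a b :: real
    proof -
      have "exp a * (1 + (b - a)) \<le> exp a * exp (b - a)" by (intro mult_left_mono) simp_all
      also have "\<dots> = exp b" by (simp flip: exp_add)
      finally show ?thesis by (simp add: algebra_simps)
    qed
    show ?thesis using le[of a b] le[of b a] by (cases "b \<le> a") (auto simp: max_def abs_if)
  qed
  have "\<bar>exp (u * y) - exp (s * y)\<bar> \<le> \<bar>u * y - s * y\<bar> * max (exp (u * y)) (exp (s * y))" by (rule *)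
  also have "\<dots> \<le> \<bar>u * y - s * y\<bar> * (1 + exp (t0 * y))"
    using exp_le[of u y] exp_le[of s y] assms by (intro mult_left_mono) auto
  also have "\<bar>u * y - s * y\<bar> = \<bar>u - s\<bar> * \<bar>y\<bar>" by (simp add: abs_mult[symmetric] left_diff_distrib)
  finally show ?thesis by (simp add: mult.assoc)
qed

lemma mgf_deriv:
  assumes s: "s \<in> {0..t0}"
  shows "(mgf has_real_derivative mgf' s) (at s within {0..t0})"
  unfolding has_field_derivative_iff tendsto_at_iff_sequentially
proof (intro allI impI)
  fix X assume X: "\<forall>i. X i \<in> {0..t0} - {s}" and lim: "X \<longlonglongrightarrow> s"
  have eq: "(mgf (X i) - mgf s) / (X i - s) = (\<integral>x. (exp (X i * F x) - exp (s * F x)) / (X i - s) \<partial>M)" for i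
    unfolding mgf_def using integrable_exp[of "X i"] integrable_exp[OF s] X by simp
  have "(\<lambda>i. \<integral>x. (exp (X i * F x) - exp (s * F x)) / (X i - s) \<partial>M) \<longlonglongrightarrow> mgf' s"
    unfolding mgf'_def
  proof (rule integral_dominated_convergence[OF _ _ dominating])
    show "AE x in M. (\<lambda>i. (exp (X i * F x) - exp (s * F x)) / (X i - s)) \<longlonglongrightarrow> F x * exp (s * F x)"
    proof (intro AE_I2)
      fix x
      have "((\<lambda>u. exp (u * F x)) has_real_derivative F x * exp (s * F x)) (at s within {0..t0})"
        by (auto intro!: derivative_eq_intros)
      then show "(\<lambda>i. (exp (X i * F x) - exp (s * F x)) / (X i - s)) \<longlonglongrightarrow> F x * exp (s * F x)"
        unfolding has_field_derivative_iff tendsto_at_iff_sequentially using X lim by (auto simp: comp_def)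
    qed
    show "AE x in M. norm ((exp (X i * F x) - exp (s * F x)) / (X i - s)) \<le> \<bar>F x\<bar> * (1 + exp (t0 * F x))" for i
    proof (intro AE_I2)
      fix x
      have "X i - s \<noteq> 0" using X by auto
      then show "norm ((exp (X i * F x) - exp (s * F x)) / (X i - s)) \<le> \<bar>F x\<bar> * (1 + exp (t0 * F x))"
        using exp_diff_le[OF s, of "X i" "F x"] X by (auto simp: abs_divide divide_le_eq mult.commute)
    qed
  qed measurable
  then show "((\<lambda>y. (mgf y - mgf s) / (y - s)) \<circ> X) \<longlonglongrightarrow> mgf' s" by (simp add: comp_def eq)
qed

lemma mgf'_continuous: "continuous_on {0..t0} mgf'"
proof (rule continuous_on_sequentiallyI)
  fix u a assume u: "\<forall>n. u n \<in> {0..t0}" and lim: "u \<longlonglongrightarrow> a"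
  show "(\<lambda>n. mgf' (u n)) \<longlonglongrightarrow> mgf' a"
    unfolding mgf'_def
  proof (rule integral_dominated_convergence[OF _ _ dominating])
    show "AE x in M. (\<lambda>n. F x * exp (u n * F x)) \<longlonglongrightarrow> F x * exp (a * F x)"
      by (intro AE_I2 tendsto_intros lim)
    show "AE x in M. norm (F x * exp (u n * F x)) \<le> \<bar>F x\<bar> * (1 + exp (t0 * F x))" for n
      using exp_le[of "u n"] u by (intro AE_I2) (auto simp: abs_mult intro!: mult_left_mono)
  qed measurable
qed

lemma mgf_continuous: "continuous_on {0..t0} mgf"
  using mgf_deriv by (intro DERIV_continuous_on)

text \<open>No measurability of \<open>h\<close> is assumed: the integral on the right is then a lower integral.\<close>

lemma ln_mgf_le:
  assumes h: "\<And>s. s \<in> {0..<t0} \<Longrightarrow> ennreal (mgf' s / mgf s - expectation F) \<le> h s" and t: "t \<in> {0..<t0}"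
  shows "ennreal (ln (mgf t) - t * expectation F) \<le> (\<integral>\<^sup>+ s\<in>{0..t}. h s \<partial>lborel)"
proof -
  let ?g = "\<lambda>s. mgf' s / mgf s - expectation F" and ?L = "\<lambda>s. ln (mgf s) - s * expectation F"
  have sub: "{0..t} \<subseteq> {0..t0}" using t by auto
  have d: "(?L has_vector_derivative ?g s) (at s within {0..t})" if "0 \<le> s" "s \<le> t" for s
  proof -
    have "(mgf has_real_derivative mgf' s) (at s within {0..t})"
      using mgf_deriv[of s] that t by (intro DERIV_subset[OF _ sub]) auto
    moreover have "0 < mgf s" using mgf_pos[of s] that t by auto
    ultimately have "(?L has_real_derivative ?g s) (at s within {0..t})"
      by (auto intro!: derivative_eq_intros simp: divide_inverse)
    then show ?thesis by (simp add: has_real_derivative_iff_has_vector_derivative)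
  qed
  have cont: "continuous_on {0..t} ?g"
    using mgf_pos by (intro continuous_intros continuous_on_subset[OF mgf'_continuous sub] continuous_on_subset[OF mgf_continuous sub])
      (use t in force)
  have bi: "has_bochner_integral lborel (\<lambda>s. indicator {0..t} s *\<^sub>R ?g s) (?L t - ?L 0)"
    by (rule has_bochner_integral_FTC_Icc[OF _ d cont]) (use t in auto)
  let ?u = "\<lambda>s. indicator {0..t} s *\<^sub>R ?g s"
  have int: "integrable lborel ?u" using bi by (rule integrable.intros)
  have "?L 0 = 0" by (simp add: mgf_def prob_space)
  then have "?L t = (\<integral>s. ?u s \<partial>lborel)" using has_bochner_integral_integral_eq[OF bi] by simp
  \<comment> \<open>The positive part is taken because \<open>ennreal\<close> maps negative numbers
    to 0, so that \<open>h\<close> controls just this part.\<close>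
  also have "\<dots> \<le> (\<integral>s. max 0 (?u s) \<partial>lborel)" using int by (intro integral_mono) auto
  finally have "ennreal (?L t) \<le> ennreal (\<integral>s. max 0 (?u s) \<partial>lborel)" by (rule ennreal_leI)
  also have "\<dots> = (\<integral>\<^sup>+s. ennreal (max 0 (?u s)) \<partial>lborel)"
    using int by (intro nn_integral_eq_integral[symmetric]) auto
  also have "\<dots> \<le> (\<integral>\<^sup>+ s\<in>{0..t}. h s \<partial>lborel)"
  proof (intro nn_integral_mono)
    fix s :: real
    show "ennreal (max 0 (?u s)) \<le> h s * indicator {0..t} s"
    proof (cases "s \<in> {0..t}")
      case True
      then have "ennreal (?g s) \<le> h s" using h t by auto
      then show ?thesis using True by (auto simp: max_def)
    qed simp
  qed
  finally show ?thesis .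
qed

lemma chernoff:
  assumes t: "t \<in> {0..t0}"
  shows "prob {x \<in> space M. y \<le> F x - expectation F} \<le> exp (ln (mgf t) - t * expectation F - t * y)"
proof -
  let ?S = "{x \<in> space M. y \<le> F x - expectation F}" and ?e = "exp (t * (y + expectation F))"
  have S[measurable]: "?S \<in> events" by measurable
  have "?e * prob ?S = (\<integral>x. ?e * indicator ?S x \<partial>M)" using S by (simp add: Int_absorb2)
  also have "\<dots> \<le> mgf t" unfolding mgf_def
  proof (rule integral_mono[OF _ integrable_exp[OF t]])
    show "integrable M (\<lambda>x. ?e * indicator ?S x)"
      by (intro integrable_mult_right integrable_real_indicator S) (simp add: less_top[symmetric])
    fix x assume "x \<in> space M"
    show "?e * indicator ?S x \<le> exp (t * F x)" using t by (auto simp: indicator_def intro!: mult_left_mono)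
  qed
  finally have "prob ?S \<le> mgf t / ?e" by (simp add: pos_le_divide_eq mult.commute)
  also have "\<dots> = exp (ln (mgf t) - t * expectation F - t * y)"
    using mgf_pos[OF t] by (simp add: exp_diff exp_add field_simps)
  finally show ?thesis .
qed

end

section \<open>Optimizing the exponential bound\<close>

lemma le_exp_ereal:
  assumes "0 < p" "ereal (ln p) \<le> y"
  shows "ereal p \<le> exp_ereal y"
proof (cases y)
  case (real r)
  have "p = exp (ln p)" using assms by simp
  also have "\<dots> \<le> exp r" using assms(2) real by simp
  finally show ?thesis using real by (simp add: exp_ereal_def)
qed (use assms in \<open>auto simp: exp_ereal_def\<close>)

lemma exp_ereal_nonneg: "0 \<le> exp_ereal y"
  by (cases y) (auto simp: exp_ereal_def)

lemma (in exp_moment) deviation_INF: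
  assumes h: "\<And>s. s \<in> {0..<t0} \<Longrightarrow> ennreal (mgf' s / mgf s - expectation F) \<le> h s"
  shows "ereal (prob {x \<in> space M. y \<le> F x - expectation F})
    \<le> exp_ereal (INF t\<in>{0<..<t0}. enn2ereal (\<integral>\<^sup>+ s\<in>{0..t}. h s \<partial>lborel) - ereal (t * y))"
\<comment> \<open>Logarithms are compared below, so probability 0 is treated apart, by nonnegativity
  of \<open>exp_ereal\<close>.\<close>
proof (cases "prob {x \<in> space M. y \<le> F x - expectation F} = 0")
  case True
  then show ?thesis using exp_ereal_nonneg by (simp flip: zero_ereal_def)
next
  case False
  let ?p = "prob {x \<in> space M. y \<le> F x - expectation F}"
  have p: "0 < ?p" using False measure_nonneg[of M] by (metis order_le_less)
  show ?thesis
  proof (rule le_exp_ereal[OF p], rule INF_greatest)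
    fix t assume t: "t \<in> {0<..<t0}"
    let ?L = "ln (mgf t) - t * expectation F"
    have "ln ?p \<le> ln (exp (?L - t * y))"
      using chernoff[of t y] p t by (intro iffD2[OF ln_le_cancel_iff]) auto
    then have "ln ?p \<le> ?L - t * y" by simp
    moreover have "ereal ?L \<le> enn2ereal (\<integral>\<^sup>+ s\<in>{0..t}. h s \<partial>lborel)"
    proof -
      have "ereal ?L \<le> ereal (max 0 ?L)" by simp
      also have "\<dots> = enn2ereal (ennreal (max 0 ?L))" by (rule enn2ereal_ennreal[symmetric]) simp
      also have "\<dots> = enn2ereal (ennreal ?L)" by (cases "0 \<le> ?L") (auto simp: max_def ennreal_neg)
      also have "\<dots> \<le> enn2ereal (\<integral>\<^sup>+ s\<in>{0..t}. h s \<partial>lborel)"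
        using ln_mgf_le[OF h, of t] t by (simp add: less_eq_ennreal.rep_eq)
      finally show ?thesis .
    qed
    then have "ereal ?L - ereal (t * y) \<le> enn2ereal (\<integral>\<^sup>+ s\<in>{0..t}. h s \<partial>lborel) - ereal (t * y)"
      by (intro ereal_minus_mono) auto
    ultimately show "ereal (ln ?p) \<le> enn2ereal (\<integral>\<^sup>+ s\<in>{0..t}. h s \<partial>lborel) - ereal (t * y)"
      by (metis (no_types, lifting) ereal_less_eq(3) ereal_minus(1) order_trans)
  qed
qed

text \<open>The left limit of a monotone function is its supremum. The lemma guarantees that the
  infimum in \<open>left_inverse\<close> is over a nonempty set.\<close>

lemma left_limit_exceeds:
  fixes h :: "real \<Rightarrow> ennreal"
  assumes t0: "0 < t0" and mono: "mono_on {0..<t0} h" and a: "a < Lim (at_left t0) h"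
  shows "\<exists>t. 0 < t \<and> t < t0 \<and> a \<le> h t"
proof (rule ccontr)
  assume "\<not> (\<exists>t. 0 < t \<and> t < t0 \<and> a \<le> h t)"
  then have below: "h t < a" if "0 < t" "t < t0" for t using that by (meson not_le)
  let ?S = "SUP t\<in>{0<..<t0}. h t"
  have near: "eventually (\<lambda>t. s < t \<and> t < t0) (at_left t0)" if "s < t0" for s
    using eventually_at_left_real[OF that] by (simp add: greaterThanLessThan_def)
  have "(h \<longlongrightarrow> ?S) (at_left t0)"
  proof (rule order_tendstoI)
    fix b assume "b < ?S"
    then obtain s where s: "0 < s" "s < t0" "b < h s" by (auto simp: less_SUP_iff)
    show "eventually (\<lambda>t. b < h t) (at_left t0)"
      using near[OF s(2)]
    proof eventually_elim
      case (elim t)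
      then have "h s \<le> h t" using s by (intro mono_onD[OF mono]) auto
      then show ?case using s(3) by simp
    qed
  next
    fix b assume b: "?S < b"
    show "eventually (\<lambda>t. h t < b) (at_left t0)"
      using near[OF t0]
    proof eventually_elim
      case (elim t)
      then have "h t \<le> ?S" by (intro SUP_upper) auto
      then show ?case using b by simp
    qed
  qed
  then have "Lim (at_left t0) h = ?S" by (intro tendsto_Lim) auto
  also have "\<dots> \<le> a" using below by (intro SUP_least) (auto intro: less_imp_le)
  finally show False using a by simp
qed

text \<open>Comparison of the areas cut out by the graph of \<open>h\<close> in the rectangle
  \<open>[0, h\<^sup>-\<^sup>1(x)] \<times> [0, x]\<close>.\<close>

lemma left_inverse_area:
  fixes h :: "real \<Rightarrow> ennreal"
  assumes mono: "mono_on {0..<t0} h" and fin: "\<And>s. s \<in> {0..<t0} \<Longrightarrow> h s < \<infinity>"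
    and x: "0 < x" and ex: "\<exists>t. 0 < t \<and> t < t0 \<and> ennreal x \<le> h t"
  defines "t \<equiv> left_inverse t0 h x"
  shows "t \<in> {0..<t0}"
    and "\<And>z. z \<in> {0..x} \<Longrightarrow> 0 \<le> left_inverse t0 h z"
    and "(\<integral>\<^sup>+z\<in>{0..x}. ennreal (left_inverse t0 h z) \<partial>lborel) + (\<integral>\<^sup>+s\<in>{0..t}. h s \<partial>lborel) \<le> ennreal (t * x)"
proof -
  let ?T = "\<lambda>z. {t. 0 < t \<and> t < t0 \<and> ennreal z \<le> h t}"
  obtain t1 where t1: "0 < t1" "t1 < t0" "ennreal x \<le> h t1" using ex by blast
  have bdd: "bdd_below (?T z)" for z by (intro bdd_belowI[of _ 0]) auto
  have ne: "?T z \<noteq> {}" if "z \<le> x" for z using t1 ennreal_leI[OF that] by (auto intro: order_trans)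
  have low: "0 \<le> left_inverse t0 h z" if "z \<le> x" for z
    unfolding left_inverse_def using ne[OF that] by (intro cInf_greatest) auto
  then show "\<And>z. z \<in> {0..x} \<Longrightarrow> 0 \<le> left_inverse t0 h z" by simp
  have up: "left_inverse t0 h z \<le> t" if "z \<le> x" for z
    unfolding t_def left_inverse_def
    by (intro cInf_superset_mono ne bdd) (use ennreal_leI[OF that] in \<open>auto intro: order_trans\<close>)
  have "t \<le> t1" unfolding t_def left_inverse_def using t1 by (intro cInf_lower bdd) auto
  then show t: "t \<in> {0..<t0}" using low[of x] t1 by (auto simp: t_def)
  have below: "h s < ennreal z" if "0 < s" "s < left_inverse t0 h z" "z \<le> x" for s z
  proof (rule ccontr)
    assume "\<not> h s < ennreal z"
    then have "s \<in> ?T z" using that up[of z] t by auto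
    then have "left_inverse t0 h z \<le> s" unfolding left_inverse_def by (rule cInf_lower[OF _ bdd])
    then show False using that by simp
  qed
  \<comment> \<open>Clipping the argument to [0, t] gives a real monotone function on the whole
    line, which is therefore Borel measurable.\<close>
  define g where "g s = enn2real (h (max 0 (min s t)))" for s
  have clip: "max 0 (min s t) \<in> {0..<t0}" for s using t by auto
  have hg: "h (max 0 (min s t)) = ennreal (g s)" for s using fin[OF clip[of s]] by (simp add: g_def)
  have "mono g"
  proof (rule monoI)
    fix r s :: real assume "r \<le> s"
    then have "h (max 0 (min r t)) \<le> h (max 0 (min s t))" using clip by (intro mono_onD[OF mono]) auto
    then show "g r \<le> g s" unfolding g_def using fin[OF clip] by (intro enn2real_mono) auto
  qed
  then have [measurable]: "g \<in> borel_measurable borel" by (rule borel_measurable_mono)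
  have g0: "0 \<le> g s" for s by (simp add: g_def)
  have "(\<integral>\<^sup>+z\<in>{0..x}. ennreal (left_inverse t0 h z) \<partial>lborel) = (\<integral>\<^sup>+z. (\<integral>\<^sup>+s. indicator {0..x} z * indicator {0<..<left_inverse t0 h z} s \<partial>lborel) \<partial>lborel)"
  proof (intro nn_integral_cong)
    fix z :: real
    show "ennreal (left_inverse t0 h z) * indicator {0..x} z = (\<integral>\<^sup>+s. indicator {0..x} z * indicator {0<..<left_inverse t0 h z} s \<partial>lborel)"
      using low[of z] by (cases "z \<in> {0..x}") simp_all
  qed
  \<comment> \<open>If s lies below the inverse at z, then \<open>g s < z\<close> by
    \<open>below\<close>. So the region left of the inverse lies in the part of the rectangle above
    the graph of \<open>g\<close>; Tonelli then measures this part by vertical sections of length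
    \<open>x - g s\<close>.\<close>
  also have "\<dots> \<le> (\<integral>\<^sup>+z. (\<integral>\<^sup>+s. indicator {(z, s). 0 \<le> z \<and> z \<le> x \<and> 0 < s \<and> s < t \<and> g s < z} (z, s) \<partial>lborel) \<partial>lborel)"
  proof (intro nn_integral_mono)
    fix z s :: real
    have "g s < z" if "0 \<le> z" "z \<le> x" "0 < s" "s < left_inverse t0 h z"
    proof -
      have "s < t" using up[of z] that by simp
      then have "ennreal (g s) < ennreal z" using below[of s z] hg[of s] that by simp
      then show ?thesis using g0[of s] by (simp add: ennreal_less_iff)
    qed
    then show "(indicator {0..x} z * indicator {0<..<left_inverse t0 h z} s :: ennreal) \<le> indicator {(z, s). 0 \<le> z \<and> z \<le> x \<and> 0 < s \<and> s < t \<and> g s < z} (z, s)"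
      using up[of z] by (auto simp: indicator_def)
  qed
  also have "\<dots> = (\<integral>\<^sup>+s. (\<integral>\<^sup>+z. indicator {(z, s). 0 \<le> z \<and> z \<le> x \<and> 0 < s \<and> s < t \<and> g s < z} (z, s) \<partial>lborel) \<partial>lborel)"
  proof (rule lborel_pair.Fubini[symmetric])
    have "{p \<in> space (lborel \<Otimes>\<^sub>M lborel). 0 \<le> fst p \<and> fst p \<le> x \<and> 0 < snd p \<and> snd p < t \<and> g (snd p) < fst p} \<in> sets (lborel \<Otimes>\<^sub>M lborel)"
      by measurable
    moreover have "{p \<in> space (lborel \<Otimes>\<^sub>M lborel). 0 \<le> fst p \<and> fst p \<le> x \<and> 0 < snd p \<and> snd p < t \<and> g (snd p) < fst p}
      = {(z, s). 0 \<le> z \<and> z \<le> x \<and> 0 < s \<and> s < t \<and> g s < z}" by (auto simp: space_pair_measure)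
    ultimately show "indicator {(z, s). 0 \<le> z \<and> z \<le> x \<and> 0 < s \<and> s < t \<and> g s < z} \<in> borel_measurable (lborel \<Otimes>\<^sub>M lborel)"
      by (intro borel_measurable_indicator) simp
  qed
  also have "\<dots> = (\<integral>\<^sup>+s. ennreal (x - g s) * indicator {0<..<t} s \<partial>lborel)"
  proof (intro nn_integral_cong)
    fix s :: real
    have "(\<integral>\<^sup>+z. indicator {(z, s). 0 \<le> z \<and> z \<le> x \<and> 0 < s \<and> s < t \<and> g s < z} (z, s) \<partial>lborel) = (\<integral>\<^sup>+z. indicator {0<..<t} s * indicator {g s<..x} z \<partial>lborel)"
      by (intro nn_integral_cong) (use g0[of s] in \<open>auto simp: indicator_def\<close>)
    also have "\<dots> = ennreal (x - g s) * indicator {0<..<t} s"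
      by (cases "g s \<le> x") (simp_all add: nn_integral_cmult mult.commute ennreal_neg)
    finally show "(\<integral>\<^sup>+z. indicator {(z, s). 0 \<le> z \<and> z \<le> x \<and> 0 < s \<and> s < t \<and> g s < z} (z, s) \<partial>lborel) = ennreal (x - g s) * indicator {0<..<t} s" .
  qed
  finally have 1: "(\<integral>\<^sup>+z\<in>{0..x}. ennreal (left_inverse t0 h z) \<partial>lborel) \<le> (\<integral>\<^sup>+s. ennreal (x - g s) * indicator {0<..<t} s \<partial>lborel)" .
  have 2: "(\<integral>\<^sup>+s\<in>{0..t}. h s \<partial>lborel) = (\<integral>\<^sup>+s. ennreal (g s) * indicator {0<..<t} s \<partial>lborel)"
  proof -
    have "(\<integral>\<^sup>+s\<in>{0..t}. h s \<partial>lborel) = (\<integral>\<^sup>+s. ennreal (g s) * indicator {0..t} s \<partial>lborel)"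
      by (intro nn_integral_cong) (auto simp: indicator_def hg[symmetric])
    also have "\<dots> = (\<integral>\<^sup>+s. ennreal (g s) * indicator {0<..<t} s \<partial>lborel)"
    proof (rule nn_integral_cong_AE)
      \<comment> \<open>The infimum ranges over positive arguments, so \<open>below\<close> says
        nothing at 0; the end points form a null set.\<close>
      show "AE s in lborel. ennreal (g s) * indicator {0..t} s = ennreal (g s) * indicator {0<..<t} s"
        using AE_lborel_singleton[of 0] AE_lborel_singleton[of t] by eventually_elim (auto simp: indicator_def)
    qed
    finally show ?thesis .
  qed
  have "(\<integral>\<^sup>+s. ennreal (x - g s) * indicator {0<..<t} s \<partial>lborel) + (\<integral>\<^sup>+s. ennreal (g s) * indicator {0<..<t} s \<partial>lborel)
    = (\<integral>\<^sup>+s. ennreal (x - g s) * indicator {0<..<t} s + ennreal (g s) * indicator {0<..<t} s \<partial>lborel)"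
    by (rule nn_integral_add[symmetric]) measurable
  also have "\<dots> = (\<integral>\<^sup>+s. ennreal x * indicator {0<..<t} s \<partial>lborel)"
  proof (intro nn_integral_cong)
    fix s :: real
    show "ennreal (x - g s) * indicator {0<..<t} s + ennreal (g s) * indicator {0<..<t} s = ennreal x * indicator {0<..<t} s"
    proof (cases "s \<in> {0<..<t}")
      case True
      then have "ennreal (g s) < ennreal x" using below[of s x] hg[of s] by (simp add: t_def)
      then have "g s < x" using g0[of s] by (simp add: ennreal_less_iff)
      then show ?thesis using True g0[of s] by (simp flip: ennreal_plus)
    qed simp
  qed
  also have "\<dots> = ennreal (t * x)" using t x by (simp add: nn_integral_cmult ennreal_mult mult.commute)
  finally show "(\<integral>\<^sup>+z\<in>{0..x}. ennreal (left_inverse t0 h z) \<partial>lborel) + (\<integral>\<^sup>+s\<in>{0..t}. h s \<partial>lborel) \<le> ennreal (t * x)"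
    unfolding 2 using 1 by (metis (no_types, lifting) add_right_mono)
qed

text \<open>Chernoff's bound at \<open>t = left_inverse t0 h y\<close>, the optimal parameter when
  \<open>h\<close> is continuous. The area comparison bounds the integral of \<open>h\<close> over
  [0, t] minus \<open>t * y\<close> by minus the integral of the inverse over [0, y].\<close>

lemma (in exp_moment) deviation_inverse:
  assumes h: "\<And>s. s \<in> {0..<t0} \<Longrightarrow> ennreal (mgf' s / mgf s - expectation F) \<le> h s"
    and mono: "mono_on {0..<t0} h" and fin: "\<And>s. s \<in> {0..<t0} \<Longrightarrow> h s < \<infinity>"
    and y: "0 < y" "ennreal y < Lim (at_left t0) h"
  shows "prob {x \<in> space M. y \<le> F x - expectation F} \<le> exp (- (LINT s:{0..y}|lborel. left_inverse t0 h s))"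
\<comment> \<open>Without integrability the Bochner integral is 0 by convention and the right-hand
  side is 1.\<close>
proof (cases "set_integrable lborel {0..y} (left_inverse t0 h)")
  case False
  then have "(LINT s:{0..y}|lborel. left_inverse t0 h s) = 0"
    by (simp add: set_integrable_def set_lebesgue_integral_def not_integrable_integral_eq)
  then show ?thesis by simp
next
  case True
  let ?I = "LINT s:{0..y}|lborel. left_inverse t0 h s"
  define t where "t = left_inverse t0 h y"
  note area = left_inverse_area[OF mono fin y(1) left_limit_exceeds[OF t0 mono y(2)], folded t_def]
  let ?L = "ln (mgf t) - t * expectation F"
  have "ennreal ?I = (\<integral>\<^sup>+s. ennreal (indicator {0..y} s *\<^sub>R left_inverse t0 h s) \<partial>lborel)"
    unfolding set_lebesgue_integral_def using True[unfolded set_integrable_def]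
    by (intro nn_integral_eq_integral[symmetric]) (use area(2) in \<open>auto simp: indicator_def\<close>)
  also have "\<dots> = (\<integral>\<^sup>+s\<in>{0..y}. ennreal (left_inverse t0 h s) \<partial>lborel)"
    by (intro nn_integral_cong) (auto simp: indicator_def)
  finally have I: "ennreal ?I = (\<integral>\<^sup>+s\<in>{0..y}. ennreal (left_inverse t0 h s) \<partial>lborel)" .
  have I0: "0 \<le> ?I"
    unfolding set_lebesgue_integral_def by (intro Bochner_Integration.integral_nonneg) (use area(2) in \<open>auto simp: indicator_def\<close>)
  have le: "ennreal ?I + ennreal ?L \<le> ennreal (t * y)"
    unfolding I by (rule order_trans[OF add_left_mono[OF ln_mgf_le[OF h area(1)]] area(3)])
  have pos_part: "ennreal ?L = ennreal (max 0 ?L)" by (cases "0 \<le> ?L") (auto simp: max_def ennreal_neg)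
  have "ennreal (?I + max 0 ?L) \<le> ennreal (t * y)"
    using le unfolding pos_part by (subst ennreal_plus[OF I0]) simp_all
  moreover have "0 \<le> t * y" using area(1) y(1) by simp
  ultimately have "?I + max 0 ?L \<le> t * y" by (simp only: ennreal_le_iff)
  then have "?L - t * y \<le> - ?I" by linarith
  then show ?thesis using chernoff[of t y] area(1) by (auto intro: order_trans)
qed

section \<open>Herbst's argument on Poisson space\<close>

context poisson_cells
begin

text \<open>\<open>covariance_le\<close> with \<open>G = w = exp (s * F)\<close>: the gradient of
  \<open>G\<close> carries the factor \<open>exp (s * F)\<close> at the first configuration, and the
  rest is the integrand of \<open>diff_pairing\<close>.\<close>

lemma exp_covariance_le:
  assumes F: "F \<in> dom_diff \<nu> P" and E: "(\<lambda>\<omega>. exp (s * F \<omega>)) \<in> dom_diff \<nu> P" and c: "0 \<le> c"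
    and bound: "AE x in P \<Otimes>\<^sub>M P. diff_pairing \<nu> F s (fst x) (snd x) \<le> ennreal c"
  shows "(\<integral>\<omega>. F \<omega> * exp (s * F \<omega>) \<partial>P) - (\<integral>\<omega>. F \<omega> \<partial>P) * (\<integral>\<omega>. exp (s * F \<omega>) \<partial>P) \<le> c * (\<integral>\<omega>. exp (s * F \<omega>) \<partial>P)"
proof (rule covariance_le[OF F E])
  have e: "square_integrable P (\<lambda>\<omega>. exp (s * F \<omega>))" using E unfolding dom_diff_iff by blast
  have o: "square_integrable P (\<lambda>_. 1)" by (simp add: square_integrable_def)
  from square_integrable_mult[OF e o] show "integrable P (\<lambda>\<omega>. exp (s * F \<omega>))" by simp
  show "AE x in P \<Otimes>\<^sub>M P. (\<integral>y. grad (\<lambda>\<omega>. exp (s * F \<omega>)) (fst x, y) * grad F (snd x, y) \<partial>\<nu>) \<le> c * exp (s * F (fst x))"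
    using bound
  proof eventually_elim
    case (elim x)
    let ?g = "\<lambda>y. (exp (s * diff_op F y (fst x)) - 1) * diff_op F y (snd x)"
    have "\<bar>\<integral>y. ?g y \<partial>\<nu>\<bar> \<le> c"
      \<comment> \<open>A finite bound excludes the value infinity, so the integrand is integrable
        and the pairing is the absolute value of its integral.\<close>
      using elim c by (auto simp: diff_pairing_def Let_def top_unique split: if_splits)
    then have "exp (s * F (fst x)) * (\<integral>y. ?g y \<partial>\<nu>) \<le> exp (s * F (fst x)) * c"
      by (intro mult_left_mono) auto
    moreover have "grad (\<lambda>\<omega>. exp (s * F \<omega>)) (fst x, y) * grad F (snd x, y) = exp (s * F (fst x)) * ?g y" for y
    proof -
      have "exp (s * F (insert y (fst x))) = exp (s * F (fst x)) * exp (s * (F (insert y (fst x)) - F (fst x)))"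
        by (simp add: right_diff_distrib flip: exp_add)
      then show ?thesis
        by (simp only: grad_def diff_op_def fst_conv snd_conv Un_insert_right sup_bot_right) (simp only: left_diff_distrib right_diff_distrib mult_1_left mult_1_right mult.assoc)
    qed
    ultimately show ?case by (simp add: mult.commute)
  qed
qed

end

theorem proposition2p2:
  fixes \<nu> :: "'a::metric_space measure"
    and P :: "'a set measure"
    and F :: "'a set \<Rightarrow> real"
    and t0 :: real
    and h :: "real \<Rightarrow> ennreal"
  assumes "sigma_compact (UNIV :: 'a set)"
    and "radon_measure \<nu>"
    and "diffuse \<nu>"
    and "poisson_measure \<nu> P"
    and "F \<in> dom_diff \<nu> P"
    and "0 < t0"
    and "\<forall>s\<in>{0..t0}. (\<lambda>\<omega>. exp (s * F \<omega>)) \<in> dom_diff \<nu> P"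
    and "h = h_sup \<nu> F \<or> h = h_esssup \<nu> P F"
  shows "(\<forall>x>0. ereal (measure P {\<omega> \<in> space P. F \<omega> - (\<integral>\<omega>'. F \<omega>' \<partial>P) \<ge> x})
            \<le> exp_ereal (INF t\<in>{0<..<t0}.
                 enn2ereal (\<integral>\<^sup>+ s\<in>{0..t}. h s \<partial>lborel) - ereal (t * x))) \<and>
         (mono_on {0..<t0} h \<and> (\<forall>s\<in>{0..<t0}. h s < \<infinity>) \<longrightarrow>
           (\<forall>x. 0 < x \<and> ennreal x < Lim (at_left t0) h \<longrightarrow>
             measure P {\<omega> \<in> space P. F \<omega> - (\<integral>\<omega>'. F \<omega>' \<partial>P) \<ge> x}
               \<le> exp (- (LINT s:{0..x}|lborel. left_inverse t0 h s))))"
proof -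
  obtain A :: "nat \<Rightarrow> 'a set" where A: "\<And>i. A i \<in> sets borel" "\<And>i. \<exists>K. compact K \<and> A i \<subseteq> K"
    "\<And>U y. open U \<Longrightarrow> y \<in> U \<Longrightarrow> \<exists>i. y \<in> A i \<and> A i \<subseteq> U"
    using sigma_compact_base[OF assms(1)] by blast
  interpret poisson_cells A \<nu> P
    by (intro poisson_cells.intro cell_base.intro poisson_cells_axioms.intro A assms(2-4))
  interpret X: exp_moment P F t0
  proof unfold_locales
    show "square_integrable P F" using assms(5) unfolding dom_diff_iff by blast
    have "(\<lambda>\<omega>. exp (t0 * F \<omega>)) \<in> dom_diff \<nu> P" using assms(6,7) by simp
    then show "square_integrable P (\<lambda>x. exp (t0 * F x))" unfolding dom_diff_iff by blast
  qed (rule assms(6))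
  \<comment> \<open>Both readings of the supremum are used only through this almost sure bound,
    which treats them alike.\<close>
  have pairing: "AE x in P \<Otimes>\<^sub>M P. diff_pairing \<nu> F s (fst x) (snd x) \<le> h s" for s
    using assms(8)
  proof
    assume h: "h = h_sup \<nu> F"
    show ?thesis
    proof (rule AE_I2)
      fix x assume "x \<in> space (P \<Otimes>\<^sub>M P)"
      then have "x \<in> config_space \<times> config_space" by (simp add: space_pair_measure)
      then show "diff_pairing \<nu> F s (fst x) (snd x) \<le> h s"
        unfolding h h_sup_def by (intro SUP_upper2[of x]) (auto simp: case_prod_beta)
    qed
  next
    assume h: "h = h_esssup \<nu> P F"
    show ?thesis
      unfolding h h_esssup_def using esssup_AE[of "\<lambda>(\<omega>, \<omega>'). diff_pairing \<nu> F s \<omega> \<omega>'" "P \<Otimes>\<^sub>M P"]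
      by (simp add: case_prod_beta)
  qed
  \<comment> \<open>An infinite \<open>h s\<close> bounds everything; otherwise the covariance
    estimate is divided by the positive \<open>X.mgf s\<close>.\<close>
  have h: "ennreal (X.mgf' s / X.mgf s - P.expectation F) \<le> h s" if s: "s \<in> {0..<t0}" for s
  proof (cases "h s = \<infinity>")
    case False
    define c where "c = enn2real (h s)"
    have hc: "h s = ennreal c" and c: "0 \<le> c" using False by (simp_all add: c_def less_top[symmetric])
    have "X.mgf' s - P.expectation F * X.mgf s \<le> c * X.mgf s"
      unfolding X.mgf'_def X.mgf_def
      by (rule exp_covariance_le[OF assms(5) _ c pairing[of s, unfolded hc]]) (use assms(7) s in auto)
    moreover have "0 < X.mgf s" using X.mgf_pos[of s] s by auto
    ultimately have "X.mgf' s / X.mgf s - P.expectation F \<le> c" by (simp add: field_simps)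
    then show ?thesis unfolding hc by (rule ennreal_leI)
  qed simp
  show ?thesis
    using X.deviation_INF[OF h] X.deviation_inverse[OF h] by blast
qed

end
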